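(* Let $O$ be a Dedekind ring with field of fractions $E$, let $T$ be a locally free (projective) $O$-module of finite positive rank, let $\mathfrak{m}$ be a maximal ideal of $O$ with residue field $k=O/\mathfrak{m}$, and put $T_E=T\otimes_O E$ and $T_k=T/\mathfrak{m}T=T\otimes_O k$. Let $G$ be a group and $\rho:G\to\mathrm{Aut}_O(T)$ a group homomorphism, and let $\rho_E:G\to\mathrm{Aut}_E(T_E)$ and $\rho_k:G\to\mathrm{Aut}_k(T_k)$ be the induced representations ($t\otimes e\mapsto\rho(\sigma)(t)\otimes e$ and $t\otimes c\mapsto\rho(\sigma)(t)\otimes c$). If $\rho_k$ is central simple (resp. very simple), then $\rho_E$ is central simple (resp. very simple).
   Context: For a field $F$, a group $G$ and a representation $\rho:G\to\mathrm{Aut}_F(V)$, an $F$-subalgebra $R\subset\mathrm{End}_F(V)$ containing $\mathrm{Id}$ is $G$-normal if $\rho(\sigma)R\rho(\sigma)^{-1}\subset R$ for all $\sigma\in G$. The representation is very simple if every $G$-normal subalgebra equals $F\cdot\mathrm{Id}$ or $\mathrm{End}_F(V)$, and central simple if every $G$-normal subalgebra is a central simple $F$-algebra. *)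

theory Defs
  imports "HOL-Algebra.Algebra"
begin

section \<open>Linear maps, free and projective modules, dimension\<close>

definition linear_maps ::
    "('a, 'x) ring_scheme \<Rightarrow> ('a, 'b, 'y) module_scheme \<Rightarrow> ('a, 'c, 'z) module_scheme
      \<Rightarrow> ('b \<Rightarrow> 'c) set"
  where "linear_maps R M N =
    {f \<in> carrier M \<rightarrow>\<^sub>E carrier N.
      (\<forall>x\<in>carrier M. \<forall>y\<in>carrier M. f (x \<oplus>\<^bsub>M\<^esub> y) = f x \<oplus>\<^bsub>N\<^esub> f y) \<and>
      (\<forall>a\<in>carrier R. \<forall>x\<in>carrier M. f (a \<odot>\<^bsub>M\<^esub> x) = a \<odot>\<^bsub>N\<^esub> f x)}"

text \<open>The algebra of endomorphisms. Its elements are extensional, so that equality in the carrier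
  is equality of maps on \<^term>\<open>carrier V\<close>.\<close>

definition End_module ::
    "('a, 'x) ring_scheme \<Rightarrow> ('a, 'b, 'y) module_scheme \<Rightarrow> ('a, 'b \<Rightarrow> 'b) module"
  where "End_module R V =
    \<lparr>carrier = linear_maps R V V,
     monoid.mult = compose (carrier V),
     one = (\<lambda>x\<in>carrier V. x),
     ring.zero = (\<lambda>x\<in>carrier V. \<zero>\<^bsub>V\<^esub>),
     add = (\<lambda>f g. \<lambda>x\<in>carrier V. f x \<oplus>\<^bsub>V\<^esub> g x),
     smult = (\<lambda>a f. \<lambda>x\<in>carrier V. a \<odot>\<^bsub>V\<^esub> f x)\<rparr>"

definition Aut_module ::
    "('a, 'x) ring_scheme \<Rightarrow> ('a, 'b, 'y) module_scheme \<Rightarrow> ('b \<Rightarrow> 'b) monoid"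
  where "Aut_module R V = units_of (End_module R V)"

text \<open>The free module on \<open>I\<close>; its ring multiplication and unit are junk.\<close>

definition free_module :: "('a, 'x) ring_scheme \<Rightarrow> 'i set \<Rightarrow> ('a, 'i \<Rightarrow> 'a) module"
  where "free_module R I =
    \<lparr>carrier = {f \<in> I \<rightarrow>\<^sub>E carrier R. finite {i \<in> I. f i \<noteq> \<zero>\<^bsub>R\<^esub>}},
     monoid.mult = undefined,
     one = undefined,
     ring.zero = (\<lambda>i\<in>I. \<zero>\<^bsub>R\<^esub>),
     add = (\<lambda>f g. \<lambda>i\<in>I. f i \<oplus>\<^bsub>R\<^esub> g i),
     smult = (\<lambda>a f. \<lambda>i\<in>I. a \<otimes>\<^bsub>R\<^esub> f i)\<rparr>"

text \<open>Projective means: a direct summand of a free module. Taking the index set inside the type of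
  elements of \<open>P\<close> loses nothing, because a projective \<open>P\<close> is a direct summand of the free module
  on \<^term>\<open>carrier P\<close>.\<close>

definition projective_module ::
    "('a, 'x) ring_scheme \<Rightarrow> ('a, 'b, 'y) module_scheme \<Rightarrow> bool"
  where "projective_module R P \<longleftrightarrow>
    (\<exists>(I :: 'b set) s p.
      s \<in> linear_maps R P (free_module R I) \<and>
      p \<in> linear_maps R (free_module R I) P \<and>
      (\<forall>x\<in>carrier P. p (s x) = x))"

definition finite_basis ::
    "('a, 'x) ring_scheme \<Rightarrow> ('a, 'b, 'y) module_scheme \<Rightarrow> 'b set \<Rightarrow> bool"
  where "finite_basis K V B \<longleftrightarrow>
    finite B \<and> B \<subseteq> carrier V \<and>
    (\<forall>v\<in>carrier V. \<exists>!c. c \<in> B \<rightarrow>\<^sub>E carrier K \<and> v = (\<Oplus>\<^bsub>V\<^esub>b\<in>B. c b \<odot>\<^bsub>V\<^esub> b))"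

definition finite_dimensional ::
    "('a, 'x) ring_scheme \<Rightarrow> ('a, 'b, 'y) module_scheme \<Rightarrow> bool"
  where "finite_dimensional K V \<longleftrightarrow>
    (\<exists>B. finite B \<and> B \<subseteq> carrier V \<and>
      (\<forall>v\<in>carrier V. \<exists>c. c \<in> B \<rightarrow>\<^sub>E carrier K \<and> v = (\<Oplus>\<^bsub>V\<^esub>b\<in>B. c b \<odot>\<^bsub>V\<^esub> b)))"


section \<open>Extension of scalars\<close>

text \<open>For a ring homomorphism \<open>f\<close> from \<open>R\<close> to \<open>S\<close>, the tensor product of \<open>M\<close> and \<open>S\<close> over \<open>R\<close> is
  the free abelian group on \<^term>\<open>carrier M \<times> carrier S\<close> modulo the subgroup generated by the
  bilinearity relations; the class of \<^term>\<open>frag_of (x, s)\<close> is the pure tensor of \<open>x\<close> and \<open>s\<close>.\<close>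

definition tensor_free ::
    "('a, 'b, 'y) module_scheme \<Rightarrow> ('s, 'z) ring_scheme \<Rightarrow> ('b \<times> 's \<Rightarrow>\<^sub>0 int) monoid"
  where "tensor_free M S = free_Abelian_group (carrier M \<times> carrier S)"

definition tensor_relations ::
    "('a, 'x) ring_scheme \<Rightarrow> ('s, 'z) ring_scheme \<Rightarrow> ('a \<Rightarrow> 's) \<Rightarrow> ('a, 'b, 'y) module_scheme
      \<Rightarrow> ('b \<times> 's \<Rightarrow>\<^sub>0 int) set"
  where "tensor_relations R S f M =
    {frag_of (x \<oplus>\<^bsub>M\<^esub> y, s) - frag_of (x, s) - frag_of (y, s) | x y s.
       x \<in> carrier M \<and> y \<in> carrier M \<and> s \<in> carrier S} \<union>
    {frag_of (x, s \<oplus>\<^bsub>S\<^esub> t) - frag_of (x, s) - frag_of (x, t) | x s t.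
       x \<in> carrier M \<and> s \<in> carrier S \<and> t \<in> carrier S} \<union>
    {frag_of (a \<odot>\<^bsub>M\<^esub> x, s) - frag_of (x, f a \<otimes>\<^bsub>S\<^esub> s) | a x s.
       a \<in> carrier R \<and> x \<in> carrier M \<and> s \<in> carrier S}"

definition tensor_kernel ::
    "('a, 'x) ring_scheme \<Rightarrow> ('s, 'z) ring_scheme \<Rightarrow> ('a \<Rightarrow> 's) \<Rightarrow> ('a, 'b, 'y) module_scheme
      \<Rightarrow> ('b \<times> 's \<Rightarrow>\<^sub>0 int) set"
  where "tensor_kernel R S f M = generate (tensor_free M S) (tensor_relations R S f M)"

definition pure_tensor ::
    "('a, 'x) ring_scheme \<Rightarrow> ('s, 'z) ring_scheme \<Rightarrow> ('a \<Rightarrow> 's) \<Rightarrow> ('a, 'b, 'y) module_scheme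
      \<Rightarrow> 'b \<Rightarrow> 's \<Rightarrow> ('b \<times> 's \<Rightarrow>\<^sub>0 int) set"
  where "pure_tensor R S f M x s = tensor_kernel R S f M #>\<^bsub>tensor_free M S\<^esub> frag_of (x, s)"

text \<open>The additive map on cosets that sends the class of the generator \<open>(x, s)\<close> to the class of
  \<open>g (x, s)\<close>, provided \<open>g\<close> respects the relations.\<close>

definition tensor_induced ::
    "('a, 'x) ring_scheme \<Rightarrow> ('s, 'z) ring_scheme \<Rightarrow> ('a \<Rightarrow> 's) \<Rightarrow> ('a, 'b, 'y) module_scheme
      \<Rightarrow> ('b \<times> 's \<Rightarrow> 'b \<times> 's) \<Rightarrow> ('b \<times> 's \<Rightarrow>\<^sub>0 int) set \<Rightarrow> ('b \<times> 's \<Rightarrow>\<^sub>0 int) set"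
  where "tensor_induced R S f M g u =
    tensor_kernel R S f M <#>\<^bsub>tensor_free M S\<^esub> frag_extend (\<lambda>p. frag_of (g p)) ` u"

definition base_change ::
    "('a, 'x) ring_scheme \<Rightarrow> ('s, 'z) ring_scheme \<Rightarrow> ('a \<Rightarrow> 's) \<Rightarrow> ('a, 'b, 'y) module_scheme
      \<Rightarrow> ('s, ('b \<times> 's \<Rightarrow>\<^sub>0 int) set) module"
  where "base_change R S f M =
    \<lparr>carrier = carrier (tensor_free M S Mod tensor_kernel R S f M),
     monoid.mult = undefined,
     one = undefined,
     ring.zero = \<one>\<^bsub>tensor_free M S Mod tensor_kernel R S f M\<^esub>,
     add = (\<lambda>u v. u \<otimes>\<^bsub>tensor_free M S Mod tensor_kernel R S f M\<^esub> v),
     smult = (\<lambda>s. tensor_induced R S f M (\<lambda>(x, t). (x, s \<otimes>\<^bsub>S\<^esub> t)))\<rparr>"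

definition base_change_map ::
    "('a, 'x) ring_scheme \<Rightarrow> ('s, 'z) ring_scheme \<Rightarrow> ('a \<Rightarrow> 's) \<Rightarrow> ('a, 'b, 'y) module_scheme
      \<Rightarrow> ('b \<Rightarrow> 'b) \<Rightarrow> ('b \<times> 's \<Rightarrow>\<^sub>0 int) set \<Rightarrow> ('b \<times> 's \<Rightarrow>\<^sub>0 int) set"
  where "base_change_map R S f M h =
    (\<lambda>u\<in>carrier (base_change R S f M). tensor_induced R S f M (\<lambda>(x, t). (h x, t)) u)"

definition base_change_rep ::
    "('a, 'x) ring_scheme \<Rightarrow> ('s, 'z) ring_scheme \<Rightarrow> ('a \<Rightarrow> 's) \<Rightarrow> ('a, 'b, 'y) module_scheme
      \<Rightarrow> ('g \<Rightarrow> 'b \<Rightarrow> 'b) \<Rightarrow> 'g \<Rightarrow> ('b \<times> 's \<Rightarrow>\<^sub>0 int) set \<Rightarrow> ('b \<times> 's \<Rightarrow>\<^sub>0 int) set"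
  where "base_change_rep R S f M \<rho> \<sigma> = base_change_map R S f M (\<rho> \<sigma>)"


section \<open>Dedekind rings and rank\<close>

definition field_of_fractions ::
    "('a, 'x) ring_scheme \<Rightarrow> ('e, 'y) ring_scheme \<Rightarrow> ('a \<Rightarrow> 'e) \<Rightarrow> bool"
  where "field_of_fractions R E \<iota> \<longleftrightarrow>
    domain R \<and> field E \<and> \<iota> \<in> ring_hom R E \<and> inj_on \<iota> (carrier R) \<and>
    (\<forall>z\<in>carrier E. \<exists>a\<in>carrier R. \<exists>b\<in>carrier R - {\<zero>\<^bsub>R\<^esub>}.
      z = \<iota> a \<otimes>\<^bsub>E\<^esub> inv\<^bsub>E\<^esub> (\<iota> b))"

text \<open>Polynomials are coefficient lists with the leading coefficient first.\<close>

definition integral_over ::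
    "('a, 'x) ring_scheme \<Rightarrow> ('e, 'y) ring_scheme \<Rightarrow> ('a \<Rightarrow> 'e) \<Rightarrow> 'e \<Rightarrow> bool"
  where "integral_over R E \<iota> z \<longleftrightarrow>
    (\<exists>p. p \<noteq> [] \<and> set p \<subseteq> carrier R \<and> hd p = \<one>\<^bsub>R\<^esub> \<and>
      ring.eval E (map \<iota> p) z = \<zero>\<^bsub>E\<^esub>)"

text \<open>A Dedekind ring together with a field of fractions \<open>E\<close>. Fields are Dedekind rings under this
  definition.\<close>

definition dedekind_ring ::
    "('a, 'x) ring_scheme \<Rightarrow> ('e, 'y) ring_scheme \<Rightarrow> ('a \<Rightarrow> 'e) \<Rightarrow> bool"
  where "dedekind_ring R E \<iota> \<longleftrightarrow>
    noetherian_domain R \<and> field_of_fractions R E \<iota> \<and>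
    (\<forall>z\<in>carrier E. integral_over R E \<iota> z \<longrightarrow> z \<in> \<iota> ` carrier R) \<and>
    (\<forall>P. primeideal P R \<and> P \<noteq> {\<zero>\<^bsub>R\<^esub>} \<longrightarrow> maximalideal P R)"

definition has_rank ::
    "('a, 'x) ring_scheme \<Rightarrow> ('e, 'y) ring_scheme \<Rightarrow> ('a \<Rightarrow> 'e) \<Rightarrow> ('a, 'b, 'z) module_scheme
      \<Rightarrow> nat \<Rightarrow> bool"
  where "has_rank R E \<iota> M n \<longleftrightarrow> (\<exists>B. finite_basis E (base_change R E \<iota> M) B \<and> card B = n)"


section \<open>Very simple and central simple representations\<close>

definition assoc_algebra :: "('a, 'x) ring_scheme \<Rightarrow> ('a, 'b, 'y) module_scheme \<Rightarrow> bool"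
  where "assoc_algebra K A \<longleftrightarrow>
    module K A \<and> ring A \<and>
    (\<forall>a\<in>carrier K. \<forall>x\<in>carrier A. \<forall>y\<in>carrier A.
      (a \<odot>\<^bsub>A\<^esub> x) \<otimes>\<^bsub>A\<^esub> y = a \<odot>\<^bsub>A\<^esub> (x \<otimes>\<^bsub>A\<^esub> y) \<and>
      x \<otimes>\<^bsub>A\<^esub> (a \<odot>\<^bsub>A\<^esub> y) = a \<odot>\<^bsub>A\<^esub> (x \<otimes>\<^bsub>A\<^esub> y))"

definition algebra_center :: "('b, 'y) ring_scheme \<Rightarrow> 'b set"
  where "algebra_center A = {x \<in> carrier A. \<forall>y\<in>carrier A. x \<otimes>\<^bsub>A\<^esub> y = y \<otimes>\<^bsub>A\<^esub> x}"

definition scalars :: "('a, 'x) ring_scheme \<Rightarrow> ('a, 'b, 'y) module_scheme \<Rightarrow> 'b set"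
  where "scalars K A = (\<lambda>a. a \<odot>\<^bsub>A\<^esub> \<one>\<^bsub>A\<^esub>) ` carrier K"

definition central_simple_algebra ::
    "('a, 'x) ring_scheme \<Rightarrow> ('a, 'b, 'y) module_scheme \<Rightarrow> bool"
  where "central_simple_algebra K A \<longleftrightarrow>
    field K \<and> assoc_algebra K A \<and> finite_dimensional K A \<and>
    carrier A \<noteq> {\<zero>\<^bsub>A\<^esub>} \<and>
    (\<forall>I. ideal I A \<longrightarrow> I = {\<zero>\<^bsub>A\<^esub>} \<or> I = carrier A) \<and>
    algebra_center A = scalars K A"

definition normal_subalgebra ::
    "('a, 'x) ring_scheme \<Rightarrow> ('a, 'b, 'y) module_scheme \<Rightarrow> ('g, 'h) monoid_scheme
      \<Rightarrow> ('g \<Rightarrow> 'b \<Rightarrow> 'b) \<Rightarrow> ('b \<Rightarrow> 'b) set \<Rightarrow> bool"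
  where "normal_subalgebra K V G \<rho> A \<longleftrightarrow>
    subring A (End_module K V) \<and>
    (\<forall>a\<in>carrier K. \<forall>u\<in>A. a \<odot>\<^bsub>End_module K V\<^esub> u \<in> A) \<and>
    (\<forall>\<sigma>\<in>carrier G. \<forall>u\<in>A.
      \<rho> \<sigma> \<otimes>\<^bsub>End_module K V\<^esub> u \<otimes>\<^bsub>End_module K V\<^esub> inv\<^bsub>End_module K V\<^esub> (\<rho> \<sigma>) \<in> A)"

definition very_simple_rep ::
    "('a, 'x) ring_scheme \<Rightarrow> ('a, 'b, 'y) module_scheme \<Rightarrow> ('g, 'h) monoid_scheme
      \<Rightarrow> ('g \<Rightarrow> 'b \<Rightarrow> 'b) \<Rightarrow> bool"
  where "very_simple_rep K V G \<rho> \<longleftrightarrow>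
    (\<forall>A. normal_subalgebra K V G \<rho> A \<longrightarrow>
      A = scalars K (End_module K V) \<or> A = carrier (End_module K V))"

definition central_simple_rep ::
    "('a, 'x) ring_scheme \<Rightarrow> ('a, 'b, 'y) module_scheme \<Rightarrow> ('g, 'h) monoid_scheme
      \<Rightarrow> ('g \<Rightarrow> 'b \<Rightarrow> 'b) \<Rightarrow> bool"
  where "central_simple_rep K V G \<rho> \<longleftrightarrow>
    (\<forall>A. normal_subalgebra K V G \<rho> A \<longrightarrow>
      central_simple_algebra K ((End_module K V)\<lparr>carrier := A\<rparr>))"


section \<open>Extension of scalars is well defined\<close>

lemma diff_regroup:
  fixes p q r :: "'q :: ab_group_add"
  shows "(p - p') - ((q - q') + (r - r')) = (p - (q + r)) - (p' - (q' + r'))"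
  by simp

locale scalar_extension = M?: Module.module R M + S?: cring S
  for R (structure) and S (structure) and f and M (structure) +
  assumes f_hom: "f \<in> ring_hom R S"
begin

abbreviation (input) "F \<equiv> tensor_free M S"
abbreviation (input) "N \<equiv> tensor_kernel R S f M"
abbreviation "T \<equiv> base_change R S f M"

lemma f_closed: "a \<in> carrier R \<Longrightarrow> f a \<in> carrier S"
  using f_hom by (rule ring_hom_closed)

lemma comm_group_F: "comm_group F"
  by (simp add: tensor_free_def abelian_free_Abelian_group)

lemma mult_F: "x \<otimes>\<^bsub>F\<^esub> y = x + y"
  by (simp add: tensor_free_def)

lemma group_F: "group F"
  by (simp add: tensor_free_def)

lemma in_F: "a \<in> carrier F \<longleftrightarrow> Poly_Mapping.keys a \<subseteq> carrier M \<times> carrier S"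
  by (simp add: tensor_free_def)

lemma F_diff: "a \<in> carrier F \<Longrightarrow> b \<in> carrier F \<Longrightarrow> a - b \<in> carrier F"
  unfolding in_F using keys_diff[of a b] by blast

lemma F_add: "a \<in> carrier F \<Longrightarrow> b \<in> carrier F \<Longrightarrow> a + b \<in> carrier F"
  unfolding in_F using keys_add[of a b] by blast

lemma F_gen: "x \<in> carrier M \<Longrightarrow> s \<in> carrier S \<Longrightarrow> frag_of (x, s) \<in> carrier F"
  unfolding in_F by simp

lemma relations_carrier: "tensor_relations R S f M \<subseteq> carrier F"
proof
  fix r assume "r \<in> tensor_relations R S f M"
  then show "r \<in> carrier F"
    unfolding tensor_relations_def
    by (elim UnE CollectE exE conjE) (simp_all add: F_diff F_gen f_closed)
qed

lemma subgroup_N: "subgroup N F"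
  unfolding tensor_kernel_def
  using group_F relations_carrier by (rule group.generate_is_subgroup)

lemma normal_N: "N \<lhd> F"
  using comm_group.subgroup_imp_normal[OF comm_group_F subgroup_N] .

abbreviation "lift g \<equiv> frag_extend (\<lambda>p. frag_of (g p))"

definition "tensor_compatible g \<longleftrightarrow>
   g ` (carrier M \<times> carrier S) \<subseteq> carrier M \<times> carrier S \<and> lift g ` tensor_relations R S f M \<subseteq> N"

lemma lift_carrier:
  assumes "g ` (carrier M \<times> carrier S) \<subseteq> carrier M \<times> carrier S" "a \<in> carrier F"
  shows "lift g a \<in> carrier F"
  using keys_frag_extend[of "\<lambda>p. frag_of (g p)" a] assms
  unfolding in_F by auto

lemma lift_N:
  assumes g: "tensor_compatible g" and a: "a \<in> N"
  shows "lift g a \<in> N"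
  using a unfolding tensor_kernel_def
proof (induction rule: generate.induct)
  case one
  then show ?case
    using generate.one[of F] by (simp add: tensor_free_def)
next
  case (incl h)
  then show ?case using g by (auto simp: tensor_compatible_def tensor_kernel_def)
next
  case (inv h)
  then have "h \<in> carrier F" "lift g h \<in> N" using relations_carrier g by (auto simp: tensor_compatible_def)
  moreover have "lift g h \<in> carrier F"
    using lift_carrier g \<open>h \<in> carrier F\<close> tensor_compatible_def by blast
  ultimately show ?case
    using subgroup.m_inv_closed[OF subgroup_N \<open>lift g h \<in> N\<close>]
    by (auto simp: tensor_kernel_def tensor_free_def frag_extend_minus)
next
  case (eng h1 h2)
  then show ?case
    using generate.eng[of "lift g h1" F _ "lift g h2"] by (simp add: mult_F frag_extend_add)
qed

lemma induced_coset:
  assumes g: "tensor_compatible g" and a: "a \<in> carrier F"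
  shows "tensor_induced R S f M g (N #>\<^bsub>F\<^esub> a) = N #>\<^bsub>F\<^esub> lift g a"
proof -
  have z: "0 \<in> N" using subgroup.one_closed[OF subgroup_N] by (simp add: tensor_free_def)
  have c: "x + y \<in> N" if "x \<in> N" "y \<in> N" for x y
    using subgroup.m_closed[OF subgroup_N that] by (simp add: mult_F)
  have "tensor_induced R S f M g (N #>\<^bsub>F\<^esub> a) = {x + lift g (y + a) | x y. x \<in> N \<and> y \<in> N}"
    unfolding tensor_induced_def set_mult_def r_coset_def mult_F by blast
  also have "\<dots> = {x + lift g a | x. x \<in> N}"
  proof (intro Set.set_eqI iffI)
    fix v assume "v \<in> {x + lift g (y + a) | x y. x \<in> N \<and> y \<in> N}"
    then obtain x y where xy: "x \<in> N" "y \<in> N" "v = x + lift g (y + a)" by blast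
    then have "v = (x + lift g y) + lift g a" by (simp add: frag_extend_add add.assoc)
    with c[OF xy(1) lift_N[OF g xy(2)]] show "v \<in> {x + lift g a | x. x \<in> N}" by blast
  next
    fix v assume "v \<in> {x + lift g a | x. x \<in> N}"
    then obtain x where "x \<in> N" "v = x + lift g (0 + a)" by auto
    with z show "v \<in> {x + lift g (y + a) | x y. x \<in> N \<and> y \<in> N}" by blast
  qed
  also have "\<dots> = N #>\<^bsub>F\<^esub> lift g a"
    unfolding r_coset_def mult_F by blast
  finally show ?thesis .
qed

lemma carrier_T: "carrier T = (\<lambda>a. N #>\<^bsub>F\<^esub> a) ` carrier F"
  by (simp add: base_change_def carrier_FactGroup)

lemma add_T: "a \<in> carrier F \<Longrightarrow> b \<in> carrier F \<Longrightarrow>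
   (N #>\<^bsub>F\<^esub> a) \<oplus>\<^bsub>T\<^esub> (N #>\<^bsub>F\<^esub> b) = N #>\<^bsub>F\<^esub> (a + b)"
  using normal.rcos_sum[OF normal_N] by (simp add: base_change_def mult_F)


lemma coset_eqI:
  assumes "a \<in> carrier F" "b \<in> carrier F" "a - b \<in> N"
  shows "N #>\<^bsub>F\<^esub> a = N #>\<^bsub>F\<^esub> b"
proof -
  have "a \<in> N #>\<^bsub>F\<^esub> b" using assms(3) by (force simp: r_coset_def mult_F)
  then show ?thesis
    using group.repr_independence[OF _ _ assms(2) subgroup_N] comm_group_F
    by (simp add: comm_group_def)
qed

lemma rel: "x \<in> tensor_relations R S f M \<Longrightarrow> x \<in> N"
  unfolding tensor_kernel_def by (rule generate.incl)

lemma rel1: "x \<in> carrier M \<Longrightarrow> y \<in> carrier M \<Longrightarrow> s \<in> carrier S \<Longrightarrow>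
  frag_of (x \<oplus>\<^bsub>M\<^esub> y, s) - frag_of (x, s) - frag_of (y, s) \<in> N"
  by (rule rel) (auto simp: tensor_relations_def)
lemma rel2: "x \<in> carrier M \<Longrightarrow> s \<in> carrier S \<Longrightarrow> t \<in> carrier S \<Longrightarrow>
  frag_of (x, s \<oplus>\<^bsub>S\<^esub> t) - frag_of (x, s) - frag_of (x, t) \<in> N"
  by (rule rel) (auto simp: tensor_relations_def)
lemma rel3: "a \<in> carrier R \<Longrightarrow> x \<in> carrier M \<Longrightarrow> s \<in> carrier S \<Longrightarrow>
  frag_of (a \<odot>\<^bsub>M\<^esub> x, s) - frag_of (x, f a \<otimes>\<^bsub>S\<^esub> s) \<in> N"
  by (rule rel) (auto simp: tensor_relations_def)

lemma tensor_compatibleI: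
  assumes "\<And>x t. x \<in> carrier M \<Longrightarrow> t \<in> carrier S \<Longrightarrow> g (x, t) \<in> carrier M \<times> carrier S"
    and 1: "\<And>x y t. x \<in> carrier M \<Longrightarrow> y \<in> carrier M \<Longrightarrow> t \<in> carrier S \<Longrightarrow>
      frag_of (g (x \<oplus>\<^bsub>M\<^esub> y, t)) - frag_of (g (x, t)) - frag_of (g (y, t)) \<in> N"
    and 2: "\<And>x s t. x \<in> carrier M \<Longrightarrow> s \<in> carrier S \<Longrightarrow> t \<in> carrier S \<Longrightarrow>
      frag_of (g (x, s \<oplus>\<^bsub>S\<^esub> t)) - frag_of (g (x, s)) - frag_of (g (x, t)) \<in> N"
    and 3: "\<And>a x t. a \<in> carrier R \<Longrightarrow> x \<in> carrier M \<Longrightarrow> t \<in> carrier S \<Longrightarrow>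
      frag_of (g (a \<odot>\<^bsub>M\<^esub> x, t)) - frag_of (g (x, f a \<otimes>\<^bsub>S\<^esub> t)) \<in> N"
  shows "tensor_compatible g"
proof -
  have "lift g r \<in> N" if "r \<in> tensor_relations R S f M" for r
    using that unfolding tensor_relations_def
    by (elim UnE CollectE exE conjE) (simp_all add: frag_extend_diff 1 2 3)
  then show ?thesis using assms(1) by (fastforce simp: tensor_compatible_def)
qed

lemma tensor_compatible_smult:
  assumes "s \<in> carrier S" shows "tensor_compatible (\<lambda>(x, t). (x, s \<otimes>\<^bsub>S\<^esub> t))"
proof -
  have "s \<otimes>\<^bsub>S\<^esub> (f a \<otimes>\<^bsub>S\<^esub> t) = f a \<otimes>\<^bsub>S\<^esub> (s \<otimes>\<^bsub>S\<^esub> t)"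
    if "a \<in> carrier R" "t \<in> carrier S" for a t
    by (rule S.m_lcomm) (use that assms f_closed in simp_all)
  then show ?thesis
    using assms by (intro tensor_compatibleI) (simp_all add: S.r_distr rel1 rel2 rel3)
qed

lemma tensor_compatible_map:
  assumes "h \<in> linear_maps R M M" shows "tensor_compatible (\<lambda>(x, t). (h x, t))"
proof -
  have "h x \<in> carrier M" if "x \<in> carrier M" for x
    using that assms by (auto simp: linear_maps_def)
  then show ?thesis
    using assms by (intro tensor_compatibleI) (simp_all add: linear_maps_def rel1 rel2 rel3)
qed

lemma pure_carrier: "x \<in> carrier M \<Longrightarrow> s \<in> carrier S \<Longrightarrow> pure_tensor R S f M x s \<in> carrier T"
  by (auto simp: carrier_T pure_tensor_def tensor_free_def)

lemma smult_coset: "s \<in> carrier S \<Longrightarrow> a \<in> carrier F \<Longrightarrow>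
   s \<odot>\<^bsub>T\<^esub> (N #>\<^bsub>F\<^esub> a) = N #>\<^bsub>F\<^esub> lift (\<lambda>(x, t). (x, s \<otimes>\<^bsub>S\<^esub> t)) a"
  using induced_coset[OF tensor_compatible_smult] by (simp add: base_change_def)

lemma smult_pure_tensor:
  assumes "x \<in> carrier M" "s \<in> carrier S" "t \<in> carrier S"
  shows "s \<odot>\<^bsub>T\<^esub> pure_tensor R S f M x t = pure_tensor R S f M x (s \<otimes>\<^bsub>S\<^esub> t)"
  using assms smult_coset[of s "frag_of (x,t)"] by (simp add: pure_tensor_def tensor_free_def)

lemma base_change_map_pure_tensor:
  assumes "h \<in> linear_maps R M M" "x \<in> carrier M" "t \<in> carrier S"
  shows "base_change_map R S f M h (pure_tensor R S f M x t) = pure_tensor R S f M (h x) t"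
  using assms pure_carrier[of x t] induced_coset[OF tensor_compatible_map[OF assms(1)], of "frag_of (x,t)"]
  by (simp add: base_change_map_def pure_tensor_def tensor_free_def)

lemma smult_tensor_compatible_carrier: "s \<in> carrier S \<Longrightarrow> a \<in> carrier F \<Longrightarrow> 
  lift (\<lambda>(x, t). (x, s \<otimes>\<^bsub>S\<^esub> t)) a \<in> carrier F"
  using lift_carrier tensor_compatible_smult tensor_compatible_def by blast

lemma N_add: "a \<in> N \<Longrightarrow> b \<in> N \<Longrightarrow> a + b \<in> N"
  using subgroup.m_closed[OF subgroup_N] by (simp add: mult_F)
lemma N_neg: "a \<in> N \<Longrightarrow> - a \<in> N"
  using subgroup.m_inv_closed[OF subgroup_N, of a] subgroup.mem_carrier[OF subgroup_N, of a]
  by (simp add: tensor_free_def)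
lemma N_0: "0 \<in> N"
  using subgroup.one_closed[OF subgroup_N] by (simp add: tensor_free_def)
lemma N_diff: "a \<in> N \<Longrightarrow> b \<in> N \<Longrightarrow> a - b \<in> N"
  using N_add[of a "-b"] N_neg by simp
lemma F_induct [consumes 1, case_names zero gen diff]:
  assumes "a \<in> carrier F" "P 0"
    "\<And>x t. x \<in> carrier M \<Longrightarrow> t \<in> carrier S \<Longrightarrow> P (frag_of (x, t))"
    "\<And>a b. P a \<Longrightarrow> P b \<Longrightarrow> P (a - b)"
  shows "P a"
  using frag_induction[of a "carrier M \<times> carrier S" P] assms by (auto simp: tensor_free_def)

lemma module_base_change: "Module.module S T"
proof (rule moduleI)
  interpret Q: comm_group "F Mod N"
    using comm_group.abelian_FactGroup[OF comm_group_F subgroup_N] .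
  have e: "carrier T = carrier (F Mod N)" "\<And>u v. u \<oplus>\<^bsub>T\<^esub> v = u \<otimes>\<^bsub>F Mod N\<^esub> v"
     "\<zero>\<^bsub>T\<^esub> = \<one>\<^bsub>F Mod N\<^esub>"
    by (simp_all add: base_change_def)
  show "abelian_group T"
  proof (rule abelian_groupI, unfold e)
    fix u v w assume u: "u \<in> carrier (F Mod N)" and v: "v \<in> carrier (F Mod N)"
      and w: "w \<in> carrier (F Mod N)"
    show "u \<otimes>\<^bsub>F Mod N\<^esub> v \<otimes>\<^bsub>F Mod N\<^esub> w = u \<otimes>\<^bsub>F Mod N\<^esub> (v \<otimes>\<^bsub>F Mod N\<^esub> w)"
      using u v w by (rule Q.m_assoc)
    show "u \<otimes>\<^bsub>F Mod N\<^esub> v \<in> carrier (F Mod N)" using u v by (rule Q.m_closed)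
    show "u \<otimes>\<^bsub>F Mod N\<^esub> v = v \<otimes>\<^bsub>F Mod N\<^esub> u" using u v by (rule Q.m_comm)
    show "\<one>\<^bsub>F Mod N\<^esub> \<otimes>\<^bsub>F Mod N\<^esub> u = u" using u by (rule Q.l_one)
    show "\<exists>v\<in>carrier (F Mod N). v \<otimes>\<^bsub>F Mod N\<^esub> u = \<one>\<^bsub>F Mod N\<^esub>" using u by (rule Q.l_inv_ex)
  qed (rule Q.one_closed)
  show "cring S" by (rule S.is_cring)
  fix s assume s: "s \<in> carrier S"
  show "s \<odot>\<^bsub>T\<^esub> u \<in> carrier T" if u: "u \<in> carrier T" for u
  proof -
    obtain a where "a \<in> carrier F" "u = N #>\<^bsub>F\<^esub> a" using u unfolding carrier_T by blast
    with s show ?thesis unfolding carrier_T by (simp add: smult_coset smult_tensor_compatible_carrier)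
  qed
  show "s \<odot>\<^bsub>T\<^esub> (u \<oplus>\<^bsub>T\<^esub> v) = s \<odot>\<^bsub>T\<^esub> u \<oplus>\<^bsub>T\<^esub> s \<odot>\<^bsub>T\<^esub> v"
    if u: "u \<in> carrier T" and v: "v \<in> carrier T" for u v
  proof -
    obtain a where "a \<in> carrier F" "u = N #>\<^bsub>F\<^esub> a" using u unfolding carrier_T by blast
    moreover obtain b where "b \<in> carrier F" "v = N #>\<^bsub>F\<^esub> b" using v unfolding carrier_T by blast
    ultimately show ?thesis
      using s by (simp add: smult_coset add_T smult_tensor_compatible_carrier frag_extend_add F_add)
  qed
next
  fix s t u assume s: "s \<in> carrier S" "t \<in> carrier S" and u: "u \<in> carrier T"
  then obtain a where a: "a \<in> carrier F" "u = N #>\<^bsub>F\<^esub> a" by (auto simp: carrier_T)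
  let ?l = "\<lambda>s. lift (\<lambda>(x, t). (x, s \<otimes>\<^bsub>S\<^esub> t))"
  have "?l (s \<oplus>\<^bsub>S\<^esub> t) a - (?l s a + ?l t a) \<in> N"
    using a(1)
  proof (induction rule: F_induct)
    case (diff a b)
    from N_diff[OF diff] show ?case by (simp only: frag_extend_diff diff_regroup)
  next
    case (gen x t')
    with s rel2[of x "s \<otimes>\<^bsub>S\<^esub> t'" "t \<otimes>\<^bsub>S\<^esub> t'"] show ?case
      by (simp add: S.l_distr diff_diff_eq)
  qed (simp add: N_0)
  then show "(s \<oplus>\<^bsub>S\<^esub> t) \<odot>\<^bsub>T\<^esub> u = s \<odot>\<^bsub>T\<^esub> u \<oplus>\<^bsub>T\<^esub> t \<odot>\<^bsub>T\<^esub> u"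
    using s a coset_eqI[of "?l (s \<oplus>\<^bsub>S\<^esub> t) a" "?l s a + ?l t a"]
    by (simp add: smult_coset add_T smult_tensor_compatible_carrier F_add)
  have "?l (s \<otimes>\<^bsub>S\<^esub> t) a = ?l s (?l t a)"
    using a(1)
    by (induction rule: F_induct) (use s in \<open>auto simp: S.m_assoc frag_extend_diff\<close>)
  then show "(s \<otimes>\<^bsub>S\<^esub> t) \<odot>\<^bsub>T\<^esub> u = s \<odot>\<^bsub>T\<^esub> (t \<odot>\<^bsub>T\<^esub> u)"
    using s a by (auto simp: smult_coset smult_tensor_compatible_carrier)
next
  fix u assume u: "u \<in> carrier T"
  then obtain a where a: "a \<in> carrier F" "u = N #>\<^bsub>F\<^esub> a" by (auto simp: carrier_T)
  have "lift (\<lambda>(x, t). (x, \<one>\<^bsub>S\<^esub> \<otimes>\<^bsub>S\<^esub> t)) a = a"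
    using a(1) by (induction rule: F_induct) (auto simp: frag_extend_diff)
  then show "\<one>\<^bsub>S\<^esub> \<odot>\<^bsub>T\<^esub> u = u" using a by (simp add: smult_coset)
qed

lemma base_change_map_linear:
  assumes h: "h \<in> linear_maps R M M"
  shows "base_change_map R S f M h \<in> linear_maps S T T"
proof -
  let ?l = "lift (\<lambda>(x, t). (h x, t))"
  have c: "?l a \<in> carrier F" if "a \<in> carrier F" for a
    using lift_carrier tensor_compatible_map[OF h] tensor_compatible_def that by blast
  have e: "base_change_map R S f M h (N #>\<^bsub>F\<^esub> a) = N #>\<^bsub>F\<^esub> ?l a" if "a \<in> carrier F" for a
    using that induced_coset[OF tensor_compatible_map[OF h] that] by (auto simp: base_change_map_def carrier_T)
  have l: "?l (lift (\<lambda>(x, t). (x, s \<otimes>\<^bsub>S\<^esub> t)) a) = lift (\<lambda>(x, t). (x, s \<otimes>\<^bsub>S\<^esub> t)) (?l a)"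
    if "a \<in> carrier F" "s \<in> carrier S" for a s
    using that(1) by (induction rule: F_induct) (auto simp: frag_extend_diff)
  have "base_change_map R S f M h \<in> extensional (carrier T)"
    by (simp add: base_change_map_def)
  then show ?thesis
    unfolding linear_maps_def
    by (auto simp: PiE_iff carrier_T e c add_T F_add frag_extend_add smult_coset smult_tensor_compatible_carrier l)
qed

lemma base_change_map_compose:
  assumes g: "g \<in> linear_maps R M M" and h: "h \<in> linear_maps R M M"
  shows "base_change_map R S f M (compose (carrier M) g h) =
    compose (carrier T) (base_change_map R S f M g) (base_change_map R S f M h)"
proof -
  have gh: "compose (carrier M) g h \<in> linear_maps R M M"
    using g h by (auto simp: linear_maps_def PiE_iff compose_def)
  have c: "lift (\<lambda>(x, t). (h x, t)) a \<in> carrier F"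
    if "h \<in> linear_maps R M M" "a \<in> carrier F" for h a
    using lift_carrier tensor_compatible_map[OF that(1)] tensor_compatible_def that by blast
  have e: "base_change_map R S f M h (N #>\<^bsub>F\<^esub> a) = N #>\<^bsub>F\<^esub> lift (\<lambda>(x, t). (h x, t)) a"
    if "h \<in> linear_maps R M M" "a \<in> carrier F" for h a
    using that induced_coset[OF tensor_compatible_map[OF that(1)] that(2)]
    by (auto simp: base_change_map_def carrier_T)
  have l: "lift (\<lambda>(x, t). (compose (carrier M) g h x, t)) a =
      lift (\<lambda>(x, t). (g x, t)) (lift (\<lambda>(x, t). (h x, t)) a)" if "a \<in> carrier F" for a
    using that by (induction rule: F_induct) (auto simp: frag_extend_diff compose_def)
  show ?thesis
  proof (rule extensionalityI)
    show "base_change_map R S f M (compose (carrier M) g h) \<in> extensional (carrier T)"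
      by (simp add: base_change_map_def)
    show "compose (carrier T) (base_change_map R S f M g) (base_change_map R S f M h)
        \<in> extensional (carrier T)"
      by (rule compose_extensional)
    fix u assume u: "u \<in> carrier T"
    then obtain a where "a \<in> carrier F" "u = N #>\<^bsub>F\<^esub> a" by (auto simp: carrier_T)
    with u show "base_change_map R S f M (compose (carrier M) g h) u =
        compose (carrier T) (base_change_map R S f M g) (base_change_map R S f M h) u"
      by (simp add: compose_eq e[OF gh] e[OF g] e[OF h] c[OF h] l)
  qed
qed

lemma base_change_map_id:
  "base_change_map R S f M (\<lambda>x\<in>carrier M. x) = (\<lambda>u\<in>carrier T. u)"
proof -
  have i: "(\<lambda>x\<in>carrier M. x) \<in> linear_maps R M M"
    by (auto simp: linear_maps_def)
  have l: "lift (\<lambda>(x, t). ((\<lambda>x\<in>carrier M. x) x, t)) a = a" if "a \<in> carrier F" for a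
    using that by (induction rule: F_induct) (auto simp: frag_extend_diff)
  show ?thesis
  proof (rule extensionalityI[where A = "carrier T"])
    fix u assume u: "u \<in> carrier T"
    then obtain a where "a \<in> carrier F" "u = N #>\<^bsub>F\<^esub> a" by (auto simp: carrier_T)
    with u show "base_change_map R S f M (\<lambda>x\<in>carrier M. x) u = (\<lambda>u\<in>carrier T. u) u"
      using induced_coset[OF tensor_compatible_map[OF i]] l by (simp add: base_change_map_def)
  qed (simp_all add: base_change_map_def)
qed

lemma base_change_rep_hom:
  assumes \<rho>: "\<rho> \<in> hom G (Aut_module R M)"
  shows "base_change_rep R S f M \<rho> \<in> hom G (Aut_module S T)"
proof (rule homI)
  have lin: "h \<in> linear_maps R M M" if "h \<in> carrier (Aut_module R M)" for h
    using that by (auto simp: Aut_module_def units_of_def Units_def End_module_def)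
  have \<rho>A: "\<rho> \<sigma> \<in> carrier (Aut_module R M)" if "\<sigma> \<in> carrier G" for \<sigma>
    using \<rho> that by (rule hom_in_carrier)
  fix \<sigma> assume \<sigma>: "\<sigma> \<in> carrier G"
  from \<rho>A[OF \<sigma>] obtain h where h: "h \<in> linear_maps R M M"
    "compose (carrier M) h (\<rho> \<sigma>) = (\<lambda>x\<in>carrier M. x)"
    "compose (carrier M) (\<rho> \<sigma>) h = (\<lambda>x\<in>carrier M. x)"
    by (auto simp: Aut_module_def units_of_def Units_def End_module_def)
  note l = lin[OF \<rho>A[OF \<sigma>]]
  show "base_change_rep R S f M \<rho> \<sigma> \<in> carrier (Aut_module S T)"
    using base_change_map_compose[OF l h(1)] base_change_map_compose[OF h(1) l]
      base_change_map_linear[OF l] base_change_map_linear[OF h(1)] base_change_map_id h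
    by (auto simp: Aut_module_def units_of_def Units_def End_module_def base_change_rep_def
        intro!: bexI[of _ "base_change_map R S f M h"])
  fix \<tau> assume \<tau>: "\<tau> \<in> carrier G"
  have "\<rho> (\<sigma> \<otimes>\<^bsub>G\<^esub> \<tau>) = compose (carrier M) (\<rho> \<sigma>) (\<rho> \<tau>)"
    using hom_mult[OF \<rho> \<sigma> \<tau>] by (simp add: Aut_module_def units_of_def End_module_def)
  then show "base_change_rep R S f M \<rho> (\<sigma> \<otimes>\<^bsub>G\<^esub> \<tau>) =
      base_change_rep R S f M \<rho> \<sigma> \<otimes>\<^bsub>Aut_module S T\<^esub> base_change_rep R S f M \<rho> \<tau>"
    using base_change_map_compose[OF l lin[OF \<rho>A[OF \<tau>]]]
    by (simp add: Aut_module_def units_of_def End_module_def base_change_rep_def)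
qed

end

end

theory Submission
  imports Defs
begin

text \<open>Since \<open>T\<close> is projective and its generic fibre is finite dimensional, \<open>T\<close> has a finite dual
  basis, so endomorphisms of \<open>T\<close> and of its fibres are described by matrices. To a subspace \<open>W\<close> of
  the endomorphisms of the generic fibre attach the image \<open>W\<^sub>k\<close>, in the endomorphisms of the special
  fibre, of the endomorphisms of \<open>T\<close> lying in \<open>W\<close>. The key fact is that \<open>W \<subseteq> W'\<close> and \<open>W'\<^sub>k \<subseteq> W\<^sub>k\<close>
  imply \<open>W = W'\<close>. Otherwise take a functional \<open>\<psi>\<close> that vanishes on \<open>W\<close> but not on \<open>W'\<close>, and \<open>c\<close> in
  the fraction field, not in the ring, with \<open>c \<mm>\<close> contained in the ring. An integral \<open>x\<close> in \<open>W'\<close>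
  is congruent modulo \<open>\<mm>\<close> to some \<open>l\<close> in \<open>W\<close>, so \<open>c (x - l)\<close> is again integral, and its value
  under \<open>\<psi>\<close> is \<open>c \<psi>(x)\<close>. Iterating, all \<open>c\<^sup>n \<psi>(x)\<close> have a common denominator, hence \<open>c\<close> is integral
  over the ring, a contradiction.

  For a normal subalgebra \<open>A\<close>, the reduction \<open>A\<^sub>k\<close> is a normal subalgebra. Comparing the reductions of
  the scalars, of \<open>A\<close>, of its ideals and centre, and of the full endomorphism algebra carries both
  properties over to the generic fibre.\<close>


section \<open>Noetherian and Dedekind rings\<close>

text \<open>The natural alternative localizes at \<mm> and compares the dimensions of
  \<open>W\<close> and \<open>W\<^sub>k\<close>. Here the element \<open>c\<close> takes the place
  of the inverse of a uniformizer, and strict monotonicity of \<open>W \<mapsto> W\<^sub>k\<close>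
  takes the place of the dimension count. Only an inclusion of reductions enters, so the reduction
  of the full endomorphism algebra never has to be identified. The obstacle is a denominator that
  must not grow with \<open>n\<close>. It is met by choosing \<psi> among the functionals that have
  one denominator on all integral points: this class contains the matrix entries and is stable under
  the eliminations that produce \<psi>. The element \<open>c\<close> is a fraction
  \<open>b/a\<close> read off from a colon ideal \<open>(a) : b\<close> equal to \<mm>. For \<mm> =
  0 the ring is a field and there is no such element, but then congruence modulo \<mm> is equality
  and the key fact is immediate.\<close>

text \<open>In a noetherian ring a nonempty chain of ideals contains its union, so Zorn's lemma
  works inside an arbitrary family. It serves once for colon ideals and once to stop an ascending
  chain.\<close>

lemma (in noetherian_ring) maximal_ideal_in_family:
  assumes "S \<noteq> {}" and "\<And>I. I \<in> S \<Longrightarrow> ideal I R"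
  obtains M where "M \<in> S" and "\<And>I. I \<in> S \<Longrightarrow> M \<subseteq> I \<Longrightarrow> I = M"
proof -
  have "\<exists>M\<in>S. \<forall>I\<in>S. M \<subseteq> I \<longrightarrow> I = M"
  proof (rule subset_Zorn)
    fix C assume C: "subset.chain S C"
    show "\<exists>U\<in>S. \<forall>I\<in>C. I \<subseteq> U"
    proof (cases "C = {}")
      case True
      then show ?thesis using assms(1) by auto
    next
      case False
      have "subset.chain {I. ideal I R} C"
        using C assms(2) by (auto simp: pred_on.chain_def)
      with False have "\<Union>C \<in> C" by (rule ideal_chain_is_trivial)
      then show ?thesis using C by (auto simp: pred_on.chain_def)
    qed
  qed
  with that show ?thesis by blast
qed

text \<open>A maximal element among the colon ideals \<open>(a) : b\<close> contained in \<open>\<mm>\<close> is prime, hence maximal,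
  hence equal to \<open>\<mm>\<close>.\<close>

lemma (in noetherian_domain) maximal_ideal_is_colon:
  assumes dim: "\<And>P. primeideal P R \<Longrightarrow> P \<noteq> {\<zero>} \<Longrightarrow> maximalideal P R"
    and m: "maximalideal \<mm> R" and nz: "\<mm> \<noteq> {\<zero>}"
  obtains a b where "a \<in> carrier R" "a \<noteq> \<zero>" "b \<in> carrier R"
    and "\<And>x. x \<in> \<mm> \<Longrightarrow> \<exists>y\<in>carrier R. x \<otimes> b = y \<otimes> a"
    and "\<not> (\<exists>y\<in>carrier R. b = y \<otimes> a)"
proof -
  interpret m: maximalideal \<mm> R by (rule m)
  have mp: "primeideal \<mm> R" by (rule maximalideal_prime[OF m])
  interpret mp: primeideal \<mm> R by (rule mp)
  have one: "\<one> \<notin> \<mm>" using m.I_notcarr m.one_imp_carrier by blast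
  obtain a where a: "a \<in> \<mm>" "a \<noteq> \<zero>" using nz m.zero_closed by blast
  then have aR: "a \<in> carrier R" by (simp add: m.a_subset[THEN subsetD])
  interpret A: ideal "PIdl a" R by (rule cgenideal_ideal[OF aR])
  define col where "col b = {x \<in> carrier R. x \<otimes> b \<in> PIdl a}" for b
  have col_ideal: "ideal (col b) R" if b: "b \<in> carrier R" for b
  proof (rule idealI[OF ring_axioms])
    show "subgroup (col b) (add_monoid R)"
    proof (rule add.subgroupI)
      show "col b \<subseteq> carrier R" by (auto simp: col_def)
      show "col b \<noteq> {}" using b by (auto simp: col_def intro!: exI[of _ \<zero>])
      show "\<ominus> x \<in> col b" if "x \<in> col b" for x
        using that b by (auto simp: col_def l_minus)
      show "x \<oplus> y \<in> col b" if "x \<in> col b" "y \<in> col b" for x y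
        using that b by (auto simp: col_def l_distr)
    qed
    show "x \<otimes> y \<in> col b" if "y \<in> col b" "x \<in> carrier R" for x y
      using that b A.I_l_closed[of "y \<otimes> b" x] by (auto simp: col_def m_assoc)
    then show "y \<otimes> x \<in> col b" if "y \<in> col b" "x \<in> carrier R" for x y
      using that m_comm[of x y] by (metis (no_types, lifting) col_def mem_Collect_eq)
  qed
  define S where "S = {col b | b. b \<in> carrier R \<and> col b \<subseteq> \<mm>}"
  have am: "PIdl a \<subseteq> \<mm>" using cgenideal_minimal[OF m.is_ideal a(1)] .
  \<comment> \<open>\<open>col \<one>\<close> is \<open>(a)\<close> itself; since \<open>a\<close>
    was taken in \<mm>, the family \<open>S\<close> is nonempty.\<close>
  have "col \<one> \<subseteq> \<mm>" using am by (auto simp: col_def)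
  then have "col \<one> \<in> S" by (auto simp: S_def)
  moreover have "ideal I R" if "I \<in> S" for I using that col_ideal by (auto simp: S_def)
  ultimately obtain P where P: "P \<in> S" and Pmax: "\<And>I. I \<in> S \<Longrightarrow> P \<subseteq> I \<Longrightarrow> I = P"
    using maximal_ideal_in_family[of S] by (metis empty_iff)
  from P obtain b where b: "b \<in> carrier R" and Pb: "P = col b" and Pm: "P \<subseteq> \<mm>"
    by (auto simp: S_def)
  have mono: "col b \<subseteq> col (b \<otimes> x)" if "x \<in> carrier R" for x
  proof
    fix y assume "y \<in> col b"
    then show "y \<in> col (b \<otimes> x)"
      using that b A.I_r_closed[of "y \<otimes> b" x] by (auto simp: col_def m_assoc)
  qed
  have "primeideal P R"
  proof (rule primeidealI)
    show "ideal P R" using col_ideal b Pb by simp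
    show "cring R" by (rule is_cring)
    show "carrier R \<noteq> P" using Pm one by blast
    fix x y assume xy: "x \<in> carrier R" "y \<in> carrier R" "x \<otimes> y \<in> P"
    show "x \<in> P \<or> y \<in> P"
    proof (rule ccontr)
      assume n: "\<not> (x \<in> P \<or> y \<in> P)"
      \<comment> \<open>As \<open>y\<close> lies in \<open>col (b \<otimes> x)\<close> but not in
        \<open>P\<close>, maximality of \<open>P\<close> pushes that colon ideal out of \<mm>, which
        yields \<open>s\<close> outside \<mm> with \<open>s b x\<close> in \<open>(a)\<close>.
        Primality of \<mm> keeps \<open>col (b \<otimes> s)\<close> inside \<mm>, so it equals
        \<open>P\<close>; but it contains \<open>x\<close>.\<close>
      have "y \<in> col (b \<otimes> x)"
        using xy b by (auto simp: Pb col_def m_ac)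
      then have "col (b \<otimes> x) \<notin> S"
        using n Pmax[of "col (b \<otimes> x)"] mono[OF xy(1)] Pb by blast
      then have "\<not> col (b \<otimes> x) \<subseteq> \<mm>" using b xy by (auto simp: S_def)
      then obtain s where s: "s \<in> carrier R" "s \<notin> \<mm>" "s \<otimes> (b \<otimes> x) \<in> PIdl a"
        by (auto simp: col_def)
      have "col (b \<otimes> s) \<subseteq> \<mm>"
      proof
        fix r assume r: "r \<in> col (b \<otimes> s)"
        then have "r \<in> carrier R" "r \<otimes> s \<in> col b" using b s by (auto simp: col_def m_ac)
        then show "r \<in> \<mm>" using mp.I_prime[of r s] s Pm Pb by blast
      qed
      then have "col (b \<otimes> s) \<in> S" using b s by (auto simp: S_def)
      then have "col (b \<otimes> s) = P" using Pmax mono[OF s(1)] Pb by simp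
      moreover have "x \<in> col (b \<otimes> s)" using s b xy by (auto simp: col_def m_ac)
      ultimately show False using n by blast
    qed
  qed
  \<comment> \<open>The nonzero element \<open>a\<close> rules out the zero ideal, as
    \<open>dim\<close> requires.\<close>
  moreover have "a \<in> P"
    using aR b A.I_r_closed[OF cgenideal_self[OF aR] b] by (auto simp: Pb col_def)
  ultimately have "maximalideal P R" using dim a by blast
  from maximalideal.I_maximal[OF this m.is_ideal Pm m.a_subset] have "P = \<mm>"
    using m.I_notcarr by simp
  then have "\<exists>y\<in>carrier R. x \<otimes> b = y \<otimes> a" if "x \<in> \<mm>" for x
  proof -
    have "x \<in> col b" using that \<open>P = \<mm>\<close> Pb by simp
    then have "x \<otimes> b \<in> PIdl a" by (simp add: col_def)
    then show ?thesis unfolding cgenideal_def by blast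
  qed
  moreover have "\<not> (\<exists>y\<in>carrier R. b = y \<otimes> a)"
  proof
    assume "\<exists>y\<in>carrier R. b = y \<otimes> a"
    then have "\<one> \<otimes> b \<in> PIdl a" using b unfolding cgenideal_def by auto
    then have "\<one> \<in> col b" by (simp add: col_def)
    then show False using Pb Pm one by blast
  qed
  ultimately show ?thesis using that[OF aR a(2) b] by blast
qed

section \<open>Powers with a common denominator and integrality\<close>

lemma (in ring) eval_map2_add:
  assumes "length p = length q" "set p \<subseteq> carrier R" "set q \<subseteq> carrier R" "x \<in> carrier R"
  shows "eval (map2 (\<oplus>) p q) x = eval p x \<oplus> eval q x"
  using assms by (induction p q rule: list_induct2) (auto simp: l_distr eval_in_carrier a_ac)

lemma (in cring) eval_map_mult:
  assumes "set p \<subseteq> carrier R" "x \<in> carrier R" "c \<in> carrier R"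
  shows "eval (map ((\<otimes>) c) p) x = c \<otimes> eval p x"
  using assms by (induction p) (auto simp: r_distr eval_in_carrier m_assoc)

text \<open>The ideals of all numerators \<open>x\<close> with \<open>x = e q(c)\<close>, where \<open>q\<close> has degree less than \<open>n\<close>, form an
  increasing chain; where it stops, \<open>c\<^sup>n\<close> is a combination of lower powers.\<close>

lemma almost_integral_imp_integral:
  assumes R: "noetherian_domain R" and E: "field E" and hom: "\<iota> \<in> ring_hom R E"
    and inj: "inj_on \<iota> (carrier R)"
    and c: "c \<in> carrier E" and e: "e \<in> carrier E" "e \<noteq> \<zero>\<^bsub>E\<^esub>"
    and ec: "\<And>n::nat. e \<otimes>\<^bsub>E\<^esub> c [^]\<^bsub>E\<^esub> n \<in> \<iota> ` carrier R"
  shows "integral_over R E \<iota> c"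
proof -
  interpret R: noetherian_domain R by (rule R)
  interpret E: field E by (rule E)
  interpret ring_hom_ring R E \<iota>
    using hom by (intro ring_hom_ringI2) (auto intro: R.ring_axioms E.ring_axioms)
  \<comment> \<open>The length is fixed and leading zeros are allowed: lists with the leading
    coefficient first then line up degree by degree, so coefficientwise sums stay in
    \<open>J n\<close>, and prefixing a zero embeds \<open>J n\<close> in
    \<open>J (Suc n)\<close>.\<close>
  define J where "J n = {x \<in> carrier R. \<exists>q. set q \<subseteq> carrier R \<and> length q = n \<and>
      \<iota> x = e \<otimes>\<^bsub>E\<^esub> E.eval (map \<iota> q) c}" for n
  have ev: "E.eval (map \<iota> q) c \<in> carrier E" if "set q \<subseteq> carrier R" for q
    using that c by (intro E.eval_in_carrier) auto
  have add2: "map \<iota> (map2 (\<oplus>\<^bsub>R\<^esub>) p q) = map2 (\<oplus>\<^bsub>E\<^esub>) (map \<iota> p) (map \<iota> q)"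
    if "length p = length q" "set p \<subseteq> carrier R" "set q \<subseteq> carrier R" for p q
    using that by (induction p q rule: list_induct2) auto
  have mul2: "map \<iota> (map ((\<otimes>\<^bsub>R\<^esub>) r) q) = map ((\<otimes>\<^bsub>E\<^esub>) (\<iota> r)) (map \<iota> q)"
    if "set q \<subseteq> carrier R" "r \<in> carrier R" for r q
    using that by (induction q) auto
  have Jm: "r \<otimes>\<^bsub>R\<^esub> x \<in> J n" if "x \<in> J n" "r \<in> carrier R" for x r n
  proof -
    obtain q where q: "set q \<subseteq> carrier R" "length q = n" "\<iota> x = e \<otimes>\<^bsub>E\<^esub> E.eval (map \<iota> q) c"
      and x: "x \<in> carrier R" using \<open>x \<in> J n\<close> by (auto simp: J_def)
    have "\<iota> (r \<otimes>\<^bsub>R\<^esub> x) = e \<otimes>\<^bsub>E\<^esub> E.eval (map \<iota> (map ((\<otimes>\<^bsub>R\<^esub>) r) q)) c"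
      unfolding mul2[OF q(1) \<open>r \<in> carrier R\<close>]
      using q x \<open>r \<in> carrier R\<close> ev[OF q(1)] e c by (subst E.eval_map_mult) (auto simp: E.m_lcomm)
    moreover have "set (map ((\<otimes>\<^bsub>R\<^esub>) r) q) \<subseteq> carrier R" using q that by auto
    ultimately show ?thesis using x that q by (auto simp: J_def intro!: exI[of _ "map ((\<otimes>\<^bsub>R\<^esub>) r) q"])
  qed
  have Ja: "x \<oplus>\<^bsub>R\<^esub> y \<in> J n" if "x \<in> J n" "y \<in> J n" for x y n
  proof -
    obtain p where p: "set p \<subseteq> carrier R" "length p = n" "\<iota> x = e \<otimes>\<^bsub>E\<^esub> E.eval (map \<iota> p) c"
      and x: "x \<in> carrier R" using \<open>x \<in> J n\<close> by (auto simp: J_def)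
    obtain q where q: "set q \<subseteq> carrier R" "length q = n" "\<iota> y = e \<otimes>\<^bsub>E\<^esub> E.eval (map \<iota> q) c"
      and y: "y \<in> carrier R" using \<open>y \<in> J n\<close> by (auto simp: J_def)
    have s: "set (map2 (\<oplus>\<^bsub>R\<^esub>) p q) \<subseteq> carrier R"
      using p q by (auto dest: set_zip_leftD set_zip_rightD)
    have "E.eval (map2 (\<oplus>\<^bsub>E\<^esub>) (map \<iota> p) (map \<iota> q)) c =
        E.eval (map \<iota> p) c \<oplus>\<^bsub>E\<^esub> E.eval (map \<iota> q) c"
      using p q c by (intro E.eval_map2_add) auto
    then have "\<iota> (x \<oplus>\<^bsub>R\<^esub> y) = e \<otimes>\<^bsub>E\<^esub> E.eval (map \<iota> (map2 (\<oplus>\<^bsub>R\<^esub>) p q)) c"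
      using p q x y e ev[OF p(1)] ev[OF q(1)] add2[of p q] by (simp add: E.r_distr)
    with s x y p q show ?thesis by (auto simp: J_def intro!: exI[of _ "map2 (\<oplus>\<^bsub>R\<^esub>) p q"])
  qed
  have Jz: "\<zero>\<^bsub>R\<^esub> \<in> J n" for n
  proof -
    have "E.eval (replicate n \<zero>\<^bsub>E\<^esub> @ []) c = \<zero>\<^bsub>E\<^esub>"
      using E.eval_replicate[of "[]" c n] c by simp
    then show ?thesis
      using e by (auto simp: J_def intro!: exI[of _ "replicate n \<zero>\<^bsub>R\<^esub>"])
  qed
  have J_ideal: "ideal (J n) R" for n
  proof (rule idealI[OF R.ring_axioms])
    show "subgroup (J n) (add_monoid R)"
    proof (rule R.add.subgroupI)
      show "J n \<subseteq> carrier R" by (auto simp: J_def)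
      show "J n \<noteq> {}" using Jz by auto
      show "x \<oplus>\<^bsub>R\<^esub> y \<in> J n" if "x \<in> J n" "y \<in> J n" for x y using that by (rule Ja)
      show "\<ominus>\<^bsub>R\<^esub> x \<in> J n" if "x \<in> J n" for x
        using Jm[OF that, of "\<ominus>\<^bsub>R\<^esub> \<one>\<^bsub>R\<^esub>"] that by (auto simp: J_def R.l_minus)
    qed
    show "r \<otimes>\<^bsub>R\<^esub> x \<in> J n" if "x \<in> J n" "r \<in> carrier R" for x r using that by (rule Jm)
    then show "x \<otimes>\<^bsub>R\<^esub> r \<in> J n" if "x \<in> J n" "r \<in> carrier R" for x r
      using that R.m_comm[of x r] by (auto simp: J_def)
  qed
  have "J n \<subseteq> J (Suc n)" for n
  proof
    fix x assume "x \<in> J n"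
    then obtain q where q: "set q \<subseteq> carrier R" "length q = n" "\<iota> x = e \<otimes>\<^bsub>E\<^esub> E.eval (map \<iota> q) c"
      and x: "x \<in> carrier R" by (auto simp: J_def)
    have "E.eval (map \<iota> (\<zero>\<^bsub>R\<^esub> # q)) c = E.eval (map \<iota> q) c" using c ev[OF q(1)] by simp
    with q x show "x \<in> J (Suc n)" by (auto simp: J_def intro!: exI[of _ "\<zero>\<^bsub>R\<^esub> # q"])
  qed
  then have mono: "J n \<subseteq> J k" if "n \<le> k" for n k using that lift_Suc_mono_le[of J] by blast
  obtain M where M: "M \<in> range J" "\<And>I. I \<in> range J \<Longrightarrow> M \<subseteq> I \<Longrightarrow> I = M"
    using R.maximal_ideal_in_family[of "range J"] J_ideal by blast
  then obtain n where "M = J n" by blast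
  with M(2)[of "J (Suc n)"] mono[of n "Suc n"] have n: "J (Suc n) = J n" by auto
  obtain x where x: "x \<in> carrier R" "\<iota> x = e \<otimes>\<^bsub>E\<^esub> c [^]\<^bsub>E\<^esub> n" using ec[of n] by (metis imageE)
  have "E.eval (replicate n \<zero>\<^bsub>E\<^esub> @ []) c = \<zero>\<^bsub>E\<^esub>"
    using E.eval_replicate[of "[]" c n] c by simp
  then have "E.eval (map \<iota> (\<one>\<^bsub>R\<^esub> # replicate n \<zero>\<^bsub>R\<^esub>)) c = c [^]\<^bsub>E\<^esub> n" using c by simp
  \<comment> \<open>The monomial of degree \<open>n\<close> is a list of length
    \<open>Suc n\<close>; equality of the two ideals replaces it by a list of length
    \<open>n\<close>, that is, by degree below \<open>n\<close>.\<close>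
  then have "x \<in> J (Suc n)"
    using x by (auto simp: J_def intro!: exI[of _ "\<one>\<^bsub>R\<^esub> # replicate n \<zero>\<^bsub>R\<^esub>"])
  then obtain q where q: "set q \<subseteq> carrier R" "length q = n" "\<iota> x = e \<otimes>\<^bsub>E\<^esub> E.eval (map \<iota> q) c"
    unfolding n by (auto simp: J_def)
  then have cn: "c [^]\<^bsub>E\<^esub> n = E.eval (map \<iota> q) c"
    using x e c ev[OF q(1)] E.m_lcancel by auto
  \<comment> \<open>Negating the lower coefficients gives a monic polynomial of degree
    \<open>n\<close> that annihilates \<open>c\<close>.\<close>
  let ?q = "map ((\<otimes>\<^bsub>R\<^esub>) (\<ominus>\<^bsub>R\<^esub> \<one>\<^bsub>R\<^esub>)) q"
  have "E.eval (map \<iota> ?q) c = \<ominus>\<^bsub>E\<^esub> E.eval (map \<iota> q) c"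
    unfolding mul2[OF q(1) R.a_inv_closed[OF R.one_closed]]
    using q(1) c ev[OF q(1)] by (subst E.eval_map_mult) (auto simp: E.l_minus)
  then have "E.eval (map \<iota> (\<one>\<^bsub>R\<^esub> # ?q)) c = \<zero>\<^bsub>E\<^esub>"
    using q(2) ev[OF q(1)] by (simp add: cn E.r_neg)
  then show ?thesis
    unfolding integral_over_def using q(1) by (intro exI[of _ "\<one>\<^bsub>R\<^esub> # ?q"]) auto
qed

text \<open>The element is the fraction \<open>b/a\<close> of the colon presentation: multiplication
  by \<mm> clears the denominator \<open>a\<close>, whereas \<open>b\<close> is not a multiple of
  \<open>a\<close>.\<close>

lemma dedekind_inverse_element:
  assumes D: "dedekind_ring R E \<iota>" and m: "maximalideal \<mm> R" and nz: "\<mm> \<noteq> {\<zero>\<^bsub>R\<^esub>}"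
  obtains c where "c \<in> carrier E" "c \<notin> \<iota> ` carrier R"
    and "\<And>x. x \<in> \<mm> \<Longrightarrow> c \<otimes>\<^bsub>E\<^esub> \<iota> x \<in> \<iota> ` carrier R"
proof -
  interpret R: noetherian_domain R using D by (simp add: dedekind_ring_def)
  have E: "field E" and hom: "\<iota> \<in> ring_hom R E" and inj: "inj_on \<iota> (carrier R)"
    using D by (auto simp: dedekind_ring_def field_of_fractions_def)
  interpret E: field E by (rule E)
  interpret ring_hom_ring R E \<iota>
    using hom by (intro ring_hom_ringI2) (auto intro: R.ring_axioms E.ring_axioms)
  obtain a b where ab: "a \<in> carrier R" "a \<noteq> \<zero>\<^bsub>R\<^esub>" "b \<in> carrier R"
    and 1: "\<And>x. x \<in> \<mm> \<Longrightarrow> \<exists>y\<in>carrier R. x \<otimes>\<^bsub>R\<^esub> b = y \<otimes>\<^bsub>R\<^esub> a"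
    and 2: "\<not> (\<exists>y\<in>carrier R. b = y \<otimes>\<^bsub>R\<^esub> a)"
    using R.maximal_ideal_is_colon[OF _ m nz] D by (auto simp: dedekind_ring_def)
  have a0: "\<iota> a \<noteq> \<zero>\<^bsub>E\<^esub>" using ab inj by (metis R.zero_closed hom_zero inj_onD)
  then have u: "\<iota> a \<in> Units E" using ab E.field_Units by auto
  have aE: "\<iota> a \<in> carrier E" "inv\<^bsub>E\<^esub> \<iota> a \<in> carrier E" "\<iota> a \<otimes>\<^bsub>E\<^esub> inv\<^bsub>E\<^esub> \<iota> a = \<one>\<^bsub>E\<^esub>"
    using u by (auto simp: E.Units_closed)
  let ?c = "\<iota> b \<otimes>\<^bsub>E\<^esub> inv\<^bsub>E\<^esub> (\<iota> a)"
  show ?thesis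
  proof (rule that[of ?c])
    show "?c \<in> carrier E" using ab aE by auto
    show "?c \<notin> \<iota> ` carrier R"
    proof
      assume "?c \<in> \<iota> ` carrier R"
      then obtain y where y: "y \<in> carrier R" "?c = \<iota> y" by auto
      have "\<iota> b = ?c \<otimes>\<^bsub>E\<^esub> \<iota> a" using ab u by (simp add: E.m_assoc)
      then have "\<iota> b = \<iota> (y \<otimes>\<^bsub>R\<^esub> a)" using y ab by simp
      then have "b = y \<otimes>\<^bsub>R\<^esub> a" by (rule inj_onD[OF inj]) (use y ab in auto)
      with 2 y show False by blast
    qed
    fix x assume x: "x \<in> \<mm>"
    have xR: "x \<in> carrier R" using x m ideal.Icarr[OF maximalideal.axioms(1)] by metis
    obtain y where y: "y \<in> carrier R" "x \<otimes>\<^bsub>R\<^esub> b = y \<otimes>\<^bsub>R\<^esub> a" using 1[OF x] by blast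
    have "?c \<otimes>\<^bsub>E\<^esub> \<iota> x = \<iota> (x \<otimes>\<^bsub>R\<^esub> b) \<otimes>\<^bsub>E\<^esub> inv\<^bsub>E\<^esub> (\<iota> a)"
      using xR ab aE by (simp add: E.m_ac)
    also have "\<dots> = \<iota> y" using y ab aE by (simp add: E.m_assoc)
    finally show "?c \<otimes>\<^bsub>E\<^esub> \<iota> x \<in> \<iota> ` carrier R" using y by auto
  qed
qed


section \<open>Linear functionals and subspaces\<close>

text \<open>The target is a ring record without scalar multiplication, which
  \<open>linear_maps\<close> cannot take. Extensionality is not imposed, so pointwise combinations
  and restrictions to submodules remain functionals as they stand.\<close>

definition linear_functional ::
    "('a, 'x) ring_scheme \<Rightarrow> ('a, 'b, 'y) module_scheme \<Rightarrow> ('b \<Rightarrow> 'a) \<Rightarrow> bool"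
  where "linear_functional K V \<phi> \<longleftrightarrow>
    \<phi> \<in> carrier V \<rightarrow> carrier K \<and>
    (\<forall>x\<in>carrier V. \<forall>y\<in>carrier V. \<phi> (x \<oplus>\<^bsub>V\<^esub> y) = \<phi> x \<oplus>\<^bsub>K\<^esub> \<phi> y) \<and>
    (\<forall>a\<in>carrier K. \<forall>x\<in>carrier V. \<phi> (a \<odot>\<^bsub>V\<^esub> x) = a \<otimes>\<^bsub>K\<^esub> \<phi> x)"

lemma linear_functionalI:
  assumes "\<And>x. x \<in> carrier V \<Longrightarrow> \<phi> x \<in> carrier K"
    and "\<And>x y. x \<in> carrier V \<Longrightarrow> y \<in> carrier V \<Longrightarrow> \<phi> (x \<oplus>\<^bsub>V\<^esub> y) = \<phi> x \<oplus>\<^bsub>K\<^esub> \<phi> y"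
    and "\<And>a x. a \<in> carrier K \<Longrightarrow> x \<in> carrier V \<Longrightarrow> \<phi> (a \<odot>\<^bsub>V\<^esub> x) = a \<otimes>\<^bsub>K\<^esub> \<phi> x"
  shows "linear_functional K V \<phi>"
  using assms by (auto simp: linear_functional_def)

lemma linear_functionalD:
  assumes "linear_functional K V \<phi>"
  shows "x \<in> carrier V \<Longrightarrow> \<phi> x \<in> carrier K"
    and "x \<in> carrier V \<Longrightarrow> y \<in> carrier V \<Longrightarrow> \<phi> (x \<oplus>\<^bsub>V\<^esub> y) = \<phi> x \<oplus>\<^bsub>K\<^esub> \<phi> y"
    and "a \<in> carrier K \<Longrightarrow> x \<in> carrier V \<Longrightarrow> \<phi> (a \<odot>\<^bsub>V\<^esub> x) = a \<otimes>\<^bsub>K\<^esub> \<phi> x"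
  using assms by (auto simp: linear_functional_def)

context module
begin

lemma linear_functional_zero:
  assumes "linear_functional R M \<phi>" shows "\<phi> \<zero>\<^bsub>M\<^esub> = \<zero>"
  using linear_functionalD(3)[OF assms, of \<zero> "\<zero>\<^bsub>M\<^esub>"] linear_functionalD(1)[OF assms, of "\<zero>\<^bsub>M\<^esub>"]
  by simp

lemma linear_functional_minus:
  assumes "linear_functional R M \<phi>" "x \<in> carrier M" "y \<in> carrier M"
  shows "\<phi> (x \<ominus>\<^bsub>M\<^esub> y) = \<phi> x \<ominus> \<phi> y"
proof -
  have "\<ominus>\<^bsub>M\<^esub> y = (\<ominus> \<one>) \<odot>\<^bsub>M\<^esub> y" using assms by (simp add: smult_l_minus)
  then have "\<phi> (\<ominus>\<^bsub>M\<^esub> y) = \<ominus> \<phi> y"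
    using assms linear_functionalD[OF assms(1)] by (simp add: l_minus)
  then show ?thesis using assms linear_functionalD(2)[OF assms(1)] by (simp add: a_minus_def)
qed

text \<open>This is the one operation that the elimination in \<open>separating_functional\<close>
  performs on functionals.\<close>

lemma linear_functional_diff_smult:
  assumes "linear_functional R M \<phi>" "linear_functional R M \<psi>" "c \<in> carrier R"
  shows "linear_functional R M (\<lambda>x. \<phi> x \<ominus> c \<otimes> \<psi> x)"
  using assms(3) linear_functionalD[OF assms(1)] linear_functionalD[OF assms(2)]
  by (intro linear_functionalI) (auto simp: a_minus_def r_distr R.minus_add R.a_ac m_lcomm r_minus)

lemma submodule_diff:
  assumes "submodule W R M" "x \<in> W" "y \<in> W"
  shows "x \<ominus>\<^bsub>M\<^esub> y \<in> W"
  unfolding a_minus_def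
  using submoduleE(5)[OF assms(1,2) submoduleE(3)[OF assms(1,3)]] .

lemma submodule_kernel:
  assumes "submodule W R M" "linear_functional R M \<phi>"
  shows "submodule {x \<in> W. \<phi> x = \<zero>} R M"
proof -
  note W = submoduleE[OF assms(1)] and f = linear_functionalD[OF assms(2)]
  have z: "\<zero>\<^bsub>M\<^esub> \<in> W" using subgroup.one_closed[OF submodule.axioms(1)[OF assms(1)]] by simp
  show ?thesis
  proof (rule submoduleI)
    fix x assume x: "x \<in> {x \<in> W. \<phi> x = \<zero>}"
    then have "\<ominus>\<^bsub>M\<^esub> x = (\<ominus> \<one>) \<odot>\<^bsub>M\<^esub> x" using W(1) by (auto simp: smult_l_minus)
    with x show "\<ominus>\<^bsub>M\<^esub> x \<in> {x \<in> W. \<phi> x = \<zero>}" using W(1) W(3)[of x] f(3)[of "\<ominus> \<one>" x] by auto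
  qed (use W f z linear_functional_zero[OF assms(2)] in \<open>auto simp: subset_iff\<close>)
qed

text \<open>Gaussian elimination on the coordinates \<open>\<phi> j\<close>, one index at a time,
  with both subspaces cut down to the kernel of \<open>\<phi> j\<close>. The set
  \<open>\<Phi>\<close> is kept abstract because the application wants the separating functional to
  retain a bounded denominator. Injectivity is asked on \<open>W'\<close>, so that the kernel
  inherits it.\<close>

lemma separating_functional:
  assumes K: "field R" and J: "finite J" and "\<And>j. j \<in> J \<Longrightarrow> \<phi> j \<in> \<Phi>"
    and lin: "\<And>\<psi>. \<psi> \<in> \<Phi> \<Longrightarrow> linear_functional R M \<psi>"
    and closed: "\<And>\<psi> \<chi> c. \<psi> \<in> \<Phi> \<Longrightarrow> \<chi> \<in> \<Phi> \<Longrightarrow> c \<in> carrier R \<Longrightarrow> (\<lambda>x. \<psi> x \<ominus> c \<otimes> \<chi> x) \<in> \<Phi>"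
    and "submodule W R M" "submodule W' R M" "W \<subseteq> W'" "w \<in> W'" "w \<notin> W"
    and "\<And>x. x \<in> W' \<Longrightarrow> (\<And>j. j \<in> J \<Longrightarrow> \<phi> j x = \<zero>) \<Longrightarrow> x = \<zero>\<^bsub>M\<^esub>"
  shows "\<exists>\<psi>\<in>\<Phi>. (\<forall>x\<in>W. \<psi> x = \<zero>) \<and> \<psi> w \<noteq> \<zero>"
  using J assms(3,6-)
proof (induction J arbitrary: W W' w)
  case empty
  then have "w = \<zero>\<^bsub>M\<^esub>" by blast
  moreover have "\<zero>\<^bsub>M\<^esub> \<in> W"
    using subgroup.one_closed[OF submodule.axioms(1)[OF empty(2)]] by simp
  ultimately show ?case using empty by blast
next
  case (insert j J)
  interpret K: field R by (rule K)
  note W = submoduleE[OF insert.prems(2)] and W' = submoduleE[OF insert.prems(3)]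
  have fj: "linear_functional R M (\<phi> j)" and fjP: "\<phi> j \<in> \<Phi>" using lin insert.prems(1) by auto
  note f = linear_functionalD[OF fj]
  let ?W0 = "{x \<in> W. \<phi> j x = \<zero>}" and ?W0' = "{x \<in> W'. \<phi> j x = \<zero>}"
  have IH: "\<exists>\<psi>\<in>\<Phi>. (\<forall>x\<in>?W0. \<psi> x = \<zero>) \<and> \<psi> v \<noteq> \<zero>" if "v \<in> ?W0'" "v \<notin> W" for v
    using insert.prems that
    by (intro insert.IH[of ?W0 ?W0']) (auto intro: submodule_kernel fj)
  show ?case
  proof (cases "\<exists>u\<in>W. \<phi> j u \<noteq> \<zero>")
    case True
    then obtain u where u: "u \<in> W" "\<phi> j u \<noteq> \<zero>" by blast
    then have uM: "u \<in> carrier M" using W(1) by blast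
    have unit: "\<phi> j u \<in> Units R" using u uM f(1) K.field_Units by auto
    define r where "r x = (\<phi> j x \<otimes> inv (\<phi> j u))" for x
    have rc: "r x \<in> carrier R" if "x \<in> carrier M" for x using that f(1) unit by (simp add: r_def)
    \<comment> \<open>\<open>v\<close> projects onto the kernel of \<open>\<phi> j\<close> along the
      pivot \<open>u\<close>. As \<open>u\<close> lies in \<open>W\<close>, it preserves
      \<open>W\<close> and \<open>W'\<close> and moves no vector into or out of
      \<open>W\<close>.\<close>
    define v where "v x = x \<ominus>\<^bsub>M\<^esub> r x \<odot>\<^bsub>M\<^esub> u" for x
    have v0: "\<phi> j (v x) = \<zero>" if "x \<in> carrier M" for x
    proof -
      have "\<phi> j (v x) = \<phi> j x \<ominus> r x \<otimes> \<phi> j u"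
        using that rc[OF that] uM f(3) linear_functional_minus[OF fj] by (simp add: v_def)
      also have "r x \<otimes> \<phi> j u = \<phi> j x" using that uM f(1) unit by (simp add: r_def m_assoc)
      finally show ?thesis using that f(1) by simp
    qed
    have wM: "w \<in> carrier M" using insert.prems W' by blast
    have vW: "v x \<in> W" if "x \<in> W" for x
    proof -
      have "x \<in> carrier M" using that W by blast
      then have "r x \<odot>\<^bsub>M\<^esub> u \<in> W" using W(4)[OF rc u(1)] by blast
      then show ?thesis using submodule_diff[OF insert.prems(2) that] by (simp add: v_def)
    qed
    have "v w \<in> W'"
    proof -
      have "r w \<odot>\<^bsub>M\<^esub> u \<in> W'" using u W'(4)[OF rc[OF wM]] insert.prems(4) by blast
      then show ?thesis using submodule_diff[OF insert.prems(3,5)] by (simp add: v_def)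
    qed
    moreover have "v w \<notin> W"
    proof
      assume "v w \<in> W"
      then have "v w \<oplus>\<^bsub>M\<^esub> r w \<odot>\<^bsub>M\<^esub> u \<in> W" using W(5)[OF _ W(4)[OF rc[OF wM] u(1)]] by blast
      moreover have "v w \<oplus>\<^bsub>M\<^esub> r w \<odot>\<^bsub>M\<^esub> u = w"
        using wM uM rc[OF wM] by (simp add: v_def a_minus_def M.a_assoc M.l_neg)
      ultimately show False using insert.prems by simp
    qed
    ultimately obtain \<psi> where \<psi>: "\<psi> \<in> \<Phi>" "\<forall>x\<in>?W0. \<psi> x = \<zero>" "\<psi> (v w) \<noteq> \<zero>"
      using IH[of "v w"] v0[OF wM] by blast
    note g = linear_functionalD[OF lin[OF \<psi>(1)]]
    \<comment> \<open>With this constant \<open>\<psi> - ?c \<phi> j\<close> equals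
      \<open>\<psi>\<close> composed with \<open>v\<close>, hence vanishes on all of
      \<open>W\<close> and not only on the kernel of \<open>\<phi> j\<close>.\<close>
    let ?c = "\<psi> u \<otimes> inv (\<phi> j u)"
    have c: "?c \<in> carrier R" using g uM unit by auto
    have e: "\<psi> x \<ominus> ?c \<otimes> \<phi> j x = \<psi> (v x)" if "x \<in> carrier M" for x
    proof -
      have "\<psi> (v x) = \<psi> x \<ominus> r x \<otimes> \<psi> u"
        using that rc[OF that] uM g(3) linear_functional_minus[OF lin[OF \<psi>(1)]] by (simp add: v_def)
      also have "r x \<otimes> \<psi> u = ?c \<otimes> \<phi> j x"
        using that f(1) uM unit g(1) by (simp add: r_def m_ac)
      finally show ?thesis by simp
    qed
    have "(\<lambda>x. \<psi> x \<ominus> ?c \<otimes> \<phi> j x) \<in> \<Phi>" by (rule closed[OF \<psi>(1) fjP c])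
    moreover have "\<psi> x \<ominus> ?c \<otimes> \<phi> j x = \<zero>" if "x \<in> W" for x
    proof -
      have "x \<in> carrier M" using that W(1) by blast
      then show ?thesis using e v0 vW[OF that] \<psi>(2) by simp
    qed
    moreover have "\<psi> w \<ominus> ?c \<otimes> \<phi> j w \<noteq> \<zero>" using e[OF wM] \<psi>(3) by simp
    ultimately show ?thesis by (intro bexI[of _ "\<lambda>x. \<psi> x \<ominus> ?c \<otimes> \<phi> j x"] conjI ballI)
  next
    case False
    \<comment> \<open>Here \<open>W\<close> lies in the kernel of \<open>\<phi> j\<close>: either
      \<open>w\<close> does too and the induction hypothesis applies to it, or
      \<open>\<phi> j\<close> itself separates.\<close>
    show ?thesis
    proof (cases "\<phi> j w = \<zero>")
      case True
      then obtain \<psi> where "\<psi> \<in> \<Phi>" "\<forall>x\<in>?W0. \<psi> x = \<zero>" "\<psi> w \<noteq> \<zero>"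
        using IH[of w] insert.prems(5,6) by blast
      then show ?thesis using False by blast
    next
      case nz: False
      then show ?thesis using False fjP by blast
    qed
  qed
qed

text \<open>The same elimination, now collecting vectors: a pivot for \<open>\<phi> j\<close>, if
  there is one, together with a spanning set of the kernel of \<open>\<phi> j\<close> spans
  \<open>W\<close>. It provides finite dimensionality of the subalgebras.\<close>

lemma submodule_finitely_spanned:
  assumes K: "field R" and J: "finite J"
    and lin: "\<And>j. j \<in> J \<Longrightarrow> linear_functional R M (\<phi> j)"
    and W: "submodule W R M"
    and inj: "\<And>x. x \<in> W \<Longrightarrow> (\<And>j. j \<in> J \<Longrightarrow> \<phi> j x = \<zero>) \<Longrightarrow> x = \<zero>\<^bsub>M\<^esub>"
  shows "\<exists>B. finite B \<and> B \<subseteq> W \<and>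
    (\<forall>v\<in>W. \<exists>c. c \<in> B \<rightarrow>\<^sub>E carrier R \<and> v = (\<Oplus>\<^bsub>M\<^esub>b\<in>B. c b \<odot>\<^bsub>M\<^esub> b))"
  using J lin W inj
proof (induction J arbitrary: W)
  case empty
  then have "W \<subseteq> {\<zero>\<^bsub>M\<^esub>}" by blast
  then show ?case by (intro exI[of _ "{}"]) auto
next
  case (insert j J)
  interpret K: field R by (rule K)
  note W = submoduleE[OF insert.prems(2)]
  have fj: "linear_functional R M (\<phi> j)" using insert.prems(1) by auto
  note f = linear_functionalD[OF fj]
  let ?W0 = "{x \<in> W. \<phi> j x = \<zero>}"
  have "\<exists>B. finite B \<and> B \<subseteq> ?W0 \<and>
      (\<forall>v\<in>?W0. \<exists>c. c \<in> B \<rightarrow>\<^sub>E carrier R \<and> v = (\<Oplus>\<^bsub>M\<^esub>b\<in>B. c b \<odot>\<^bsub>M\<^esub> b))"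
    using insert.prems by (intro insert.IH) (auto intro: submodule_kernel fj)
  then obtain B where B: "finite B" "B \<subseteq> ?W0"
    and span: "\<And>v. v \<in> ?W0 \<Longrightarrow> \<exists>c. c \<in> B \<rightarrow>\<^sub>E carrier R \<and> v = (\<Oplus>\<^bsub>M\<^esub>b\<in>B. c b \<odot>\<^bsub>M\<^esub> b)"
    by blast
  show ?case
  proof (cases "\<exists>u\<in>W. \<phi> j u \<noteq> \<zero>")
    case True
    then obtain u where u: "u \<in> W" "\<phi> j u \<noteq> \<zero>" by blast
    then have uM: "u \<in> carrier M" using W(1) by blast
    have unit: "\<phi> j u \<in> Units R" using u uM f(1) K.field_Units by auto
    \<comment> \<open>As \<open>\<phi> j\<close> vanishes on \<open>B\<close> but not at the pivot,
      the update \<open>c(u := r)\<close> leaves the coefficients on \<open>B\<close>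
      untouched.\<close>
    have uB: "u \<notin> B" using B u by blast
    have BM: "B \<subseteq> carrier M" using B W by blast
    show ?thesis
    proof (intro exI[of _ "insert u B"] conjI ballI)
      show "finite (insert u B)" "insert u B \<subseteq> W" using B u by auto
      fix x assume x: "x \<in> W"
      then have xM: "x \<in> carrier M" using W(1) by blast
      define r where "r = \<phi> j x \<otimes> inv (\<phi> j u)"
      have r: "r \<in> carrier R" using f(1) xM unit by (simp add: r_def)
      have ru: "r \<odot>\<^bsub>M\<^esub> u \<in> W" using W(4)[OF r u(1)] .
      let ?v = "x \<ominus>\<^bsub>M\<^esub> r \<odot>\<^bsub>M\<^esub> u"
      have "\<phi> j ?v = \<phi> j x \<ominus> r \<otimes> \<phi> j u"
        using xM r uM f(3) linear_functional_minus[OF fj] by simp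
      also have "r \<otimes> \<phi> j u = \<phi> j x" using xM uM f(1) unit by (simp add: r_def m_assoc)
      finally have "\<phi> j ?v = \<zero>" using xM f(1) by simp
      moreover have "?v \<in> W" by (rule submodule_diff[OF insert.prems(2) x ru])
      ultimately obtain c where c: "c \<in> B \<rightarrow>\<^sub>E carrier R" "?v = (\<Oplus>\<^bsub>M\<^esub>b\<in>B. c b \<odot>\<^bsub>M\<^esub> b)"
        using span[of ?v] by blast
      have "(\<Oplus>\<^bsub>M\<^esub>b\<in>insert u B. (c(u := r)) b \<odot>\<^bsub>M\<^esub> b) =
          r \<odot>\<^bsub>M\<^esub> u \<oplus>\<^bsub>M\<^esub> (\<Oplus>\<^bsub>M\<^esub>b\<in>B. (c(u := r)) b \<odot>\<^bsub>M\<^esub> b)"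
        using B uB c(1) r uM BM by (subst M.finsum_insert) (auto intro!: smult_closed)
      also have "(\<Oplus>\<^bsub>M\<^esub>b\<in>B. (c(u := r)) b \<odot>\<^bsub>M\<^esub> b) = ?v"
        unfolding c(2) using uB c(1) BM by (intro M.finsum_cong') (auto intro!: smult_closed)
      also have "r \<odot>\<^bsub>M\<^esub> u \<oplus>\<^bsub>M\<^esub> ?v = x"
        using xM uM r by (simp add: a_minus_def M.a_lcomm M.r_neg)
      finally have "x = (\<Oplus>\<^bsub>M\<^esub>b\<in>insert u B. (c(u := r)) b \<odot>\<^bsub>M\<^esub> b)" by simp
      moreover have "c(u := r) \<in> insert u B \<rightarrow>\<^sub>E carrier R" using c(1) r by (auto simp: PiE_iff extensional_def)
      ultimately show "\<exists>c. c \<in> insert u B \<rightarrow>\<^sub>E carrier R \<and> x = (\<Oplus>\<^bsub>M\<^esub>b\<in>insert u B. c b \<odot>\<^bsub>M\<^esub> b)"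
        by blast
    qed
  next
    case False
    then have "?W0 = W" by blast
    then show ?thesis using B span by auto
  qed
qed

end

section \<open>Denominators and the comparison of subspaces\<close>

lemma common_denominator:
  assumes F: "field_of_fractions R E \<iota>" and "finite Z" "Z \<subseteq> carrier E"
  shows "\<exists>d\<in>carrier R - {\<zero>\<^bsub>R\<^esub>}. \<forall>z\<in>Z. \<iota> d \<otimes>\<^bsub>E\<^esub> z \<in> \<iota> ` carrier R"
  using assms(2,3)
proof (induction Z)
  case empty
  interpret R: domain R using F by (simp add: field_of_fractions_def)
  show ?case using R.one_not_zero by (intro bexI[of _ "\<one>\<^bsub>R\<^esub>"]) auto
next
  case (insert z Z)
  interpret R: domain R using F by (simp add: field_of_fractions_def)
  interpret E: field E using F by (simp add: field_of_fractions_def)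
  have hom: "\<iota> \<in> ring_hom R E" and inj: "inj_on \<iota> (carrier R)"
    using F by (auto simp: field_of_fractions_def)
  interpret ring_hom_ring R E \<iota>
    using hom by (intro ring_hom_ringI2) (auto intro: R.ring_axioms E.ring_axioms)
  obtain d where d: "d \<in> carrier R" "d \<noteq> \<zero>\<^bsub>R\<^esub>" "\<And>z. z \<in> Z \<Longrightarrow> \<iota> d \<otimes>\<^bsub>E\<^esub> z \<in> \<iota> ` carrier R"
    using insert by auto
  obtain a b where ab: "a \<in> carrier R" "b \<in> carrier R" "b \<noteq> \<zero>\<^bsub>R\<^esub>" "z = \<iota> a \<otimes>\<^bsub>E\<^esub> inv\<^bsub>E\<^esub> (\<iota> b)"
    using F insert.prems unfolding field_of_fractions_def by blast
  have "\<iota> b \<noteq> \<zero>\<^bsub>E\<^esub>" using ab inj by (metis R.zero_closed hom_zero inj_onD)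
  then have u: "\<iota> b \<in> Units E" using ab E.field_Units by auto
  have "\<iota> b \<otimes>\<^bsub>E\<^esub> z = \<iota> a \<otimes>\<^bsub>E\<^esub> (\<iota> b \<otimes>\<^bsub>E\<^esub> inv\<^bsub>E\<^esub> (\<iota> b))"
    unfolding ab(4) using ab u E.Units_inv_closed[OF u] by (intro E.m_lcomm) auto
  then have bz: "\<iota> b \<otimes>\<^bsub>E\<^esub> z = \<iota> a" using ab u by simp
  have im: "\<iota> r \<otimes>\<^bsub>E\<^esub> y \<in> \<iota> ` carrier R" if "r \<in> carrier R" "y \<in> \<iota> ` carrier R" for r y
    using that by (auto simp flip: hom_mult)
  show ?case
  proof (intro bexI[of _ "d \<otimes>\<^bsub>R\<^esub> b"] ballI)
    show "d \<otimes>\<^bsub>R\<^esub> b \<in> carrier R - {\<zero>\<^bsub>R\<^esub>}" using d ab R.integral by auto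
    fix y assume y: "y \<in> insert z Z"
    show "\<iota> (d \<otimes>\<^bsub>R\<^esub> b) \<otimes>\<^bsub>E\<^esub> y \<in> \<iota> ` carrier R"
    proof (cases "y = z")
      case True
      have "\<iota> (d \<otimes>\<^bsub>R\<^esub> b) \<otimes>\<^bsub>E\<^esub> y = \<iota> d \<otimes>\<^bsub>E\<^esub> (\<iota> b \<otimes>\<^bsub>E\<^esub> z)"
        using d ab insert.prems by (simp add: True E.m_assoc)
      then show ?thesis using im[OF d(1)] bz ab by simp
    next
      case False
      then have "y \<in> Z" "y \<in> carrier E" using y insert.prems by auto
      moreover have "\<iota> (d \<otimes>\<^bsub>R\<^esub> b) \<otimes>\<^bsub>E\<^esub> y = \<iota> b \<otimes>\<^bsub>E\<^esub> (\<iota> d \<otimes>\<^bsub>E\<^esub> y)"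
        using d ab \<open>y \<in> carrier E\<close> by (simp add: E.m_ac)
      ultimately show ?thesis using im[OF ab(2)] d(3) by simp
    qed
  qed
qed

text \<open>The last hypothesis says that the integral points of \<open>W'\<close> agree modulo \<open>\<mm>\<close> with points of
  \<open>W\<close>, which are then integral too.\<close>

lemma subspace_eq_if_reductions_eq:
  assumes D: "dedekind_ring R E \<iota>" and m: "maximalideal \<mm> R"
    and V: "module E V" and J: "finite J"
    and lin: "\<And>j. j \<in> J \<Longrightarrow> linear_functional E V (\<phi> j)"
    and inj\<phi>: "\<And>x. x \<in> carrier V \<Longrightarrow> (\<And>j. j \<in> J \<Longrightarrow> \<phi> j x = \<zero>\<^bsub>E\<^esub>) \<Longrightarrow> x = \<zero>\<^bsub>V\<^esub>"
    and W: "submodule W E V" and W': "submodule W' E V" and sub: "W \<subseteq> W'"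
    and red: "\<And>x. x \<in> W' \<Longrightarrow> (\<And>j. j \<in> J \<Longrightarrow> \<phi> j x \<in> \<iota> ` carrier R) \<Longrightarrow>
      \<exists>l\<in>W. \<forall>j\<in>J. \<phi> j (x \<ominus>\<^bsub>V\<^esub> l) \<in> \<iota> ` \<mm>"
  shows "W = W'"
proof (rule ccontr)
  assume "W \<noteq> W'"
  interpret R: noetherian_domain R using D by (simp add: dedekind_ring_def)
  have E: "field E" and hom: "\<iota> \<in> ring_hom R E" and inj: "inj_on \<iota> (carrier R)"
    and F: "field_of_fractions R E \<iota>"
    using D by (auto simp: dedekind_ring_def field_of_fractions_def)
  interpret E: field E by (rule E)
  interpret ring_hom_ring R E \<iota>
    using hom by (intro ring_hom_ringI2) (auto intro: R.ring_axioms E.ring_axioms)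
  interpret V: module E V by (rule V)
  note WE = V.submoduleE[OF W] and WE' = V.submoduleE[OF W']
  have nz: "\<iota> d \<noteq> \<zero>\<^bsub>E\<^esub>" if "d \<in> carrier R" "d \<noteq> \<zero>\<^bsub>R\<^esub>" for d
    using that inj by (metis R.zero_closed hom_zero inj_onD)
  have im_mult: "y \<otimes>\<^bsub>E\<^esub> z \<in> \<iota> ` carrier R" if "y \<in> \<iota> ` carrier R" "z \<in> \<iota> ` carrier R" for y z
    using that by (auto simp flip: hom_mult)
  have im_minus: "y \<ominus>\<^bsub>E\<^esub> z \<in> \<iota> ` carrier R" if yz: "y \<in> \<iota> ` carrier R" "z \<in> \<iota> ` carrier R" for y z
  proof -
    obtain a b where ab: "a \<in> carrier R" "b \<in> carrier R" "y = \<iota> a" "z = \<iota> b" using yz by auto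
    then have "y \<ominus>\<^bsub>E\<^esub> z = \<iota> (a \<ominus>\<^bsub>R\<^esub> b)" by (simp add: a_minus_def)
    then show ?thesis using ab by simp
  qed
  define int where "int x \<longleftrightarrow> (\<forall>j\<in>J. \<phi> j x \<in> \<iota> ` carrier R)" for x
  obtain w0 where w0: "w0 \<in> W'" "w0 \<notin> W" using sub \<open>W \<noteq> W'\<close> by blast
  then have w0V: "w0 \<in> carrier V" using WE' by blast
  obtain d0 where d0: "d0 \<in> carrier R" "d0 \<noteq> \<zero>\<^bsub>R\<^esub>"
    and d0w: "\<And>j. j \<in> J \<Longrightarrow> \<iota> d0 \<otimes>\<^bsub>E\<^esub> \<phi> j w0 \<in> \<iota> ` carrier R"
    using common_denominator[OF F, of "(\<lambda>j. \<phi> j w0) ` J"] J linear_functionalD(1)[OF lin w0V]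
    by (auto simp: image_subset_iff)
  \<comment> \<open>Clearing denominators makes the witness integral; since
    \<open>\<iota> d0\<close> is a unit of \<open>E\<close>, it still lies outside
    \<open>W\<close>.\<close>
  define w where "w = \<iota> d0 \<odot>\<^bsub>V\<^esub> w0"
  have w: "w \<in> W'" "w \<in> carrier V" using WE'(4)[OF _ w0(1)] w0V d0 by (auto simp: w_def)
  have "int w" using d0w d0 w0V linear_functionalD(3)[OF lin] by (simp add: int_def w_def)
  have "w \<notin> W"
  proof
    assume "w \<in> W"
    have u: "\<iota> d0 \<in> Units E" using nz d0 E.field_Units by auto
    have "inv\<^bsub>E\<^esub> (\<iota> d0) \<odot>\<^bsub>V\<^esub> w = w0"
      using u w0V d0 by (simp add: w_def V.smult_assoc1[symmetric])
    then show False using \<open>w \<in> W\<close> WE(4)[of "inv\<^bsub>E\<^esub> (\<iota> d0)" w] u w0 by auto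
  qed
  have mR: "x \<in> carrier R" if "x \<in> \<mm>" for x
    using that m ideal.Icarr[OF maximalideal.axioms(1)] by metis
  show False
  proof (cases "\<mm> = {\<zero>\<^bsub>R\<^esub>}")
    \<comment> \<open>With \<mm> zero a congruence modulo \<mm> is an equality of coordinates, so
      \<open>w\<close> itself lies in \<open>W\<close>.\<close>
    case True
    obtain l where l: "l \<in> W" "\<forall>j\<in>J. \<phi> j (w \<ominus>\<^bsub>V\<^esub> l) \<in> \<iota> ` \<mm>"
      using red[OF w(1)] \<open>int w\<close> by (auto simp: int_def)
    have lV: "l \<in> carrier V" using l WE by blast
    have "w \<ominus>\<^bsub>V\<^esub> l = \<zero>\<^bsub>V\<^esub>" by (rule inj\<phi>) (use l lV w True in auto)
    then have "w = l"
      using lV w V.minus_equality[of w "\<ominus>\<^bsub>V\<^esub> l"] by (simp add: a_minus_def)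
    then show False using l \<open>w \<notin> W\<close> by simp
  next
    case False
    obtain c where c: "c \<in> carrier E" "c \<notin> \<iota> ` carrier R"
      and cm: "\<And>x. x \<in> \<mm> \<Longrightarrow> c \<otimes>\<^bsub>E\<^esub> \<iota> x \<in> \<iota> ` carrier R"
      using dedekind_inverse_element[OF D m False] by blast
    \<comment> \<open>One denominator \<open>d\<close> must serve all integral points at once, since
      the powers of \<open>c\<close> are read off at a different integral point for each
      exponent.\<close>
    define \<Phi> where "\<Phi> = {\<psi>. linear_functional E V \<psi> \<and>
      (\<exists>d\<in>carrier R - {\<zero>\<^bsub>R\<^esub>}. \<forall>x\<in>carrier V. int x \<longrightarrow> \<iota> d \<otimes>\<^bsub>E\<^esub> \<psi> x \<in> \<iota> ` carrier R)}"
    have "\<exists>\<psi>\<in>\<Phi>. (\<forall>x\<in>W. \<psi> x = \<zero>\<^bsub>E\<^esub>) \<and> \<psi> w \<noteq> \<zero>\<^bsub>E\<^esub>"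
    proof (rule V.separating_functional[OF E J _ _ _ W W' sub w(1) \<open>w \<notin> W\<close>])
      show "\<phi> j \<in> \<Phi>" if "j \<in> J" for j
        using that lin[OF that] linear_functionalD(1)[OF lin[OF that]] R.one_not_zero
        by (auto simp: \<Phi>_def int_def intro!: bexI[of _ "\<one>\<^bsub>R\<^esub>"])
      show "linear_functional E V \<psi>" if "\<psi> \<in> \<Phi>" for \<psi> using that by (simp add: \<Phi>_def)
      show "x = \<zero>\<^bsub>V\<^esub>" if "x \<in> W'" "\<And>j. j \<in> J \<Longrightarrow> \<phi> j x = \<zero>\<^bsub>E\<^esub>" for x
        using inj\<phi>[of x] that WE' by blast
      fix \<psi> \<chi> r assume \<psi>: "\<psi> \<in> \<Phi>" and \<chi>: "\<chi> \<in> \<Phi>" and r: "r \<in> carrier E"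
      obtain d1 where d1: "d1 \<in> carrier R" "d1 \<noteq> \<zero>\<^bsub>R\<^esub>"
        "\<And>x. x \<in> carrier V \<Longrightarrow> int x \<Longrightarrow> \<iota> d1 \<otimes>\<^bsub>E\<^esub> \<psi> x \<in> \<iota> ` carrier R"
        using \<psi> by (auto simp: \<Phi>_def)
      obtain d2 where d2: "d2 \<in> carrier R" "d2 \<noteq> \<zero>\<^bsub>R\<^esub>"
        "\<And>x. x \<in> carrier V \<Longrightarrow> int x \<Longrightarrow> \<iota> d2 \<otimes>\<^bsub>E\<^esub> \<chi> x \<in> \<iota> ` carrier R"
        using \<chi> by (auto simp: \<Phi>_def)
      obtain b where b: "b \<in> carrier R" "b \<noteq> \<zero>\<^bsub>R\<^esub>" "\<iota> b \<otimes>\<^bsub>E\<^esub> r \<in> \<iota> ` carrier R"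
        using common_denominator[OF F, of "{r}"] r by auto
      \<comment> \<open>The denominators of \<open>\<psi>\<close>, of \<open>\<chi>\<close> and of
        the constant \<open>r\<close> multiply.\<close>
      let ?d = "d1 \<otimes>\<^bsub>R\<^esub> (d2 \<otimes>\<^bsub>R\<^esub> b)"
      have "\<iota> ?d \<otimes>\<^bsub>E\<^esub> (\<psi> x \<ominus>\<^bsub>E\<^esub> r \<otimes>\<^bsub>E\<^esub> \<chi> x) \<in> \<iota> ` carrier R" if x: "x \<in> carrier V" "int x" for x
      proof -
        have \<psi>x: "\<psi> x \<in> carrier E" and \<chi>x: "\<chi> x \<in> carrier E"
          using x \<psi> \<chi> by (auto simp: \<Phi>_def dest: linear_functionalD(1))
        have "\<iota> ?d \<otimes>\<^bsub>E\<^esub> (\<psi> x \<ominus>\<^bsub>E\<^esub> r \<otimes>\<^bsub>E\<^esub> \<chi> x) =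
            \<iota> (d2 \<otimes>\<^bsub>R\<^esub> b) \<otimes>\<^bsub>E\<^esub> (\<iota> d1 \<otimes>\<^bsub>E\<^esub> \<psi> x) \<ominus>\<^bsub>E\<^esub>
            \<iota> d1 \<otimes>\<^bsub>E\<^esub> ((\<iota> b \<otimes>\<^bsub>E\<^esub> r) \<otimes>\<^bsub>E\<^esub> (\<iota> d2 \<otimes>\<^bsub>E\<^esub> \<chi> x))"
          using d1(1) d2(1) b(1) r \<psi>x \<chi>x by (simp add: a_minus_def E.r_distr E.r_minus E.m_ac)
        also have "\<dots> \<in> \<iota> ` carrier R"
          using im_minus[OF im_mult[OF imageI d1(3)[OF x]] im_mult[OF imageI im_mult[OF b(3) d2(3)[OF x]]],
              of "d2 \<otimes>\<^bsub>R\<^esub> b" d1] d1(1) d2(1) b(1) by simp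
        finally show ?thesis .
      qed
      moreover have "?d \<in> carrier R - {\<zero>\<^bsub>R\<^esub>}" using d1(1,2) d2(1,2) b(1,2) R.integral by auto
      ultimately show "(\<lambda>x. \<psi> x \<ominus>\<^bsub>E\<^esub> r \<otimes>\<^bsub>E\<^esub> \<chi> x) \<in> \<Phi>"
        using \<psi> \<chi> r V.linear_functional_diff_smult unfolding \<Phi>_def by blast
    qed
    then obtain \<psi> d where \<psi>W: "\<And>x. x \<in> W \<Longrightarrow> \<psi> x = \<zero>\<^bsub>E\<^esub>" and \<psi>w: "\<psi> w \<noteq> \<zero>\<^bsub>E\<^esub>"
      and l\<psi>: "linear_functional E V \<psi>" and d: "d \<in> carrier R" "d \<noteq> \<zero>\<^bsub>R\<^esub>"
      and d\<psi>: "\<And>x. x \<in> carrier V \<Longrightarrow> int x \<Longrightarrow> \<iota> d \<otimes>\<^bsub>E\<^esub> \<psi> x \<in> \<iota> ` carrier R"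
      by (auto simp: \<Phi>_def)
    note g = linear_functionalD[OF l\<psi>]
    have iter: "\<exists>x\<in>W'. int x \<and> \<psi> x = \<psi> w \<otimes>\<^bsub>E\<^esub> c [^]\<^bsub>E\<^esub> n" for n :: nat
    proof (induction n)
      case 0
      then show ?case using w \<open>int w\<close> g(1) by (intro bexI[of _ w]) auto
    next
      case (Suc n)
      then obtain x where x: "x \<in> W'" "int x" "\<psi> x = \<psi> w \<otimes>\<^bsub>E\<^esub> c [^]\<^bsub>E\<^esub> n" by blast
      obtain l where l: "l \<in> W" "\<And>j. j \<in> J \<Longrightarrow> \<phi> j (x \<ominus>\<^bsub>V\<^esub> l) \<in> \<iota> ` \<mm>"
        using red[OF x(1)] x(2) by (auto simp: int_def)
      have xV: "x \<in> carrier V" and lV: "l \<in> carrier V" using x l WE WE' by auto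
      have xl: "x \<ominus>\<^bsub>V\<^esub> l \<in> W'" using V.submodule_diff[OF W' x(1)] l sub by blast
      let ?y = "c \<odot>\<^bsub>V\<^esub> (x \<ominus>\<^bsub>V\<^esub> l)"
      have "int ?y"
        unfolding int_def
      proof
        fix j assume j: "j \<in> J"
        obtain z where z: "z \<in> \<mm>" "\<phi> j (x \<ominus>\<^bsub>V\<^esub> l) = \<iota> z" using l(2)[OF j] by blast
        have "\<phi> j ?y = c \<otimes>\<^bsub>E\<^esub> \<iota> z" using linear_functionalD(3)[OF lin[OF j] c(1)] xV lV z by simp
        then show "\<phi> j ?y \<in> \<iota> ` carrier R" using cm[OF z(1)] by simp
      qed
      moreover have "?y \<in> W'" by (rule WE'(4)[OF c(1) xl])
      moreover have "\<psi> ?y = c \<otimes>\<^bsub>E\<^esub> (\<psi> x \<ominus>\<^bsub>E\<^esub> \<psi> l)"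
        using g(3)[OF c(1)] xV lV V.linear_functional_minus[OF l\<psi>] by simp
      then have "\<psi> ?y = \<psi> w \<otimes>\<^bsub>E\<^esub> c [^]\<^bsub>E\<^esub> Suc n"
        using \<psi>W[OF l(1)] x(3) c(1) g(1)[OF w(2)] by (simp add: a_minus_def E.m_ac)
      ultimately show ?case by blast
    qed
    \<comment> \<open>Put \<open>e = d \<psi>(w)\<close>, which is nonzero. At the points supplied
      by \<open>iter\<close> the value \<open>d \<psi>(x)\<close> is \<open>e c^n\<close>, and it
      lies in the ring.\<close>
    have "integral_over R E \<iota> c"
    proof (rule almost_integral_imp_integral[OF R.noetherian_domain_axioms E hom inj c(1)])
      show "\<iota> d \<otimes>\<^bsub>E\<^esub> \<psi> w \<in> carrier E" using d g(1)[OF w(2)] by simp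
      show "\<iota> d \<otimes>\<^bsub>E\<^esub> \<psi> w \<noteq> \<zero>\<^bsub>E\<^esub>" using nz[OF d] \<psi>w E.integral[of "\<iota> d" "\<psi> w"] d g(1)[OF w(2)] by auto
      fix n :: nat
      obtain x where x: "x \<in> W'" "int x" "\<psi> x = \<psi> w \<otimes>\<^bsub>E\<^esub> c [^]\<^bsub>E\<^esub> n" using iter by blast
      then have "\<iota> d \<otimes>\<^bsub>E\<^esub> (\<psi> w \<otimes>\<^bsub>E\<^esub> c [^]\<^bsub>E\<^esub> n) \<in> \<iota> ` carrier R" using d\<psi>[of x] WE' by auto
      then show "\<iota> d \<otimes>\<^bsub>E\<^esub> \<psi> w \<otimes>\<^bsub>E\<^esub> c [^]\<^bsub>E\<^esub> n \<in> \<iota> ` carrier R"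
        using d c g(1)[OF w(2)] by (simp add: E.m_assoc)
    qed
    then show False using D c by (auto simp: dedekind_ring_def)
  qed
qed


section \<open>Base change of endomorphisms\<close>

lemma linear_mapsD:
  assumes "h \<in> linear_maps R M N"
  shows "h \<in> carrier M \<rightarrow>\<^sub>E carrier N"
    and "x \<in> carrier M \<Longrightarrow> h x \<in> carrier N"
    and "x \<in> carrier M \<Longrightarrow> y \<in> carrier M \<Longrightarrow> h (x \<oplus>\<^bsub>M\<^esub> y) = h x \<oplus>\<^bsub>N\<^esub> h y"
    and "a \<in> carrier R \<Longrightarrow> x \<in> carrier M \<Longrightarrow> h (a \<odot>\<^bsub>M\<^esub> x) = a \<odot>\<^bsub>N\<^esub> h x"
  using assms by (auto simp: linear_maps_def)

lemma linear_maps_eqI: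
  assumes "g \<in> linear_maps R M N" "h \<in> linear_maps R M N"
    and "\<And>x. x \<in> carrier M \<Longrightarrow> g x = h x"
  shows "g = h"
  by (rule PiE_ext[OF linear_mapsD(1)[OF assms(1)] linear_mapsD(1)[OF assms(2)] assms(3)])

lemma End_module_simps:
  "carrier (End_module R V) = linear_maps R V V"
  "f \<otimes>\<^bsub>End_module R V\<^esub> g = compose (carrier V) f g"
  "\<one>\<^bsub>End_module R V\<^esub> = (\<lambda>x\<in>carrier V. x)"
  "\<zero>\<^bsub>End_module R V\<^esub> = (\<lambda>x\<in>carrier V. \<zero>\<^bsub>V\<^esub>)"
  "f \<oplus>\<^bsub>End_module R V\<^esub> g = (\<lambda>x\<in>carrier V. f x \<oplus>\<^bsub>V\<^esub> g x)"
  "a \<odot>\<^bsub>End_module R V\<^esub> f = (\<lambda>x\<in>carrier V. a \<odot>\<^bsub>V\<^esub> f x)"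
  by (simp_all add: End_module_def)

lemma (in module) End_module_closed:
  "f \<in> linear_maps R M M \<Longrightarrow> g \<in> linear_maps R M M \<Longrightarrow> compose (carrier M) f g \<in> linear_maps R M M"
  "(\<lambda>x\<in>carrier M. x) \<in> linear_maps R M M"
  "(\<lambda>x\<in>carrier M. \<zero>\<^bsub>M\<^esub>) \<in> linear_maps R M M"
  "f \<in> linear_maps R M M \<Longrightarrow> g \<in> linear_maps R M M \<Longrightarrow>
    (\<lambda>x\<in>carrier M. f x \<oplus>\<^bsub>M\<^esub> g x) \<in> linear_maps R M M"
  "a \<in> carrier R \<Longrightarrow> f \<in> linear_maps R M M \<Longrightarrow> (\<lambda>x\<in>carrier M. a \<odot>\<^bsub>M\<^esub> f x) \<in> linear_maps R M M"
proof -
  show "compose (carrier M) f g \<in> linear_maps R M M"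
    if "f \<in> linear_maps R M M" "g \<in> linear_maps R M M"
    using linear_mapsD[OF that(1)] linear_mapsD[OF that(2)]
    by (auto simp: linear_maps_def compose_def)
  show "(\<lambda>x\<in>carrier M. x) \<in> linear_maps R M M" "(\<lambda>x\<in>carrier M. \<zero>\<^bsub>M\<^esub>) \<in> linear_maps R M M"
    by (auto simp: linear_maps_def)
  show "(\<lambda>x\<in>carrier M. f x \<oplus>\<^bsub>M\<^esub> g x) \<in> linear_maps R M M"
    if "f \<in> linear_maps R M M" "g \<in> linear_maps R M M"
    using linear_mapsD[OF that(1)] linear_mapsD[OF that(2)]
    by (auto simp: linear_maps_def smult_r_distr M.a_ac)
  show "(\<lambda>x\<in>carrier M. a \<odot>\<^bsub>M\<^esub> f x) \<in> linear_maps R M M"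
    if "a \<in> carrier R" "f \<in> linear_maps R M M"
    using that(1) linear_mapsD[OF that(2)]
    by (auto simp: linear_maps_def smult_r_distr m_comm simp flip: smult_assoc1)
qed

lemma (in module) assoc_algebra_End_module: "assoc_algebra R (End_module R M)"
proof -
  let ?E = "End_module R M"
  note s = End_module_simps and c = End_module_closed
  have ext: "(\<lambda>x\<in>carrier M. h x) = f"
    if "f \<in> linear_maps R M M" "\<And>x. x \<in> carrier M \<Longrightarrow> h x = f x" for f h
    using PiE_restrict[OF linear_mapsD(1)[OF that(1)]] that(2) by (metis restrict_ext)
  have ab: "abelian_group ?E"
  proof (rule abelian_groupI)
    fix f g h assume f: "f \<in> carrier ?E" and g: "g \<in> carrier ?E" and h: "h \<in> carrier ?E"
    note fgh = f[unfolded s(1)] g[unfolded s(1)] h[unfolded s(1)]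
    note l = linear_mapsD(2)[OF fgh(1)] linear_mapsD(2)[OF fgh(2)] linear_mapsD(2)[OF fgh(3)]
    show "f \<oplus>\<^bsub>?E\<^esub> g \<in> carrier ?E" using fgh by (simp add: s c)
    show "f \<oplus>\<^bsub>?E\<^esub> g \<oplus>\<^bsub>?E\<^esub> h = f \<oplus>\<^bsub>?E\<^esub> (g \<oplus>\<^bsub>?E\<^esub> h)"
      unfolding s by (intro restrict_ext) (use l in \<open>simp add: M.a_assoc\<close>)
    show "f \<oplus>\<^bsub>?E\<^esub> g = g \<oplus>\<^bsub>?E\<^esub> f" unfolding s by (intro restrict_ext M.a_comm l)
    show "\<zero>\<^bsub>?E\<^esub> \<oplus>\<^bsub>?E\<^esub> f = f" unfolding s by (rule ext[OF fgh(1)]) (use l in simp)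
    have "(\<lambda>x\<in>carrier M. (\<ominus> \<one>) \<odot>\<^bsub>M\<^esub> f x) \<oplus>\<^bsub>?E\<^esub> f = \<zero>\<^bsub>?E\<^esub>"
      unfolding s by (intro restrict_ext) (use l in \<open>simp add: smult_l_minus M.l_neg\<close>)
    moreover have "(\<lambda>x\<in>carrier M. (\<ominus> \<one>) \<odot>\<^bsub>M\<^esub> f x) \<in> carrier ?E" using fgh by (simp add: s c)
    ultimately show "\<exists>g\<in>carrier ?E. g \<oplus>\<^bsub>?E\<^esub> f = \<zero>\<^bsub>?E\<^esub>" by blast
  qed (simp add: s c)
  have mod: "Module.module R ?E"
  proof (rule moduleI[OF is_cring ab])
    fix a b f g assume a: "a \<in> carrier R" and b: "b \<in> carrier R"
      and f: "f \<in> carrier ?E" and g: "g \<in> carrier ?E"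
    note fg = f[unfolded s(1)] g[unfolded s(1)]
    note l = linear_mapsD(2)[OF fg(1)] linear_mapsD(2)[OF fg(2)]
    show "a \<odot>\<^bsub>?E\<^esub> f \<in> carrier ?E" using a fg by (simp add: s c)
    show "(a \<oplus> b) \<odot>\<^bsub>?E\<^esub> f = a \<odot>\<^bsub>?E\<^esub> f \<oplus>\<^bsub>?E\<^esub> b \<odot>\<^bsub>?E\<^esub> f"
      unfolding s by (intro restrict_ext) (use a b l in \<open>simp add: smult_l_distr\<close>)
    show "a \<odot>\<^bsub>?E\<^esub> (f \<oplus>\<^bsub>?E\<^esub> g) = a \<odot>\<^bsub>?E\<^esub> f \<oplus>\<^bsub>?E\<^esub> a \<odot>\<^bsub>?E\<^esub> g"
      unfolding s by (intro restrict_ext) (use a l in \<open>simp add: smult_r_distr\<close>)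
    show "(a \<otimes> b) \<odot>\<^bsub>?E\<^esub> f = a \<odot>\<^bsub>?E\<^esub> (b \<odot>\<^bsub>?E\<^esub> f)"
      unfolding s by (intro restrict_ext) (use a b l in \<open>simp add: smult_assoc1\<close>)
  next
    fix f assume "f \<in> carrier ?E"
    then have f: "f \<in> linear_maps R M M" by (simp add: s)
    show "\<one> \<odot>\<^bsub>?E\<^esub> f = f" unfolding s by (rule ext[OF f]) (use linear_mapsD(2)[OF f] in simp)
  qed
  have ring: "ring ?E"
  proof (rule ringI[OF ab])
    show "Group.monoid ?E"
    proof (rule monoidI)
      fix f g h assume f: "f \<in> carrier ?E" and g: "g \<in> carrier ?E" and h: "h \<in> carrier ?E"
      note fgh = f[unfolded s(1)] g[unfolded s(1)] h[unfolded s(1)]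
      note l = linear_mapsD(2)[OF fgh(1)] linear_mapsD(2)[OF fgh(2)] linear_mapsD(2)[OF fgh(3)]
      show "f \<otimes>\<^bsub>?E\<^esub> g \<in> carrier ?E" using fgh by (simp add: s c)
      show "f \<otimes>\<^bsub>?E\<^esub> g \<otimes>\<^bsub>?E\<^esub> h = f \<otimes>\<^bsub>?E\<^esub> (g \<otimes>\<^bsub>?E\<^esub> h)"
        unfolding s compose_def by (intro restrict_ext) (use l in simp)
      show "\<one>\<^bsub>?E\<^esub> \<otimes>\<^bsub>?E\<^esub> f = f" unfolding s compose_def by (rule ext[OF fgh(1)]) (use l in simp)
      show "f \<otimes>\<^bsub>?E\<^esub> \<one>\<^bsub>?E\<^esub> = f" unfolding s compose_def by (rule ext[OF fgh(1)]) (use l in simp)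
    qed (simp add: s c)
    fix f g h assume f: "f \<in> carrier ?E" and g: "g \<in> carrier ?E" and h: "h \<in> carrier ?E"
    note fgh = f[unfolded s(1)] g[unfolded s(1)] h[unfolded s(1)]
    note l = linear_mapsD(2,3)[OF fgh(1)] linear_mapsD(2,3)[OF fgh(2)] linear_mapsD(2,3)[OF fgh(3)]
    show "(f \<oplus>\<^bsub>?E\<^esub> g) \<otimes>\<^bsub>?E\<^esub> h = f \<otimes>\<^bsub>?E\<^esub> h \<oplus>\<^bsub>?E\<^esub> g \<otimes>\<^bsub>?E\<^esub> h"
      unfolding s compose_def by (intro restrict_ext) (use l in simp)
    show "h \<otimes>\<^bsub>?E\<^esub> (f \<oplus>\<^bsub>?E\<^esub> g) = h \<otimes>\<^bsub>?E\<^esub> f \<oplus>\<^bsub>?E\<^esub> h \<otimes>\<^bsub>?E\<^esub> g"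
      unfolding s compose_def by (intro restrict_ext) (use l in simp)
  qed
  have "(a \<odot>\<^bsub>?E\<^esub> f) \<otimes>\<^bsub>?E\<^esub> g = a \<odot>\<^bsub>?E\<^esub> (f \<otimes>\<^bsub>?E\<^esub> g) \<and> f \<otimes>\<^bsub>?E\<^esub> (a \<odot>\<^bsub>?E\<^esub> g) = a \<odot>\<^bsub>?E\<^esub> (f \<otimes>\<^bsub>?E\<^esub> g)"
    if a: "a \<in> carrier R" and f: "f \<in> carrier ?E" and g: "g \<in> carrier ?E" for a f g
  proof -
    note fg = f[unfolded s(1)] g[unfolded s(1)]
    note l = linear_mapsD(2-4)[OF fg(1)] linear_mapsD(2-4)[OF fg(2)]
    show ?thesis unfolding s compose_def by (intro conjI restrict_ext) (use a l in simp_all)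
  qed
  with mod ring show ?thesis by (simp add: assoc_algebra_def)
qed

text \<open>Only additivity is asked, because the lemma is applied alike to functionals, to
  endomorphisms and to the formation of pure tensors with a fixed second factor.\<close>

lemma additive_map_finsum:
  assumes "abelian_group M" "abelian_group N"
    and h: "\<And>x. x \<in> carrier M \<Longrightarrow> h x \<in> carrier N"
    and add: "\<And>x y. x \<in> carrier M \<Longrightarrow> y \<in> carrier M \<Longrightarrow> h (x \<oplus>\<^bsub>M\<^esub> y) = h x \<oplus>\<^bsub>N\<^esub> h y"
    and "finite J" "\<And>j. j \<in> J \<Longrightarrow> y j \<in> carrier M"
  shows "h (\<Oplus>\<^bsub>M\<^esub>j\<in>J. y j) = (\<Oplus>\<^bsub>N\<^esub>j\<in>J. h (y j))"
proof -
  interpret M: abelian_group M by fact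
  interpret N: abelian_group N by fact
  have "h \<zero>\<^bsub>M\<^esub> \<oplus>\<^bsub>N\<^esub> h \<zero>\<^bsub>M\<^esub> = h \<zero>\<^bsub>M\<^esub>" using add[of "\<zero>\<^bsub>M\<^esub>" "\<zero>\<^bsub>M\<^esub>"] by simp
  then have h0: "h \<zero>\<^bsub>M\<^esub> = \<zero>\<^bsub>N\<^esub>" using h by (simp add: N.add.l_cancel_one)
  show ?thesis
    using assms(5,6)
  proof (induction J)
    case (insert j J)
    then show ?case using add h by (simp add: Pi_def)
  qed (simp add: h0)
qed

text \<open>Such data exhibit \<open>M\<close> as a direct summand of a free module of finite rank.\<close>

definition dual_basis ::
    "('a, 'x) ring_scheme \<Rightarrow> ('a, 'b, 'y) module_scheme \<Rightarrow> 'i set \<Rightarrow> ('i \<Rightarrow> 'b) \<Rightarrow> ('i \<Rightarrow> 'b \<Rightarrow> 'a) \<Rightarrow> bool"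
  where "dual_basis R M J t \<phi> \<longleftrightarrow>
    finite J \<and> (\<forall>j\<in>J. t j \<in> carrier M \<and> linear_functional R M (\<phi> j)) \<and>
    (\<forall>x\<in>carrier M. x = (\<Oplus>\<^bsub>M\<^esub>j\<in>J. \<phi> j x \<odot>\<^bsub>M\<^esub> t j))"

section \<open>Pure tensors, extended functionals and matrix coefficients\<close>

context scalar_extension
begin

abbreviation (input) "pure \<equiv> pure_tensor R S f M"

lemma pure_add_left:
  "x \<in> carrier M \<Longrightarrow> y \<in> carrier M \<Longrightarrow> s \<in> carrier S \<Longrightarrow> pure (x \<oplus>\<^bsub>M\<^esub> y) s = pure x s \<oplus>\<^bsub>T\<^esub> pure y s"
  using coset_eqI[of "frag_of (x \<oplus>\<^bsub>M\<^esub> y, s)" "frag_of (x, s) + frag_of (y, s)"] rel1[of x y s]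
  by (simp add: pure_tensor_def add_T F_gen F_add diff_diff_eq)

lemma pure_smult_left:
  "a \<in> carrier R \<Longrightarrow> x \<in> carrier M \<Longrightarrow> s \<in> carrier S \<Longrightarrow> pure (a \<odot>\<^bsub>M\<^esub> x) s = pure x (f a \<otimes>\<^bsub>S\<^esub> s)"
  unfolding pure_tensor_def by (intro coset_eqI F_gen rel3) (auto simp: f_closed)

lemma pure_eq_smult: "x \<in> carrier M \<Longrightarrow> s \<in> carrier S \<Longrightarrow> pure x s = s \<odot>\<^bsub>T\<^esub> pure x \<one>\<^bsub>S\<^esub>"
  by (simp add: smult_pure_tensor)

lemma pure_finsum:
  assumes "finite J" "\<And>j. j \<in> J \<Longrightarrow> y j \<in> carrier M" "s \<in> carrier S"
  shows "pure (\<Oplus>\<^bsub>M\<^esub>j\<in>J. y j) s = (\<Oplus>\<^bsub>T\<^esub>j\<in>J. pure (y j) s)"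
  using assms module.axioms(2)[OF module_base_change] M.abelian_group_axioms
  by (intro additive_map_finsum) (auto simp: pure_carrier pure_add_left)

text \<open>The negative of a pure tensor is pure, with \<open>- x\<close> as first factor; hence
  sums suffice and differences need no case.\<close>

lemma base_change_induct [consumes 1, case_names pure add]:
  assumes "u \<in> carrier T"
    and pure: "\<And>x s. x \<in> carrier M \<Longrightarrow> s \<in> carrier S \<Longrightarrow> P (pure x s)"
    and add: "\<And>u v. u \<in> carrier T \<Longrightarrow> v \<in> carrier T \<Longrightarrow> P u \<Longrightarrow> P v \<Longrightarrow> P (u \<oplus>\<^bsub>T\<^esub> v)"
  shows "P u"
proof -
  interpret T: Module.module S T by (rule module_base_change)
  have P0: "P (N #>\<^bsub>F\<^esub> 0)"
  proof -
    have z: "0 \<in> carrier F" by (simp add: in_F)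
    have "N #>\<^bsub>F\<^esub> 0 = \<zero>\<^bsub>T\<^esub>"
      using add_T[OF z z] z T.add.l_cancel_one[of "N #>\<^bsub>F\<^esub> 0" "N #>\<^bsub>F\<^esub> 0"]
      by (auto simp: carrier_T)
    moreover have "pure \<zero>\<^bsub>M\<^esub> \<zero>\<^bsub>S\<^esub> = \<zero>\<^bsub>T\<^esub>"
      using pure_eq_smult[of "\<zero>\<^bsub>M\<^esub>" "\<zero>\<^bsub>S\<^esub>"] pure_carrier[of "\<zero>\<^bsub>M\<^esub>" "\<one>\<^bsub>S\<^esub>"] by simp
    ultimately show ?thesis using pure[of "\<zero>\<^bsub>M\<^esub>" "\<zero>\<^bsub>S\<^esub>"] by simp
  qed
  obtain a where a: "a \<in> carrier F" "u = N #>\<^bsub>F\<^esub> a" using assms(1) by (auto simp: carrier_T)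
  \<comment> \<open>\<open>F_induct\<close> has a difference step, whereas \<open>P\<close> is only
    closed under sums; carrying \<open>- a\<close> along turns \<open>a - b\<close> into
    \<open>a + (- b)\<close>.\<close>
  have "a \<in> carrier F \<and> - a \<in> carrier F \<and> P (N #>\<^bsub>F\<^esub> a) \<and> P (N #>\<^bsub>F\<^esub> (- a))"
    using a(1)
  proof (induction rule: F_induct)
    case zero
    then show ?case using P0 by (simp add: in_F)
  next
    case (gen x t)
    \<comment> \<open>Both sides are additive inverses of \<open>pure x t\<close>.\<close>
    have "N #>\<^bsub>F\<^esub> (- frag_of (x, t)) = pure (\<ominus>\<^bsub>M\<^esub> x) t"
    proof -
      have "pure \<zero>\<^bsub>M\<^esub> t = \<zero>\<^bsub>T\<^esub>"
        using pure_smult_left[of "\<zero>" x t] gen pure_eq_smult[of x "\<zero>\<^bsub>S\<^esub>"]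
          ring_hom_zero[OF f_hom R.ring_axioms S.ring_axioms] pure_carrier[of x "\<one>\<^bsub>S\<^esub>"] by simp
      then have 1: "pure (\<ominus>\<^bsub>M\<^esub> x) t \<oplus>\<^bsub>T\<^esub> pure x t = \<zero>\<^bsub>T\<^esub>"
        using gen pure_add_left[of "\<ominus>\<^bsub>M\<^esub> x" x t] by (simp add: M.l_neg)
      have n: "- frag_of (x, t) \<in> carrier F" using gen by (simp add: in_F)
      have "(N #>\<^bsub>F\<^esub> (- frag_of (x, t))) \<oplus>\<^bsub>T\<^esub> pure x t = N #>\<^bsub>F\<^esub> 0"
        unfolding pure_tensor_def using add_T[OF n F_gen] gen by simp
      also have "\<dots> = \<zero>\<^bsub>T\<^esub>"
        using add_T[of 0 0] T.add.l_cancel_one[of "N #>\<^bsub>F\<^esub> 0" "N #>\<^bsub>F\<^esub> 0"]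
        by (auto simp: carrier_T in_F)
      finally show ?thesis
        using 1 T.minus_equality n gen pure_carrier by (metis M.a_inv_closed carrier_T imageI)
    qed
    then show ?case using pure gen by (simp add: in_F) (simp add: pure_tensor_def)
  next
    case (diff a b)
    then have "N #>\<^bsub>F\<^esub> (a - b) = (N #>\<^bsub>F\<^esub> a) \<oplus>\<^bsub>T\<^esub> (N #>\<^bsub>F\<^esub> (- b))"
      "N #>\<^bsub>F\<^esub> (- (a - b)) = (N #>\<^bsub>F\<^esub> b) \<oplus>\<^bsub>T\<^esub> (N #>\<^bsub>F\<^esub> (- a))"
      by (simp_all add: add_T)
    moreover have "N #>\<^bsub>F\<^esub> c \<in> carrier T" if "c \<in> carrier F" for c using that by (auto simp: carrier_T)
    ultimately show ?case using diff F_diff[of a b] F_diff[of b a] add by auto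
  qed
  then show ?thesis using a by simp
qed

text \<open>This is \<open>\<phi>\<close> tensored with the identity. The assignment on generators
  extends to the free abelian group, kills the bilinearity relations and so factors through the
  quotient; compatibility with scalars is then checked on pure tensors.\<close>

lemma linear_functional_extends:
  assumes \<phi>: "linear_functional R M \<phi>"
  shows "\<exists>\<Phi>. linear_functional S T \<Phi> \<and>
    (\<forall>x\<in>carrier M. \<forall>s\<in>carrier S. \<Phi> (pure x s) = f (\<phi> x) \<otimes>\<^bsub>S\<^esub> s)"
proof -
  note p = linear_functionalD[OF \<phi>]
  have fp: "f (\<phi> x) \<in> carrier S" if "x \<in> carrier M" for x using p(1)[OF that] f_closed by simp
  let ?g = "\<lambda>(x, s). f (\<phi> x) \<otimes>\<^bsub>S\<^esub> s"
  have "?g ` (carrier M \<times> carrier S) \<subseteq> carrier (add_monoid S)" using fp by auto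
  then obtain h where "h \<in> hom (free_Abelian_group (carrier M \<times> carrier S)) (add_monoid S)"
    and hg0: "\<And>p. p \<in> carrier M \<times> carrier S \<Longrightarrow> h (frag_of p) = ?g p"
    by (rule comm_group.free_Abelian_group_universal[OF S.a_comm_group]) blast
  then have h: "h \<in> hom F (add_monoid S)" by (simp add: tensor_free_def)
  have hg: "h (frag_of (x, s)) = f (\<phi> x) \<otimes>\<^bsub>S\<^esub> s" if "x \<in> carrier M" "s \<in> carrier S" for x s
    using hg0[of "(x, s)"] that by simp
  interpret h: group_hom F "add_monoid S" h
    using h group_F S.a_group by (simp add: group_hom_def group_hom_axioms_def)
  have hc: "h a \<in> carrier S" if "a \<in> carrier F" for a using h.hom_closed[OF that] by simp
  have hdiff: "h (a - b) = h a \<ominus>\<^bsub>S\<^esub> h b" if "a \<in> carrier F" "b \<in> carrier F" for a b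
  proof -
    have "h (a - b) \<oplus>\<^bsub>S\<^esub> h b = h a"
      using h.hom_mult[OF F_diff[OF that] that(2)] by (simp add: mult_F)
    then show ?thesis using hc that F_diff[OF that]
      by (metis S.add.inv_solve_right a_minus_def)
  qed
  have cancel: "x \<oplus>\<^bsub>S\<^esub> y \<ominus>\<^bsub>S\<^esub> x \<ominus>\<^bsub>S\<^esub> y = \<zero>\<^bsub>S\<^esub>" if "x \<in> carrier S" "y \<in> carrier S" for x y
    using that by (simp add: a_minus_def S.a_comm[of x y] S.a_assoc S.r_neg)
  have rel0: "h r = \<zero>\<^bsub>S\<^esub>" if "r \<in> tensor_relations R S f M" for r
    using that unfolding tensor_relations_def
  proof (elim UnE CollectE exE conjE)
    fix x y s assume [simp]: "x \<in> carrier M" "y \<in> carrier M" "s \<in> carrier S"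
      and r: "r = frag_of (x \<oplus>\<^bsub>M\<^esub> y, s) - frag_of (x, s) - frag_of (y, s)"
    have "h r = (f (\<phi> x) \<oplus>\<^bsub>S\<^esub> f (\<phi> y)) \<otimes>\<^bsub>S\<^esub> s \<ominus>\<^bsub>S\<^esub> f (\<phi> x) \<otimes>\<^bsub>S\<^esub> s \<ominus>\<^bsub>S\<^esub> f (\<phi> y) \<otimes>\<^bsub>S\<^esub> s"
      unfolding r by (simp add: hdiff F_diff F_gen hg p ring_hom_add[OF f_hom])
    also have "\<dots> = \<zero>\<^bsub>S\<^esub>"
      using fp[of x] fp[of y] by (simp add: S.l_distr cancel)
    finally show ?thesis .
  next
    fix x s t assume [simp]: "x \<in> carrier M" "s \<in> carrier S" "t \<in> carrier S"
      and r: "r = frag_of (x, s \<oplus>\<^bsub>S\<^esub> t) - frag_of (x, s) - frag_of (x, t)"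
    have "h r = f (\<phi> x) \<otimes>\<^bsub>S\<^esub> (s \<oplus>\<^bsub>S\<^esub> t) \<ominus>\<^bsub>S\<^esub> f (\<phi> x) \<otimes>\<^bsub>S\<^esub> s \<ominus>\<^bsub>S\<^esub> f (\<phi> x) \<otimes>\<^bsub>S\<^esub> t"
      unfolding r by (simp add: hdiff F_diff F_gen hg)
    also have "\<dots> = \<zero>\<^bsub>S\<^esub>"
      using fp[of x] by (simp add: S.r_distr cancel)
    finally show ?thesis .
  next
    fix a x s assume [simp]: "a \<in> carrier R" "x \<in> carrier M" "s \<in> carrier S"
      and r: "r = frag_of (a \<odot>\<^bsub>M\<^esub> x, s) - frag_of (x, f a \<otimes>\<^bsub>S\<^esub> s)"
    have "h r = (f a \<otimes>\<^bsub>S\<^esub> f (\<phi> x)) \<otimes>\<^bsub>S\<^esub> s \<ominus>\<^bsub>S\<^esub> f (\<phi> x) \<otimes>\<^bsub>S\<^esub> (f a \<otimes>\<^bsub>S\<^esub> s)"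
      unfolding r by (simp add: hdiff F_gen hg p f_closed ring_hom_mult[OF f_hom])
    also have "\<dots> = \<zero>\<^bsub>S\<^esub>"
      using fp[of x] f_closed[of a] by (simp add: S.m_ac)
    finally show ?thesis .
  qed
  have "N \<subseteq> kernel F (add_monoid S) h"
    unfolding tensor_kernel_def
  proof (rule group.generate_subgroup_incl[OF group_F _ h.subgroup_kernel])
    show "tensor_relations R S f M \<subseteq> kernel F (add_monoid S) h"
      using rel0 relations_carrier by (auto simp: kernel_def)
  qed
  then obtain \<Phi> where \<Phi>: "\<Phi> \<in> hom (F Mod N) (add_monoid S)"
    and \<Phi>h: "\<And>a. a \<in> carrier F \<Longrightarrow> \<Phi> (N #>\<^bsub>F\<^esub> a) = h a"
    using h.FactGroup_universal_kernel[OF normal_N] by blast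
  have e: "carrier T = carrier (F Mod N)" "\<And>u v. u \<oplus>\<^bsub>T\<^esub> v = u \<otimes>\<^bsub>F Mod N\<^esub> v"
    by (simp_all add: base_change_def)
  have pu: "\<Phi> (pure x s) = f (\<phi> x) \<otimes>\<^bsub>S\<^esub> s" if "x \<in> carrier M" "s \<in> carrier S" for x s
    using that \<Phi>h[OF F_gen] hg by (simp add: pure_tensor_def)
  have cl: "\<Phi> u \<in> carrier S" if "u \<in> carrier T" for u
    using hom_in_carrier[OF \<Phi>] that e by simp
  have ad: "\<Phi> (u \<oplus>\<^bsub>T\<^esub> v) = \<Phi> u \<oplus>\<^bsub>S\<^esub> \<Phi> v" if "u \<in> carrier T" "v \<in> carrier T" for u v
    using hom_mult[OF \<Phi>] that e by simp
  interpret T: Module.module S T by (rule module_base_change)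
  have "\<Phi> (a \<odot>\<^bsub>T\<^esub> u) = a \<otimes>\<^bsub>S\<^esub> \<Phi> u" if "a \<in> carrier S" "u \<in> carrier T" for a u
    using that(2)
  proof (induction rule: base_change_induct)
    case (pure x s)
    then show ?case using that(1) fp[of x] by (simp add: smult_pure_tensor pu S.m_lcomm)
  next
    case (add u v)
    then show ?case using that(1) by (simp add: T.smult_r_distr ad S.r_distr cl)
  qed
  then have "linear_functional S T \<Phi>" using cl ad by (intro linear_functionalI)
  then show ?thesis using pu by blast
qed

text \<open>The values on pure tensors determine the functional on \<open>carrier T\<close>, so the
  choice is harmless there; elsewhere its values are arbitrary.\<close>

definition extend_functional where
  "extend_functional \<phi> = (SOME \<Phi>. linear_functional S T \<Phi> \<and>
    (\<forall>x\<in>carrier M. \<forall>s\<in>carrier S. \<Phi> (pure x s) = f (\<phi> x) \<otimes>\<^bsub>S\<^esub> s))"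

lemma
  assumes "linear_functional R M \<phi>"
  shows linear_functional_extend: "linear_functional S T (extend_functional \<phi>)"
    and extend_functional_pure: "\<And>x s. x \<in> carrier M \<Longrightarrow> s \<in> carrier S \<Longrightarrow>
      extend_functional \<phi> (pure x s) = f (\<phi> x) \<otimes>\<^bsub>S\<^esub> s"
  using someI_ex[OF linear_functional_extends[OF assms]] by (auto simp: extend_functional_def)

text \<open>The tensors with second factor one generate \<open>T\<close> over \<open>S\<close>,
  because any other second factor is a scalar in front.\<close>

lemma linear_maps_eq_on_pure:
  assumes g: "g \<in> linear_maps S T T" and h: "h \<in> linear_maps S T T"
    and eq: "\<And>x. x \<in> carrier M \<Longrightarrow> g (pure x \<one>\<^bsub>S\<^esub>) = h (pure x \<one>\<^bsub>S\<^esub>)"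
  shows "g = h"
proof (rule linear_maps_eqI[OF g h])
  fix u assume "u \<in> carrier T"
  then show "g u = h u"
  proof (induction rule: base_change_induct)
    case (pure x s)
    then show ?case
      using eq pure_carrier linear_mapsD(4)[OF g] linear_mapsD(4)[OF h] pure_eq_smult[of x s] by simp
  next
    case (add u v)
    then show ?case using linear_mapsD(3)[OF g] linear_mapsD(3)[OF h] by simp
  qed
qed

lemma base_change_map_add:
  assumes g: "g \<in> linear_maps R M M" and h: "h \<in> linear_maps R M M"
  shows "base_change_map R S f M (g \<oplus>\<^bsub>End_module R M\<^esub> h) =
    base_change_map R S f M g \<oplus>\<^bsub>End_module S T\<^esub> base_change_map R S f M h"
proof (rule linear_maps_eq_on_pure)
  interpret T: Module.module S T by (rule module_base_change)
  have gh: "g \<oplus>\<^bsub>End_module R M\<^esub> h \<in> linear_maps R M M"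
    using g h by (simp add: End_module_simps M.End_module_closed)
  note l = base_change_map_linear[OF g] base_change_map_linear[OF h]
  show "base_change_map R S f M (g \<oplus>\<^bsub>End_module R M\<^esub> h) \<in> linear_maps S T T"
    by (rule base_change_map_linear[OF gh])
  show "base_change_map R S f M g \<oplus>\<^bsub>End_module S T\<^esub> base_change_map R S f M h \<in> linear_maps S T T"
    using l by (simp add: End_module_simps T.End_module_closed)
  fix x assume x: "x \<in> carrier M"
  show "base_change_map R S f M (g \<oplus>\<^bsub>End_module R M\<^esub> h) (pure x \<one>\<^bsub>S\<^esub>) =
    (base_change_map R S f M g \<oplus>\<^bsub>End_module S T\<^esub> base_change_map R S f M h) (pure x \<one>\<^bsub>S\<^esub>)"
    unfolding base_change_map_pure_tensor[OF gh x S.one_closed]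
    using x linear_mapsD(2)[OF g x] linear_mapsD(2)[OF h x]
    by (simp add: base_change_map_pure_tensor g h End_module_simps(5) pure_carrier pure_add_left)
qed

lemma base_change_map_smult:
  assumes g: "g \<in> linear_maps R M M" and a: "a \<in> carrier R"
  shows "base_change_map R S f M (a \<odot>\<^bsub>End_module R M\<^esub> g) =
    f a \<odot>\<^bsub>End_module S T\<^esub> base_change_map R S f M g"
proof (rule linear_maps_eq_on_pure)
  interpret T: Module.module S T by (rule module_base_change)
  have ag: "a \<odot>\<^bsub>End_module R M\<^esub> g \<in> linear_maps R M M"
    using g a by (simp add: End_module_simps M.End_module_closed)
  show "base_change_map R S f M (a \<odot>\<^bsub>End_module R M\<^esub> g) \<in> linear_maps S T T"
    by (rule base_change_map_linear[OF ag])
  show "f a \<odot>\<^bsub>End_module S T\<^esub> base_change_map R S f M g \<in> linear_maps S T T"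
    using base_change_map_linear[OF g] a by (simp add: End_module_simps T.End_module_closed f_closed)
  fix x assume x: "x \<in> carrier M"
  show "base_change_map R S f M (a \<odot>\<^bsub>End_module R M\<^esub> g) (pure x \<one>\<^bsub>S\<^esub>) =
    (f a \<odot>\<^bsub>End_module S T\<^esub> base_change_map R S f M g) (pure x \<one>\<^bsub>S\<^esub>)"
    unfolding base_change_map_pure_tensor[OF ag x S.one_closed]
    using x a linear_mapsD(2)[OF g x]
    by (simp add: base_change_map_pure_tensor g End_module_simps(6) pure_carrier pure_smult_left
        smult_pure_tensor f_closed)
qed

text \<open>Column \<open>j\<close> holds the coordinates of the image of \<open>t j\<close>. The
  \<open>t j\<close> generate but may be dependent, so endomorphisms are determined by their
  matrices although not every matrix on \<open>J\<close> comes from one.\<close>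

definition matrix_coeff where
  "matrix_coeff t \<phi> = (\<lambda>(i, j) h. extend_functional (\<phi> i) (h (pure (t j) \<one>\<^bsub>S\<^esub>)))"

lemma matrix_coeff_functional:
  assumes d: "dual_basis R M J t \<phi>" and p: "p \<in> J \<times> J"
  shows "linear_functional S (End_module S T) (matrix_coeff t \<phi> p)"
proof -
  obtain i j where ij: "p = (i, j)" "i \<in> J" "j \<in> J" using p by auto
  have l: "linear_functional S T (extend_functional (\<phi> i))"
    using d ij by (auto simp: dual_basis_def intro: linear_functional_extend)
  have t: "pure (t j) \<one>\<^bsub>S\<^esub> \<in> carrier T"
    using d ij by (auto simp: dual_basis_def intro: pure_carrier)
  show ?thesis
    using t linear_functionalD[OF l]
    by (intro linear_functionalI) (auto simp: ij(1) matrix_coeff_def End_module_simps linear_mapsD)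
qed

lemma matrix_coeff_base_change_map:
  assumes d: "dual_basis R M J t \<phi>" and ij: "i \<in> J" "j \<in> J" and g: "g \<in> linear_maps R M M"
  shows "matrix_coeff t \<phi> (i, j) (base_change_map R S f M g) = f (\<phi> i (g (t j)))"
proof -
  have t: "t j \<in> carrier M" and l: "linear_functional R M (\<phi> i)" using d ij by (auto simp: dual_basis_def)
  have gt: "g (t j) \<in> carrier M" using linear_mapsD(2)[OF g t] .
  then have "f (\<phi> i (g (t j))) \<in> carrier S" using f_closed linear_functionalD(1)[OF l] by simp
  then show ?thesis
    using t gt by (simp add: matrix_coeff_def base_change_map_pure_tensor g extend_functional_pure[OF l])
qed

text \<open>A dual basis survives base change: moving the coefficients \<open>\<phi> j x\<close>
  across the tensor sign turns the expansion of \<open>x\<close> into that of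
  \<open>pure x s\<close>.\<close>

lemma dual_basis_expansion:
  assumes d: "dual_basis R M J t \<phi>" and u: "u \<in> carrier T"
  shows "u = (\<Oplus>\<^bsub>T\<^esub>j\<in>J. extend_functional (\<phi> j) u \<odot>\<^bsub>T\<^esub> pure (t j) \<one>\<^bsub>S\<^esub>)"
proof -
  interpret T: Module.module S T by (rule module_base_change)
  have J: "finite J" and t: "\<And>j. j \<in> J \<Longrightarrow> t j \<in> carrier M"
    and l: "\<And>j. j \<in> J \<Longrightarrow> linear_functional R M (\<phi> j)"
    and ex: "\<And>x. x \<in> carrier M \<Longrightarrow> x = (\<Oplus>\<^bsub>M\<^esub>j\<in>J. \<phi> j x \<odot>\<^bsub>M\<^esub> t j)"
    using d by (auto simp: dual_basis_def)
  note L = linear_functionalD[OF linear_functional_extend[OF l]]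
  have pt: "pure (t j) \<one>\<^bsub>S\<^esub> \<in> carrier T" if "j \<in> J" for j using t that by (simp add: pure_carrier)
  show ?thesis
    using u
  proof (induction rule: base_change_induct)
    case (pure x s)
    have c: "\<phi> j x \<in> carrier R" if "j \<in> J" for j using linear_functionalD(1)[OF l[OF that] pure(1)] .
    have "pure x s = pure (\<Oplus>\<^bsub>M\<^esub>j\<in>J. \<phi> j x \<odot>\<^bsub>M\<^esub> t j) s" using ex[OF pure(1)] by simp
    also have "\<dots> = (\<Oplus>\<^bsub>T\<^esub>j\<in>J. pure (\<phi> j x \<odot>\<^bsub>M\<^esub> t j) s)"
      using J t pure c by (intro pure_finsum) auto
    also have "\<dots> = (\<Oplus>\<^bsub>T\<^esub>j\<in>J. extend_functional (\<phi> j) (pure x s) \<odot>\<^bsub>T\<^esub> pure (t j) \<one>\<^bsub>S\<^esub>)"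
    proof (intro T.M.finsum_cong' refl Pi_I)
      fix j assume j: "j \<in> J"
      have fc: "f (\<phi> j x) \<otimes>\<^bsub>S\<^esub> s \<in> carrier S" using f_closed[OF c[OF j]] pure by simp
      show "extend_functional (\<phi> j) (pure x s) \<odot>\<^bsub>T\<^esub> pure (t j) \<one>\<^bsub>S\<^esub> \<in> carrier T"
        using pt[OF j] pure fc by (simp add: extend_functional_pure[OF l[OF j]])
      show "pure (\<phi> j x \<odot>\<^bsub>M\<^esub> t j) s = extend_functional (\<phi> j) (pure x s) \<odot>\<^bsub>T\<^esub> pure (t j) \<one>\<^bsub>S\<^esub>"
        using pure t[OF j] fc c[OF j]
        by (simp add: extend_functional_pure[OF l[OF j]] pure_smult_left smult_pure_tensor)
    qed
    finally show ?case .
  next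
    case (add u v)
    have "(\<Oplus>\<^bsub>T\<^esub>j\<in>J. extend_functional (\<phi> j) (u \<oplus>\<^bsub>T\<^esub> v) \<odot>\<^bsub>T\<^esub> pure (t j) \<one>\<^bsub>S\<^esub>) =
        (\<Oplus>\<^bsub>T\<^esub>j\<in>J. extend_functional (\<phi> j) u \<odot>\<^bsub>T\<^esub> pure (t j) \<one>\<^bsub>S\<^esub> \<oplus>\<^bsub>T\<^esub>
          extend_functional (\<phi> j) v \<odot>\<^bsub>T\<^esub> pure (t j) \<one>\<^bsub>S\<^esub>)"
      using add(1,2) L pt by (intro T.M.finsum_cong') (auto simp: T.smult_l_distr)
    also have "\<dots> = (\<Oplus>\<^bsub>T\<^esub>j\<in>J. extend_functional (\<phi> j) u \<odot>\<^bsub>T\<^esub> pure (t j) \<one>\<^bsub>S\<^esub>) \<oplus>\<^bsub>T\<^esub>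
        (\<Oplus>\<^bsub>T\<^esub>j\<in>J. extend_functional (\<phi> j) v \<odot>\<^bsub>T\<^esub> pure (t j) \<one>\<^bsub>S\<^esub>)"
      using add(1,2) L pt by (intro T.M.finsum_addf) auto
    finally show ?case using add(3,4) by simp
  qed
qed

text \<open>By the expansion, column \<open>j\<close> recovers the image of the generator belonging
  to \<open>t j\<close>, and these generators span \<open>T\<close>.\<close>

lemma matrix_coeff_inject:
  assumes d: "dual_basis R M J t \<phi>" and g: "g \<in> linear_maps S T T" and h: "h \<in> linear_maps S T T"
    and eq: "\<And>p. p \<in> J \<times> J \<Longrightarrow> matrix_coeff t \<phi> p g = matrix_coeff t \<phi> p h"
  shows "g = h"
proof (rule linear_maps_eqI[OF g h])
  interpret T: Module.module S T by (rule module_base_change)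
  have J: "finite J" and t: "\<And>j. j \<in> J \<Longrightarrow> t j \<in> carrier M"
    and l: "\<And>j. j \<in> J \<Longrightarrow> linear_functional R M (\<phi> j)" using d by (auto simp: dual_basis_def)
  have pt: "pure (t j) \<one>\<^bsub>S\<^esub> \<in> carrier T" if "j \<in> J" for j using t that by (simp add: pure_carrier)
  have ght: "g (pure (t j) \<one>\<^bsub>S\<^esub>) = h (pure (t j) \<one>\<^bsub>S\<^esub>)" if j: "j \<in> J" for j
  proof -
    let ?u = "g (pure (t j) \<one>\<^bsub>S\<^esub>)" and ?v = "h (pure (t j) \<one>\<^bsub>S\<^esub>)"
    have uv: "?u \<in> carrier T" "?v \<in> carrier T"
      using linear_mapsD(2)[OF g pt[OF j]] linear_mapsD(2)[OF h pt[OF j]] .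
    have e: "extend_functional (\<phi> i) ?u = extend_functional (\<phi> i) ?v" if "i \<in> J" for i
      using eq[of "(i, j)"] that j by (simp add: matrix_coeff_def)
    have "?u = (\<Oplus>\<^bsub>T\<^esub>i\<in>J. extend_functional (\<phi> i) ?u \<odot>\<^bsub>T\<^esub> pure (t i) \<one>\<^bsub>S\<^esub>)"
      by (rule dual_basis_expansion[OF d uv(1)])
    also have "\<dots> = (\<Oplus>\<^bsub>T\<^esub>i\<in>J. extend_functional (\<phi> i) ?v \<odot>\<^bsub>T\<^esub> pure (t i) \<one>\<^bsub>S\<^esub>)"
      using e uv linear_functionalD(1)[OF linear_functional_extend[OF l]] pt
      by (intro T.M.finsum_cong') auto
    also have "\<dots> = ?v" by (rule dual_basis_expansion[OF d uv(2), symmetric])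
    finally show ?thesis .
  qed
  fix u assume u: "u \<in> carrier T"
  have fin: "k (\<Oplus>\<^bsub>T\<^esub>j\<in>J. extend_functional (\<phi> j) u \<odot>\<^bsub>T\<^esub> pure (t j) \<one>\<^bsub>S\<^esub>) =
      (\<Oplus>\<^bsub>T\<^esub>j\<in>J. extend_functional (\<phi> j) u \<odot>\<^bsub>T\<^esub> k (pure (t j) \<one>\<^bsub>S\<^esub>))"
    if k: "k \<in> linear_maps S T T" for k
  proof -
    have c: "extend_functional (\<phi> j) u \<in> carrier S" if "j \<in> J" for j
      using linear_functionalD(1)[OF linear_functional_extend[OF l[OF that]] u] .
    have "k (\<Oplus>\<^bsub>T\<^esub>j\<in>J. extend_functional (\<phi> j) u \<odot>\<^bsub>T\<^esub> pure (t j) \<one>\<^bsub>S\<^esub>) =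
        (\<Oplus>\<^bsub>T\<^esub>j\<in>J. k (extend_functional (\<phi> j) u \<odot>\<^bsub>T\<^esub> pure (t j) \<one>\<^bsub>S\<^esub>))"
      using J c pt linear_mapsD[OF k] T.M.abelian_group_axioms
      by (intro additive_map_finsum) auto
    also have "\<dots> = (\<Oplus>\<^bsub>T\<^esub>j\<in>J. extend_functional (\<phi> j) u \<odot>\<^bsub>T\<^esub> k (pure (t j) \<one>\<^bsub>S\<^esub>))"
      using c pt linear_mapsD[OF k] by (intro T.M.finsum_cong') auto
    finally show ?thesis .
  qed
  have "g u = (\<Oplus>\<^bsub>T\<^esub>j\<in>J. extend_functional (\<phi> j) u \<odot>\<^bsub>T\<^esub> g (pure (t j) \<one>\<^bsub>S\<^esub>))"
    using fin[OF g] dual_basis_expansion[OF d u] by simp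
  also have "\<dots> = (\<Oplus>\<^bsub>T\<^esub>j\<in>J. extend_functional (\<phi> j) u \<odot>\<^bsub>T\<^esub> h (pure (t j) \<one>\<^bsub>S\<^esub>))"
    using ght pt linear_mapsD(2)[OF h] linear_functionalD(1)[OF linear_functional_extend[OF l] u]
    by (intro T.M.finsum_cong') auto
  also have "\<dots> = h u"
    using fin[OF h] dual_basis_expansion[OF d u] by simp
  finally show "g u = h u" .
qed

text \<open>Lift the entries to \<open>R\<close>, let \<open>y j\<close> be the combination of the
  \<open>t i\<close> with the lifted column \<open>j\<close>, and send \<open>x\<close> to the sum
  of the \<open>\<phi> j x \<odot> y j\<close>. Going through the functionals makes this map well
  defined whatever relations the \<open>t j\<close> satisfy.\<close>

lemma integral_matrix_imp_base_change_map:
  assumes d: "dual_basis R M J t \<phi>" and h: "h \<in> linear_maps S T T"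
    and int: "\<And>p. p \<in> J \<times> J \<Longrightarrow> matrix_coeff t \<phi> p h \<in> f ` carrier R"
  shows "\<exists>g\<in>linear_maps R M M. h = base_change_map R S f M g"
proof -
  interpret T: Module.module S T by (rule module_base_change)
  have J: "finite J" and t: "\<And>j. j \<in> J \<Longrightarrow> t j \<in> carrier M"
    and l: "\<And>j. j \<in> J \<Longrightarrow> linear_functional R M (\<phi> j)"
    and ex: "\<And>x. x \<in> carrier M \<Longrightarrow> x = (\<Oplus>\<^bsub>M\<^esub>j\<in>J. \<phi> j x \<odot>\<^bsub>M\<^esub> t j)"
    using d by (auto simp: dual_basis_def)
  note L = linear_functionalD[OF l]
  have pt: "pure (t j) \<one>\<^bsub>S\<^esub> \<in> carrier T" if "j \<in> J" for j using t that by (simp add: pure_carrier)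
  \<comment> \<open>\<open>f\<close> may fail to be injective, so arbitrary preimages are
    taken.\<close>
  define m where "m i j = inv_into (carrier R) f (matrix_coeff t \<phi> (i, j) h)" for i j
  have m: "m i j \<in> carrier R" "matrix_coeff t \<phi> (i, j) h = f (m i j)" if "i \<in> J" "j \<in> J" for i j
    using int[of "(i, j)"] that inv_into_into[of _ f] f_inv_into_f[of _ f] by (auto simp: m_def)
  define y where "y j = (\<Oplus>\<^bsub>M\<^esub>i\<in>J. m i j \<odot>\<^bsub>M\<^esub> t i)" for j
  have yM: "y j \<in> carrier M" if "j \<in> J" for j
    using t m that by (auto simp: y_def intro!: M.finsum_closed)
  have hy: "h (pure (t j) \<one>\<^bsub>S\<^esub>) = pure (y j) \<one>\<^bsub>S\<^esub>" if j: "j \<in> J" for j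
  proof -
    have "pure (y j) \<one>\<^bsub>S\<^esub> = (\<Oplus>\<^bsub>T\<^esub>i\<in>J. pure (m i j \<odot>\<^bsub>M\<^esub> t i) \<one>\<^bsub>S\<^esub>)"
      unfolding y_def using J t m j by (intro pure_finsum) auto
    also have "\<dots> = (\<Oplus>\<^bsub>T\<^esub>i\<in>J. extend_functional (\<phi> i) (h (pure (t j) \<one>\<^bsub>S\<^esub>)) \<odot>\<^bsub>T\<^esub> pure (t i) \<one>\<^bsub>S\<^esub>)"
    proof (intro T.M.finsum_cong' refl Pi_I)
      fix i assume i: "i \<in> J"
      have e: "extend_functional (\<phi> i) (h (pure (t j) \<one>\<^bsub>S\<^esub>)) = f (m i j)"
        using m[OF i j] by (simp add: matrix_coeff_def)
      have fm: "f (m i j) \<in> carrier S" using m[OF i j] f_closed by simp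
      show "extend_functional (\<phi> i) (h (pure (t j) \<one>\<^bsub>S\<^esub>)) \<odot>\<^bsub>T\<^esub> pure (t i) \<one>\<^bsub>S\<^esub> \<in> carrier T"
        unfolding e using fm pt[OF i] by simp
      show "pure (m i j \<odot>\<^bsub>M\<^esub> t i) \<one>\<^bsub>S\<^esub> =
          extend_functional (\<phi> i) (h (pure (t j) \<one>\<^bsub>S\<^esub>)) \<odot>\<^bsub>T\<^esub> pure (t i) \<one>\<^bsub>S\<^esub>"
        unfolding e using fm m[OF i j] t[OF i] by (simp add: pure_smult_left smult_pure_tensor)
    qed
    also have "\<dots> = h (pure (t j) \<one>\<^bsub>S\<^esub>)"
      using dual_basis_expansion[OF d linear_mapsD(2)[OF h pt[OF j]]] by simp
    finally show ?thesis by simp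
  qed
  define g where "g = (\<lambda>x\<in>carrier M. \<Oplus>\<^bsub>M\<^esub>j\<in>J. \<phi> j x \<odot>\<^bsub>M\<^esub> y j)"
  have gc: "(\<Oplus>\<^bsub>M\<^esub>j\<in>J. \<phi> j x \<odot>\<^bsub>M\<^esub> y j) \<in> carrier M" if "x \<in> carrier M" for x
    using L that yM by (auto intro!: M.finsum_closed)
  have g: "g \<in> linear_maps R M M"
    unfolding linear_maps_def
  proof (intro CollectI conjI ballI)
    show "g \<in> carrier M \<rightarrow>\<^sub>E carrier M" using gc by (auto simp: g_def)
    fix x assume x: "x \<in> carrier M"
    show "g (x \<oplus>\<^bsub>M\<^esub> x') = g x \<oplus>\<^bsub>M\<^esub> g x'" if x': "x' \<in> carrier M" for x'
    proof -
      have "(\<Oplus>\<^bsub>M\<^esub>j\<in>J. \<phi> j (x \<oplus>\<^bsub>M\<^esub> x') \<odot>\<^bsub>M\<^esub> y j) =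
          (\<Oplus>\<^bsub>M\<^esub>j\<in>J. \<phi> j x \<odot>\<^bsub>M\<^esub> y j \<oplus>\<^bsub>M\<^esub> \<phi> j x' \<odot>\<^bsub>M\<^esub> y j)"
        using x x' L yM by (intro M.finsum_cong') (auto simp: M.smult_l_distr)
      also have "\<dots> = (\<Oplus>\<^bsub>M\<^esub>j\<in>J. \<phi> j x \<odot>\<^bsub>M\<^esub> y j) \<oplus>\<^bsub>M\<^esub> (\<Oplus>\<^bsub>M\<^esub>j\<in>J. \<phi> j x' \<odot>\<^bsub>M\<^esub> y j)"
        using x x' L yM by (intro M.finsum_addf) auto
      finally show ?thesis using x x' by (simp add: g_def)
    qed
    show "g (a \<odot>\<^bsub>M\<^esub> x) = a \<odot>\<^bsub>M\<^esub> g x" if a: "a \<in> carrier R" for a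
    proof -
      have "a \<odot>\<^bsub>M\<^esub> (\<Oplus>\<^bsub>M\<^esub>j\<in>J. \<phi> j x \<odot>\<^bsub>M\<^esub> y j) = (\<Oplus>\<^bsub>M\<^esub>j\<in>J. a \<odot>\<^bsub>M\<^esub> (\<phi> j x \<odot>\<^bsub>M\<^esub> y j))"
        using J a x L yM by (intro M.finsum_smult_ldistr) auto
      also have "\<dots> = (\<Oplus>\<^bsub>M\<^esub>j\<in>J. \<phi> j (a \<odot>\<^bsub>M\<^esub> x) \<odot>\<^bsub>M\<^esub> y j)"
        using a x L yM by (intro M.finsum_cong') (auto simp: M.smult_assoc1)
      finally show ?thesis using a x by (simp add: g_def)
    qed
  qed
  have "h = base_change_map R S f M g"
  proof (rule matrix_coeff_inject[OF d h base_change_map_linear[OF g]])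
    fix p assume "p \<in> J \<times> J"
    then obtain i j where ij: "p = (i, j)" "i \<in> J" "j \<in> J" by auto
    have "g (t j) \<in> carrier M" using linear_mapsD(2)[OF g t[OF ij(3)]] .
    \<comment> \<open>\<open>g (t j)\<close> is not \<open>y j\<close> by definition. Applying
      \<open>h\<close> to the expansion of \<open>t j\<close> shows that the two agree after base
      change.\<close>
    have "base_change_map R S f M g (pure (t j) \<one>\<^bsub>S\<^esub>) = pure (g (t j)) \<one>\<^bsub>S\<^esub>"
      using t ij g by (simp add: base_change_map_pure_tensor)
    also have "\<dots> = (\<Oplus>\<^bsub>T\<^esub>k\<in>J. pure (\<phi> k (t j) \<odot>\<^bsub>M\<^esub> y k) \<one>\<^bsub>S\<^esub>)"
      using J L t ij yM by (simp add: g_def pure_finsum)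
    also have "\<dots> = (\<Oplus>\<^bsub>T\<^esub>k\<in>J. h (pure (\<phi> k (t j) \<odot>\<^bsub>M\<^esub> t k) \<one>\<^bsub>S\<^esub>))"
    proof (intro T.M.finsum_cong' refl Pi_I)
      fix k assume k: "k \<in> J"
      have p: "\<phi> k (t j) \<in> carrier R" "f (\<phi> k (t j)) \<in> carrier S"
        using L[OF k] t ij f_closed by auto
      show "h (pure (\<phi> k (t j) \<odot>\<^bsub>M\<^esub> t k) \<one>\<^bsub>S\<^esub>) \<in> carrier T"
        using p t[OF k] linear_mapsD(2)[OF h] by (simp add: pure_carrier)
      have e: "pure (\<phi> k (t j) \<odot>\<^bsub>M\<^esub> z) \<one>\<^bsub>S\<^esub> = f (\<phi> k (t j)) \<odot>\<^bsub>T\<^esub> pure z \<one>\<^bsub>S\<^esub>"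
        if "z \<in> carrier M" for z
        using that p by (simp add: pure_smult_left smult_pure_tensor)
      show "pure (\<phi> k (t j) \<odot>\<^bsub>M\<^esub> y k) \<one>\<^bsub>S\<^esub> = h (pure (\<phi> k (t j) \<odot>\<^bsub>M\<^esub> t k) \<one>\<^bsub>S\<^esub>)"
        using e[OF t[OF k]] e[OF yM[OF k]] hy[OF k] p pt[OF k] linear_mapsD(4)[OF h] by simp
    qed
    also have "\<dots> = h (\<Oplus>\<^bsub>T\<^esub>k\<in>J. pure (\<phi> k (t j) \<odot>\<^bsub>M\<^esub> t k) \<one>\<^bsub>S\<^esub>)"
      using J L t ij linear_mapsD[OF h] T.M.abelian_group_axioms
      by (intro additive_map_finsum[symmetric]) (auto simp: pure_carrier)
    also have "(\<Oplus>\<^bsub>T\<^esub>k\<in>J. pure (\<phi> k (t j) \<odot>\<^bsub>M\<^esub> t k) \<one>\<^bsub>S\<^esub>) = pure (t j) \<one>\<^bsub>S\<^esub>"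
      using J L t ij pure_finsum[of J "\<lambda>k. \<phi> k (t j) \<odot>\<^bsub>M\<^esub> t k" "\<one>\<^bsub>S\<^esub>"] ex[of "t j"] by simp
    finally show "matrix_coeff t \<phi> p h = matrix_coeff t \<phi> p (base_change_map R S f M g)"
      by (simp add: ij matrix_coeff_def)
  qed
  with g show ?thesis by blast
qed

end


section \<open>Dual bases and reduction of subspaces\<close>

text \<open>The free module containing \<open>M\<close> may have infinite rank. A finite spanning
  set of \<open>T\<close> involves only finitely many coordinates; every other coordinate vanishes
  on \<open>T\<close>, hence on \<open>M\<close> since \<open>f\<close> is injective.\<close>

lemma (in scalar_extension) finite_dual_basis_exists:
  assumes proj: "projective_module R M" and inj: "inj_on f (carrier R)"
    and fd: "finite_dimensional S T"
  shows "\<exists>J t \<phi>. dual_basis R M (J :: 'c set) t \<phi>"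
proof -
  interpret T: Module.module S T by (rule module_base_change)
  obtain I s p where s: "s \<in> linear_maps R M (free_module R (I :: 'c set))"
    and p: "p \<in> linear_maps R (free_module R I) M"
    and ps: "\<And>x. x \<in> carrier M \<Longrightarrow> p (s x) = x"
    using proj unfolding projective_module_def by blast
  define e where "e i = (\<lambda>j\<in>I. if j = i then \<one>\<^bsub>R\<^esub> else \<zero>\<^bsub>R\<^esub>)" for i
  define t where "t i = p (e i)" for i
  define \<phi> where "\<phi> i x = s x i" for i x
  have eF: "e i \<in> carrier (free_module R I)" if "i \<in> I" for i
    using that by (auto simp: e_def free_module_def intro: finite_subset[of _ "{i}"])
  have t: "t i \<in> carrier M" if "i \<in> I" for i
    using linear_mapsD(2)[OF p eF[OF that]] by (simp add: t_def)
  have sF: "s x \<in> carrier (free_module R I)" if "x \<in> carrier M" for x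
    using linear_mapsD(2)[OF s that] .
  have lin: "linear_functional R M (\<phi> i)" if i: "i \<in> I" for i
  proof (rule linear_functionalI)
    show "\<phi> i x \<in> carrier R" if "x \<in> carrier M" for x
      using sF[OF that] i by (auto simp: free_module_def \<phi>_def)
    show "\<phi> i (x \<oplus>\<^bsub>M\<^esub> y) = \<phi> i x \<oplus>\<^bsub>R\<^esub> \<phi> i y" if "x \<in> carrier M" "y \<in> carrier M" for x y
      using linear_mapsD(3)[OF s that] i by (simp add: \<phi>_def free_module_def)
    show "\<phi> i (a \<odot>\<^bsub>M\<^esub> x) = a \<otimes>\<^bsub>R\<^esub> \<phi> i x" if "a \<in> carrier R" "x \<in> carrier M" for a x
      using linear_mapsD(4)[OF s that] i by (simp add: \<phi>_def free_module_def)
  qed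
  have p0: "p (\<lambda>i\<in>I. \<zero>\<^bsub>R\<^esub>) = \<zero>\<^bsub>M\<^esub>"
  proof -
    have z: "(\<lambda>i\<in>I. \<zero>\<^bsub>R\<^esub>) \<in> carrier (free_module R I)" by (auto simp: free_module_def)
    have "\<zero>\<^bsub>R\<^esub> \<odot>\<^bsub>free_module R I\<^esub> (\<lambda>i\<in>I. \<zero>\<^bsub>R\<^esub>) = (\<lambda>i\<in>I. \<zero>\<^bsub>R\<^esub>)"
      unfolding free_module_def by (auto intro!: restrict_ext)
    then show ?thesis
      using linear_mapsD(4)[OF p R.zero_closed z] linear_mapsD(2)[OF p z] by simp
  qed
  \<comment> \<open>\<open>A\<close> need only contain the support of \<open>g\<close>, so one
    finite set can later serve every \<open>x\<close>.\<close>
  have expand: "p g = (\<Oplus>\<^bsub>M\<^esub>i\<in>A. g i \<odot>\<^bsub>M\<^esub> t i)"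
    if "finite A" "A \<subseteq> I" "g \<in> carrier (free_module R I)" "\<And>i. i \<in> I - A \<Longrightarrow> g i = \<zero>\<^bsub>R\<^esub>" for A g
    using that
  proof (induction A arbitrary: g)
    case empty
    then have "g = (\<lambda>i\<in>I. \<zero>\<^bsub>R\<^esub>)"
      by (intro extensionalityI[of g I]) (auto simp: free_module_def PiE_iff)
    then show ?case using p0 by (simp only: M.finsum_empty)
  next
    case (insert a A)
    let ?g = "\<lambda>i\<in>I. if i = a then \<zero>\<^bsub>R\<^esub> else g i"
    have a: "a \<in> I" and gc: "\<And>i. i \<in> I \<Longrightarrow> g i \<in> carrier R" and gx: "g \<in> extensional I"
      using insert.prems by (auto simp: free_module_def PiE_iff)
    have fin: "finite {i \<in> I. g i \<noteq> \<zero>\<^bsub>R\<^esub>}"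
      using insert.prems(2) by (simp add: free_module_def)
    have g': "?g \<in> carrier (free_module R I)"
      using gc by (auto simp: free_module_def intro: finite_subset[OF _ fin])
    have ae: "g a \<odot>\<^bsub>free_module R I\<^esub> e a \<in> carrier (free_module R I)"
      using gc a by (auto simp: free_module_def e_def intro: finite_subset[of _ "{a}"])
    have "g = ?g \<oplus>\<^bsub>free_module R I\<^esub> g a \<odot>\<^bsub>free_module R I\<^esub> e a"
      using gx gc a by (intro extensionalityI[of g I]) (auto simp: free_module_def e_def)
    then have "p g = p ?g \<oplus>\<^bsub>M\<^esub> g a \<odot>\<^bsub>M\<^esub> t a"
      using linear_mapsD(3)[OF p g' ae] linear_mapsD(4)[OF p gc[OF a] eF[OF a]] by (simp add: t_def)
    also have "p ?g = (\<Oplus>\<^bsub>M\<^esub>i\<in>A. ?g i \<odot>\<^bsub>M\<^esub> t i)"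
      by (rule insert.IH[OF _ g']) (use insert.prems in auto)
    also have "\<dots> = (\<Oplus>\<^bsub>M\<^esub>i\<in>A. g i \<odot>\<^bsub>M\<^esub> t i)"
      using insert.prems(1) insert.hyps(2) gc t by (intro M.finsum_cong') auto
    also have "\<dots> \<oplus>\<^bsub>M\<^esub> g a \<odot>\<^bsub>M\<^esub> t a = (\<Oplus>\<^bsub>M\<^esub>i\<in>insert a A. g i \<odot>\<^bsub>M\<^esub> t i)"
    proof -
      have 1: "(\<lambda>i. g i \<odot>\<^bsub>M\<^esub> t i) \<in> A \<rightarrow> carrier M" and 2: "g a \<odot>\<^bsub>M\<^esub> t a \<in> carrier M"
        using insert.prems(1) gc t by auto
      show ?thesis
        using M.finsum_insert[OF insert.hyps(1,2) 1 2] M.a_comm[OF M.finsum_closed[OF 1] 2] by simp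
    qed
    finally show ?case .
  qed
  have support: "finite {i \<in> I. extend_functional (\<phi> i) u \<noteq> \<zero>\<^bsub>S\<^esub>}" if "u \<in> carrier T" for u
    using that
  proof (induction rule: base_change_induct)
    case (pure x r)
    have "finite {i \<in> I. s x i \<noteq> \<zero>\<^bsub>R\<^esub>}" using sF[OF pure(1)] by (simp add: free_module_def)
    moreover have "{i \<in> I. extend_functional (\<phi> i) (pure x r) \<noteq> \<zero>\<^bsub>S\<^esub>} \<subseteq> {i \<in> I. s x i \<noteq> \<zero>\<^bsub>R\<^esub>}"
      using pure extend_functional_pure[OF lin] ring_hom_zero[OF f_hom R.ring_axioms S.ring_axioms]
      by (auto simp: \<phi>_def)
    ultimately show ?case by (rule rev_finite_subset)
  next
    case (add u v)
    have "{i \<in> I. extend_functional (\<phi> i) (u \<oplus>\<^bsub>T\<^esub> v) \<noteq> \<zero>\<^bsub>S\<^esub>} \<subseteq>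
        {i \<in> I. extend_functional (\<phi> i) u \<noteq> \<zero>\<^bsub>S\<^esub>} \<union> {i \<in> I. extend_functional (\<phi> i) v \<noteq> \<zero>\<^bsub>S\<^esub>}"
      using linear_functionalD(2)[OF linear_functional_extend[OF lin] add(1,2)] by auto
    then show ?case using add(3,4) finite_subset by blast
  qed
  obtain B where B: "finite B" "B \<subseteq> carrier T"
    and span: "\<And>v. v \<in> carrier T \<Longrightarrow> \<exists>c. c \<in> B \<rightarrow>\<^sub>E carrier S \<and> v = (\<Oplus>\<^bsub>T\<^esub>b\<in>B. c b \<odot>\<^bsub>T\<^esub> b)"
    using fd unfolding finite_dimensional_def by blast
  define J where "J = (\<Union>b\<in>B. {i \<in> I. extend_functional (\<phi> i) b \<noteq> \<zero>\<^bsub>S\<^esub>})"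
  have J: "finite J" "J \<subseteq> I" using B support by (auto simp: J_def)
  \<comment> \<open>The extended coordinate vanishes on the spanning set \<open>B\<close>, hence at
    \<open>pure x \<one>\<close>, where its value is \<open>f (\<phi> i x)\<close>.\<close>
  have out: "\<phi> i x = \<zero>\<^bsub>R\<^esub>" if i: "i \<in> I - J" and x: "x \<in> carrier M" for i x
  proof -
    have l: "linear_functional S T (extend_functional (\<phi> i))"
      using i by (intro linear_functional_extend lin) auto
    note L = linear_functionalD[OF l]
    have b0: "extend_functional (\<phi> i) b = \<zero>\<^bsub>S\<^esub>" if "b \<in> B" for b using i that by (auto simp: J_def)
    let ?u = "pure x \<one>\<^bsub>S\<^esub>"
    have u: "?u \<in> carrier T" using x by (simp add: pure_carrier)
    obtain c where c: "c \<in> B \<rightarrow>\<^sub>E carrier S" "?u = (\<Oplus>\<^bsub>T\<^esub>b\<in>B. c b \<odot>\<^bsub>T\<^esub> b)"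
      using span[OF u] by blast
    have cb: "c b \<in> carrier S" "b \<in> carrier T" if "b \<in> B" for b using c(1) B that by auto
    have "extend_functional (\<phi> i) (\<Oplus>\<^bsub>T\<^esub>b\<in>B. c b \<odot>\<^bsub>T\<^esub> b) =
        (\<Oplus>\<^bsub>S\<^esub>b\<in>B. extend_functional (\<phi> i) (c b \<odot>\<^bsub>T\<^esub> b))"
      using B(1) cb L T.M.abelian_group_axioms S.abelian_group_axioms
      by (intro additive_map_finsum) auto
    also have "\<dots> = (\<Oplus>\<^bsub>S\<^esub>b\<in>B. \<zero>\<^bsub>S\<^esub>)"
      using cb L(3) b0 by (intro S.finsum_cong') auto
    also have "\<dots> = \<zero>\<^bsub>S\<^esub>" by (rule S.finsum_zero)
    finally have "extend_functional (\<phi> i) ?u = \<zero>\<^bsub>S\<^esub>" using c(2) by simp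
    moreover have pc: "\<phi> i x \<in> carrier R" using linear_functionalD(1)[OF lin x] i by blast
    ultimately have "f (\<phi> i x) = f \<zero>\<^bsub>R\<^esub>"
      using extend_functional_pure[OF lin x S.one_closed] i f_closed[OF pc]
        ring_hom_zero[OF f_hom R.ring_axioms S.ring_axioms] by auto
    then show ?thesis using inj pc by (auto dest: inj_onD)
  qed
  have "x = (\<Oplus>\<^bsub>M\<^esub>j\<in>J. \<phi> j x \<odot>\<^bsub>M\<^esub> t j)" if x: "x \<in> carrier M" for x
    using expand[OF J sF[OF x]] out x ps[OF x] by (simp add: \<phi>_def)
  then have "dual_basis R M J t \<phi>"
    unfolding dual_basis_def using J t lin by blast
  then show ?thesis by blast
qed

lemma (in scalar_extension) base_change_map_zero:
  "base_change_map R S f M \<zero>\<^bsub>End_module R M\<^esub> = \<zero>\<^bsub>End_module S T\<^esub>"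
proof -
  interpret T: Module.module S T by (rule module_base_change)
  have R: "Module.module R (End_module R M)" and S: "Module.module S (End_module S T)"
    using M.assoc_algebra_End_module T.assoc_algebra_End_module by (auto simp: assoc_algebra_def)
  have one: "\<one>\<^bsub>End_module R M\<^esub> \<in> linear_maps R M M"
    by (simp add: End_module_simps M.End_module_closed)
  \<comment> \<open>Writing zero as the scalar zero times the identity reduces the claim to
    compatibility with scalars.\<close>
  have "\<zero>\<^bsub>R\<^esub> \<odot>\<^bsub>End_module R M\<^esub> \<one>\<^bsub>End_module R M\<^esub> = \<zero>\<^bsub>End_module R M\<^esub>"
    using one by (intro module.smult_l_null[OF R]) (simp add: End_module_simps(1))
  moreover have "\<zero>\<^bsub>S\<^esub> \<odot>\<^bsub>End_module S T\<^esub> base_change_map R S f M \<one>\<^bsub>End_module R M\<^esub> = \<zero>\<^bsub>End_module S T\<^esub>"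
    using base_change_map_linear[OF one]
    by (intro module.smult_l_null[OF S]) (simp add: End_module_simps(1))
  ultimately show ?thesis
    using base_change_map_smult[OF one R.zero_closed]
      ring_hom_zero[OF f_hom R.ring_axioms S.ring_axioms] by simp
qed

text \<open>Base change of endomorphisms is multiplicative and unital, so it carries inverses to
  inverses. Conjugation can thus be carried out over \<open>R\<close>, and the same
  \<open>g'\<close> serves every fibre.\<close>

lemma (in scalar_extension) base_change_rep_conj:
  assumes \<rho>: "\<rho> \<in> hom G (Aut_module R M)" and \<gamma>: "\<gamma> \<in> carrier G" and g: "g \<in> linear_maps R M M"
  defines "g' \<equiv> \<rho> \<gamma> \<otimes>\<^bsub>End_module R M\<^esub> g \<otimes>\<^bsub>End_module R M\<^esub> inv\<^bsub>End_module R M\<^esub> (\<rho> \<gamma>)"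
  shows "g' \<in> linear_maps R M M"
    and "base_change_rep R S f M \<rho> \<gamma> \<otimes>\<^bsub>End_module S T\<^esub> base_change_map R S f M g \<otimes>\<^bsub>End_module S T\<^esub>
      inv\<^bsub>End_module S T\<^esub> (base_change_rep R S f M \<rho> \<gamma>) = base_change_map R S f M g'"
proof -
  interpret T: Module.module S T by (rule module_base_change)
  interpret ER: ring "End_module R M"
    using M.assoc_algebra_End_module by (simp add: assoc_algebra_def)
  interpret ES: ring "End_module S T"
    using T.assoc_algebra_End_module by (simp add: assoc_algebra_def)
  let ?b = "base_change_map R S f M"
  have mult: "?b (x \<otimes>\<^bsub>End_module R M\<^esub> y) = ?b x \<otimes>\<^bsub>End_module S T\<^esub> ?b y"
    if "x \<in> carrier (End_module R M)" "y \<in> carrier (End_module R M)" for x y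
    using that base_change_map_compose by (simp add: End_module_simps)
  have one: "?b \<one>\<^bsub>End_module R M\<^esub> = \<one>\<^bsub>End_module S T\<^esub>"
    by (simp add: End_module_simps base_change_map_id)
  have cl: "?b x \<in> carrier (End_module S T)" if "x \<in> carrier (End_module R M)" for x
    using that base_change_map_linear by (simp add: End_module_simps)
  have u: "\<rho> \<gamma> \<in> Units (End_module R M)"
    using hom_in_carrier[OF \<rho> \<gamma>] by (simp add: Aut_module_def units_of_def)
  have gc: "g \<in> carrier (End_module R M)" using g by (simp add: End_module_simps)
  have "?b (\<rho> \<gamma>) \<otimes>\<^bsub>End_module S T\<^esub> ?b (inv\<^bsub>End_module R M\<^esub> (\<rho> \<gamma>)) = \<one>\<^bsub>End_module S T\<^esub>"
    "?b (inv\<^bsub>End_module R M\<^esub> (\<rho> \<gamma>)) \<otimes>\<^bsub>End_module S T\<^esub> ?b (\<rho> \<gamma>) = \<one>\<^bsub>End_module S T\<^esub>"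
    using u one by (simp_all add: mult[symmetric] ER.Units_closed)
  then have "inv\<^bsub>End_module S T\<^esub> (?b (\<rho> \<gamma>)) = ?b (inv\<^bsub>End_module R M\<^esub> (\<rho> \<gamma>))"
    using ES.inv_unique'[of "?b (\<rho> \<gamma>)" "?b (inv\<^bsub>End_module R M\<^esub> (\<rho> \<gamma>))"] u cl
    by (simp add: ER.Units_closed)
  then show "base_change_rep R S f M \<rho> \<gamma> \<otimes>\<^bsub>End_module S T\<^esub> ?b g \<otimes>\<^bsub>End_module S T\<^esub>
      inv\<^bsub>End_module S T\<^esub> (base_change_rep R S f M \<rho> \<gamma>) = ?b g'"
    using u gc by (simp add: base_change_rep_def g'_def mult ER.Units_closed)
  have "g' \<in> carrier (End_module R M)" using u gc by (simp add: g'_def ER.Units_closed)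
  then show "g' \<in> linear_maps R M M" by (simp add: End_module_simps)
qed

lemma (in module) submoduleI':
  assumes "H \<subseteq> carrier M" "\<zero>\<^bsub>M\<^esub> \<in> H"
    and "\<And>a b. a \<in> H \<Longrightarrow> b \<in> H \<Longrightarrow> a \<oplus>\<^bsub>M\<^esub> b \<in> H"
    and smult: "\<And>a x. a \<in> carrier R \<Longrightarrow> x \<in> H \<Longrightarrow> a \<odot>\<^bsub>M\<^esub> x \<in> H"
  shows "submodule H R M"
proof (rule submoduleI[OF assms(1,2) _ assms(3,4)])
  fix x assume x: "x \<in> H"
  then have "\<ominus>\<^bsub>M\<^esub> x = (\<ominus> \<one>) \<odot>\<^bsub>M\<^esub> x" using assms(1) by (auto simp: smult_l_minus)
  then show "\<ominus>\<^bsub>M\<^esub> x \<in> H" using smult[OF _ x, of "\<ominus> \<one>"] by simp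
qed

lemma normal_subalgebra_submodule:
  assumes "module K V" "normal_subalgebra K V G \<rho> A"
  shows "submodule A K (End_module K V)"
proof -
  interpret V: module K V by fact
  interpret E: module K "End_module K V"
    using V.assoc_algebra_End_module by (simp add: assoc_algebra_def)
  have A: "subring A (End_module K V)" "\<And>a u. a \<in> carrier K \<Longrightarrow> u \<in> A \<Longrightarrow> a \<odot>\<^bsub>End_module K V\<^esub> u \<in> A"
    using assms(2) by (auto simp: normal_subalgebra_def)
  show ?thesis
    by (rule E.submoduleI') (use subringE[OF A(1)] A(2) in auto)
qed

lemma assoc_algebra_subalgebra:
  assumes B: "assoc_algebra K B" and A: "subring A B" "submodule A K B"
  shows "assoc_algebra K (B\<lparr>carrier := A\<rparr>)"
proof -
  have "module K B" "ring B" using B by (auto simp: assoc_algebra_def)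
  then show ?thesis
    using submodule.submodule_is_module[OF A(2)] ring.subring_is_ring[OF _ A(1)] B
      subringE(1)[OF A(1)] by (auto simp: assoc_algebra_def subset_iff)
qed

text \<open>One dual basis of \<open>M\<close> is fixed for both fibres, so that the matrix entries
  of \<open>gen g\<close> and \<open>spec g\<close> are images of the same elements
  \<open>\<phi> i (g (t j))\<close> of \<open>R\<close>.\<close>

locale dedekind_lattice =
  fixes R :: "('a, 'x) ring_scheme" and E :: "('e, 'y) ring_scheme" and \<iota> :: "'a \<Rightarrow> 'e"
    and M :: "('a, 'b, 'z) module_scheme" and \<mm> :: "'a set"
    and J :: "'i set" and t :: "'i \<Rightarrow> 'b" and \<phi> :: "'i \<Rightarrow> 'b \<Rightarrow> 'a"
  assumes dedekind: "dedekind_ring R E \<iota>" and module: "module R M"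
    and maximal: "maximalideal \<mm> R" and dual: "dual_basis R M J t \<phi>"
begin

abbreviation "k \<equiv> R Quot \<mm>"
abbreviation "res \<equiv> (\<lambda>a. \<mm> +>\<^bsub>R\<^esub> a)"
abbreviation "V\<^sub>E \<equiv> base_change R E \<iota> M"
abbreviation "V\<^sub>k \<equiv> base_change R k res M"
abbreviation "\<E>\<^sub>E \<equiv> End_module E V\<^sub>E"
abbreviation "\<E>\<^sub>k \<equiv> End_module k V\<^sub>k"
abbreviation "gen \<equiv> base_change_map R E \<iota> M"
abbreviation "spec \<equiv> base_change_map R k res M"

lemma domain_R: "domain R" and field_E: "field E" and inj_\<iota>: "inj_on \<iota> (carrier R)"
  using dedekind by (auto simp: dedekind_ring_def field_of_fractions_def)

lemma field_k: "field k"
  by (rule maximalideal.quotient_is_field[OF maximal domain.axioms(1)[OF domain_R]])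

sublocale R: domain R by (rule domain_R)
sublocale E: field E by (rule field_E)
sublocale k: field k by (rule field_k)

lemma scalar_extension_E: "scalar_extension R E \<iota> M"
  using dedekind module E.is_cring
  by (auto simp: scalar_extension_def scalar_extension_axioms_def dedekind_ring_def field_of_fractions_def)

lemma scalar_extension_k: "scalar_extension R k res M"
  using module k.is_cring ideal.rcos_ring_hom[OF maximalideal.axioms(1)[OF maximal]]
  by (auto simp: scalar_extension_def scalar_extension_axioms_def)

sublocale XE: scalar_extension R E \<iota> M by (rule scalar_extension_E)
sublocale Xk: scalar_extension R k res M by (rule scalar_extension_k)

lemma modules: "module E V\<^sub>E" "module k V\<^sub>k"
  by (rule XE.module_base_change, rule Xk.module_base_change)

lemma algebras: "assoc_algebra E \<E>\<^sub>E" "assoc_algebra k \<E>\<^sub>k"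
  using modules by (auto intro: module.assoc_algebra_End_module)

lemma module_E: "module E \<E>\<^sub>E" and ring_E: "ring \<E>\<^sub>E"
  and module_k: "module k \<E>\<^sub>k" and ring_k: "ring \<E>\<^sub>k"
  using algebras by (auto simp: assoc_algebra_def)

text \<open>Since \<open>\<iota>\<close> is injective, the generic matrix determines the entries in
  \<open>R\<close>, and these determine the special matrix. Commutation relations pass from the
  generic to the special fibre in this way.\<close>

lemma gen_eq_imp_spec_eq:
  assumes g: "g \<in> linear_maps R M M" and h: "h \<in> linear_maps R M M" and eq: "gen g = gen h"
  shows "spec g = spec h"
proof (rule Xk.matrix_coeff_inject[OF dual])
  show "spec g \<in> linear_maps k V\<^sub>k V\<^sub>k" "spec h \<in> linear_maps k V\<^sub>k V\<^sub>k"
    using g h by (auto intro: Xk.base_change_map_linear)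
  fix p assume "p \<in> J \<times> J"
  then obtain i j where ij: "p = (i, j)" "i \<in> J" "j \<in> J" by auto
  have c: "\<phi> i (l (t j)) \<in> carrier R" if "l \<in> linear_maps R M M" for l
    using dual ij linear_mapsD(2)[OF that] by (auto simp: dual_basis_def dest: linear_functionalD(1))
  have "\<iota> (\<phi> i (g (t j))) = \<iota> (\<phi> i (h (t j)))"
    using XE.matrix_coeff_base_change_map[OF dual ij(2,3)] g h eq by metis
  then have "\<phi> i (g (t j)) = \<phi> i (h (t j))"
    using inj_\<iota> c[OF g] c[OF h] by (auto dest: inj_onD)
  then show "Xk.matrix_coeff t \<phi> p (spec g) = Xk.matrix_coeff t \<phi> p (spec h)"
    by (simp add: ij Xk.matrix_coeff_base_change_map[OF dual] g h)
qed

definition reduction :: "_ \<Rightarrow> _" where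
  "reduction W = spec ` {g \<in> linear_maps R M M. gen g \<in> W}"

lemma reductionI: "g \<in> linear_maps R M M \<Longrightarrow> gen g \<in> W \<Longrightarrow> spec g \<in> reduction W"
  by (auto simp: reduction_def)

lemma reductionE:
  assumes "u \<in> reduction W"
  obtains g where "g \<in> linear_maps R M M" "gen g \<in> W" "u = spec g"
  using assms by (auto simp: reduction_def)

lemma reduction_subset: "reduction W \<subseteq> carrier \<E>\<^sub>k"
  by (auto simp: reduction_def End_module_simps intro: Xk.base_change_map_linear)

text \<open>The abstract comparison, with matrix entries as coordinates: integral entries mean that
  the endomorphism comes from \<open>M\<close>, and equal images in the special fibre mean congruent
  entries modulo \<mm>.\<close>

lemma subspace_eq_if_reduction_subset:
  assumes W: "submodule W E \<E>\<^sub>E" and W': "submodule W' E \<E>\<^sub>E" and sub: "W \<subseteq> W'"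
    and red: "reduction W' \<subseteq> reduction W"
  shows "W = W'"
proof (rule subspace_eq_if_reductions_eq[OF dedekind maximal module_E _ _ _ W W' sub])
  interpret VE: module E V\<^sub>E by (rule modules)
  interpret EE: module E \<E>\<^sub>E by (rule module_E)
  show "finite (J \<times> J)" using dual by (auto simp: dual_basis_def)
  show "linear_functional E \<E>\<^sub>E (XE.matrix_coeff t \<phi> p)" if "p \<in> J \<times> J" for p
    by (rule XE.matrix_coeff_functional[OF dual that])
  show "x = \<zero>\<^bsub>\<E>\<^sub>E\<^esub>" if x: "x \<in> carrier \<E>\<^sub>E" "\<And>p. p \<in> J \<times> J \<Longrightarrow> XE.matrix_coeff t \<phi> p x = \<zero>\<^bsub>E\<^esub>" for x
  proof (rule XE.matrix_coeff_inject[OF dual])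
    show "x \<in> linear_maps E V\<^sub>E V\<^sub>E" "\<zero>\<^bsub>\<E>\<^sub>E\<^esub> \<in> linear_maps E V\<^sub>E V\<^sub>E"
      using x EE.M.zero_closed by (auto simp: End_module_simps(1))
    show "XE.matrix_coeff t \<phi> p x = XE.matrix_coeff t \<phi> p \<zero>\<^bsub>\<E>\<^sub>E\<^esub>" if "p \<in> J \<times> J" for p
      using x(2)[OF that] EE.linear_functional_zero[OF XE.matrix_coeff_functional[OF dual that]] by simp
  qed
  fix x assume x: "x \<in> W'" and int: "\<And>p. p \<in> J \<times> J \<Longrightarrow> XE.matrix_coeff t \<phi> p x \<in> \<iota> ` carrier R"
  have "x \<in> linear_maps E V\<^sub>E V\<^sub>E"
    using x EE.submoduleE(1)[OF W'] by (auto simp: End_module_simps)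
  then obtain g where g: "g \<in> linear_maps R M M" "x = gen g"
    using XE.integral_matrix_imp_base_change_map[OF dual _ int] by blast
  then have "spec g \<in> reduction W" using x red by (blast intro: reductionI)
  then obtain l where l: "l \<in> linear_maps R M M" "gen l \<in> W" "spec g = spec l" by (rule reductionE)
  show "\<exists>l\<in>W. \<forall>p\<in>J \<times> J. XE.matrix_coeff t \<phi> p (x \<ominus>\<^bsub>\<E>\<^sub>E\<^esub> l) \<in> \<iota> ` \<mm>"
  proof (intro bexI[OF _ l(2)] ballI)
    fix p assume p: "p \<in> J \<times> J"
    then obtain i j where ij: "p = (i, j)" "i \<in> J" "j \<in> J" by auto
    have c: "\<phi> i (h (t j)) \<in> carrier R" if "h \<in> linear_maps R M M" for h
      using dual ij linear_mapsD(2)[OF that] by (auto simp: dual_basis_def dest: linear_functionalD(1))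
    let ?a = "\<phi> i (g (t j))" and ?b = "\<phi> i (l (t j))"
    \<comment> \<open>The matrix entries of \<open>spec g\<close> and \<open>spec l\<close> are
      cosets of \<mm>, so their equality is the required congruence.\<close>
    have "\<mm> +>\<^bsub>R\<^esub> ?a = \<mm> +>\<^bsub>R\<^esub> ?b"
      using Xk.matrix_coeff_base_change_map[OF dual ij(2,3)] g(1) l(1,3) by metis
    then have m: "?a \<ominus>\<^bsub>R\<^esub> ?b \<in> \<mm>"
      using R.quotient_eq_iff_same_a_r_cos[OF maximalideal.axioms(1)[OF maximal] c[OF g(1)] c[OF l(1)]]
      by simp
    have "gen g \<in> carrier \<E>\<^sub>E" "gen l \<in> carrier \<E>\<^sub>E"
      using g l by (auto simp: End_module_simps intro: XE.base_change_map_linear)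
    then have "XE.matrix_coeff t \<phi> p (x \<ominus>\<^bsub>\<E>\<^sub>E\<^esub> gen l) = \<iota> ?a \<ominus>\<^bsub>E\<^esub> \<iota> ?b"
      using EE.linear_functional_minus[OF XE.matrix_coeff_functional[OF dual p]] g l
      by (simp add: ij XE.matrix_coeff_base_change_map[OF dual])
    also have "\<dots> = \<iota> (?a \<ominus>\<^bsub>R\<^esub> ?b)"
    proof -
      interpret ring_hom_ring R E \<iota>
        using XE.f_hom by (intro ring_hom_ringI2) (auto intro: R.ring_axioms E.ring_axioms)
      show ?thesis using c[OF g(1)] c[OF l(1)] by (simp add: a_minus_def)
    qed
    finally show "XE.matrix_coeff t \<phi> p (x \<ominus>\<^bsub>\<E>\<^sub>E\<^esub> gen l) \<in> \<iota> ` \<mm>" using m by simp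
  qed
qed

lemma reduction_one: "\<one>\<^bsub>\<E>\<^sub>E\<^esub> \<in> W \<Longrightarrow> \<one>\<^bsub>\<E>\<^sub>k\<^esub> \<in> reduction W"
  using reductionI[of "\<lambda>x\<in>carrier M. x" W] XE.base_change_map_id Xk.base_change_map_id
    module.End_module_closed(2)[OF module] by (simp add: End_module_simps)

lemma reduction_zero: "\<zero>\<^bsub>\<E>\<^sub>E\<^esub> \<in> W \<Longrightarrow> \<zero>\<^bsub>\<E>\<^sub>k\<^esub> \<in> reduction W"
  using reductionI[of "\<zero>\<^bsub>End_module R M\<^esub>" W] XE.base_change_map_zero Xk.base_change_map_zero
    module.End_module_closed(3)[OF module] by (simp add: End_module_simps(4))

lemma reduction_add:
  assumes "\<And>x y. x \<in> W \<Longrightarrow> y \<in> W \<Longrightarrow> x \<oplus>\<^bsub>\<E>\<^sub>E\<^esub> y \<in> W" "u \<in> reduction W" "v \<in> reduction W"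
  shows "u \<oplus>\<^bsub>\<E>\<^sub>k\<^esub> v \<in> reduction W"
proof -
  obtain g where g: "g \<in> linear_maps R M M" "gen g \<in> W" "u = spec g" using assms(2) by (rule reductionE)
  obtain h where h: "h \<in> linear_maps R M M" "gen h \<in> W" "v = spec h" using assms(3) by (rule reductionE)
  have "g \<oplus>\<^bsub>End_module R M\<^esub> h \<in> linear_maps R M M"
    using module.End_module_closed(4)[OF module] g h by (simp add: End_module_simps)
  from reductionI[OF this, of W] show ?thesis
    using assms(1)[OF g(2) h(2)] g h by (simp add: XE.base_change_map_add Xk.base_change_map_add)
qed

lemma reduction_smult:
  assumes "\<And>a x. a \<in> carrier E \<Longrightarrow> x \<in> W \<Longrightarrow> a \<odot>\<^bsub>\<E>\<^sub>E\<^esub> x \<in> W" "c \<in> carrier k" "u \<in> reduction W"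
  shows "c \<odot>\<^bsub>\<E>\<^sub>k\<^esub> u \<in> reduction W"
proof -
  obtain g where g: "g \<in> linear_maps R M M" "gen g \<in> W" "u = spec g" using assms(3) by (rule reductionE)
  obtain d where d: "d \<in> carrier R" "c = res d"
    using assms(2) by (auto simp: FactRing_def A_RCOSETS_def')
  have "d \<odot>\<^bsub>End_module R M\<^esub> g \<in> linear_maps R M M"
    using module.End_module_closed(5)[OF module] g d by (simp add: End_module_simps)
  from reductionI[OF this, of W] show ?thesis
    using assms(1)[OF XE.f_closed[OF d(1)] g(2)] g d
    by (simp add: XE.base_change_map_smult Xk.base_change_map_smult)
qed

text \<open>Three separate sets allow the same statement to cover products inside a subalgebra and
  the two-sided absorption of an ideal.\<close>

lemma reduction_mult:
  assumes "\<And>x y. x \<in> W \<Longrightarrow> y \<in> W' \<Longrightarrow> x \<otimes>\<^bsub>\<E>\<^sub>E\<^esub> y \<in> W''" "u \<in> reduction W" "v \<in> reduction W'"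
  shows "u \<otimes>\<^bsub>\<E>\<^sub>k\<^esub> v \<in> reduction W''"
proof -
  obtain g where g: "g \<in> linear_maps R M M" "gen g \<in> W" "u = spec g" using assms(2) by (rule reductionE)
  obtain h where h: "h \<in> linear_maps R M M" "gen h \<in> W'" "v = spec h" using assms(3) by (rule reductionE)
  have "compose (carrier M) g h \<in> linear_maps R M M"
    using module.End_module_closed(1)[OF module] g h by simp
  from reductionI[OF this, of W''] show ?thesis
    using assms(1)[OF g(2) h(2)] g h
    by (simp add: XE.base_change_map_compose Xk.base_change_map_compose End_module_simps)
qed

lemma scalars_submodule: "submodule (scalars E \<E>\<^sub>E) E \<E>\<^sub>E"
proof -
  interpret EE: module E \<E>\<^sub>E by (rule module_E)
  have one: "\<one>\<^bsub>\<E>\<^sub>E\<^esub> \<in> carrier \<E>\<^sub>E" by (rule monoid.one_closed[OF ring.is_monoid[OF ring_E]])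
  show ?thesis
  proof (rule EE.submoduleI')
    show "scalars E \<E>\<^sub>E \<subseteq> carrier \<E>\<^sub>E" using one by (auto simp: scalars_def)
    show "\<zero>\<^bsub>\<E>\<^sub>E\<^esub> \<in> scalars E \<E>\<^sub>E"
      unfolding scalars_def using one by (intro image_eqI[of _ _ "\<zero>\<^bsub>E\<^esub>"]) auto
    show "x \<oplus>\<^bsub>\<E>\<^sub>E\<^esub> y \<in> scalars E \<E>\<^sub>E" if "x \<in> scalars E \<E>\<^sub>E" "y \<in> scalars E \<E>\<^sub>E" for x y
      using that one by (auto simp: scalars_def simp flip: EE.smult_l_distr)
    show "a \<odot>\<^bsub>\<E>\<^sub>E\<^esub> x \<in> scalars E \<E>\<^sub>E" if "a \<in> carrier E" "x \<in> scalars E \<E>\<^sub>E" for a x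
      using that one by (auto simp: scalars_def simp flip: EE.smult_assoc1)
  qed
qed

text \<open>The identity reduces to the identity and reductions of subspaces are stable under
  \<open>k\<close>. This inclusion turns an upper bound by the scalars of \<open>k\<close> into one
  by the reduction of the scalars of \<open>E\<close>.\<close>

lemma scalars_subset_reduction: "scalars k \<E>\<^sub>k \<subseteq> reduction (scalars E \<E>\<^sub>E)"
proof
  fix u assume "u \<in> scalars k \<E>\<^sub>k"
  then obtain c where c: "c \<in> carrier k" "u = c \<odot>\<^bsub>\<E>\<^sub>k\<^esub> \<one>\<^bsub>\<E>\<^sub>k\<^esub>" by (auto simp: scalars_def)
  interpret EE: module E \<E>\<^sub>E by (rule module_E)
  have "\<one>\<^bsub>\<E>\<^sub>E\<^esub> \<in> scalars E \<E>\<^sub>E"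
    using EE.smult_one[OF monoid.one_closed[OF ring.is_monoid[OF ring_E]]]
    unfolding scalars_def by (intro image_eqI[of _ _ "\<one>\<^bsub>E\<^esub>"]) auto
  then show "u \<in> reduction (scalars E \<E>\<^sub>E)"
    unfolding c(2) using c(1) EE.submoduleE(4)[OF scalars_submodule]
    by (intro reduction_smult reduction_one)
qed

end


section \<open>Reduction of normal subalgebras\<close>

context dedekind_lattice
begin

lemma normal_subalgebra_reduction:
  assumes \<rho>: "\<rho> \<in> hom G (Aut_module R M)"
    and A: "normal_subalgebra E V\<^sub>E G (base_change_rep R E \<iota> M \<rho>) A"
  shows "normal_subalgebra k V\<^sub>k G (base_change_rep R k res M \<rho>) (reduction A)"
proof -
  interpret Ek: ring \<E>\<^sub>k by (rule ring_k)
  interpret Mk: module k \<E>\<^sub>k by (rule module_k)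
  have sub: "subring A \<E>\<^sub>E" and smult: "\<And>a u. a \<in> carrier E \<Longrightarrow> u \<in> A \<Longrightarrow> a \<odot>\<^bsub>\<E>\<^sub>E\<^esub> u \<in> A"
    and conj: "\<And>\<sigma> u. \<sigma> \<in> carrier G \<Longrightarrow> u \<in> A \<Longrightarrow> base_change_rep R E \<iota> M \<rho> \<sigma> \<otimes>\<^bsub>\<E>\<^sub>E\<^esub> u \<otimes>\<^bsub>\<E>\<^sub>E\<^esub>
      inv\<^bsub>\<E>\<^sub>E\<^esub> (base_change_rep R E \<iota> M \<rho> \<sigma>) \<in> A"
    using A by (auto simp: normal_subalgebra_def)
  note A' = subringE[OF sub]
  have red_smult: "c \<odot>\<^bsub>\<E>\<^sub>k\<^esub> u \<in> reduction A" if "c \<in> carrier k" "u \<in> reduction A" for c u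
    using reduction_smult[OF smult that] .
  have "subring (reduction A) \<E>\<^sub>k"
  proof (rule Ek.subringI)
    show "reduction A \<subseteq> carrier \<E>\<^sub>k" by (rule reduction_subset)
    show "\<one>\<^bsub>\<E>\<^sub>k\<^esub> \<in> reduction A" using A'(3) by (rule reduction_one)
    show "u \<otimes>\<^bsub>\<E>\<^sub>k\<^esub> v \<in> reduction A" if "u \<in> reduction A" "v \<in> reduction A" for u v
      using reduction_mult[OF A'(6) that] .
    show "u \<oplus>\<^bsub>\<E>\<^sub>k\<^esub> v \<in> reduction A" if "u \<in> reduction A" "v \<in> reduction A" for u v
      using reduction_add[OF A'(7) that] .
    show "\<ominus>\<^bsub>\<E>\<^sub>k\<^esub> u \<in> reduction A" if u: "u \<in> reduction A" for u
    proof -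
      have "u \<in> carrier \<E>\<^sub>k" using u reduction_subset by blast
      then have "\<ominus>\<^bsub>\<E>\<^sub>k\<^esub> u = (\<ominus>\<^bsub>k\<^esub> \<one>\<^bsub>k\<^esub>) \<odot>\<^bsub>\<E>\<^sub>k\<^esub> u" by (simp add: Mk.smult_l_minus)
      then show ?thesis using red_smult[OF _ u, of "\<ominus>\<^bsub>k\<^esub> \<one>\<^bsub>k\<^esub>"] by simp
    qed
  qed
  moreover have "base_change_rep R k res M \<rho> \<sigma> \<otimes>\<^bsub>\<E>\<^sub>k\<^esub> u \<otimes>\<^bsub>\<E>\<^sub>k\<^esub>
      inv\<^bsub>\<E>\<^sub>k\<^esub> (base_change_rep R k res M \<rho> \<sigma>) \<in> reduction A"
    if \<sigma>: "\<sigma> \<in> carrier G" and u: "u \<in> reduction A" for \<sigma> u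
  proof -
    \<comment> \<open>Conjugating the lift \<open>g\<close> over \<open>R\<close> gives an
      endomorphism whose generic fibre lies in \<open>A\<close> and whose special fibre is the
      required conjugate.\<close>
    obtain g where g: "g \<in> linear_maps R M M" "gen g \<in> A" "u = spec g" using u by (rule reductionE)
    show ?thesis
      unfolding g(3) Xk.base_change_rep_conj(2)[OF \<rho> \<sigma> g(1)]
      using conj[OF \<sigma> g(2)] XE.base_change_rep_conj[OF \<rho> \<sigma> g(1)] by (intro reductionI) auto
  qed
  ultimately show ?thesis using red_smult by (auto simp: normal_subalgebra_def)
qed

lemma very_simple_lifts:
  assumes \<rho>: "\<rho> \<in> hom G (Aut_module R M)"
    and vs: "very_simple_rep k V\<^sub>k G (base_change_rep R k res M \<rho>)"
  shows "very_simple_rep E V\<^sub>E G (base_change_rep R E \<iota> M \<rho>)"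
  unfolding very_simple_rep_def
proof (intro allI impI)
  fix A assume A: "normal_subalgebra E V\<^sub>E G (base_change_rep R E \<iota> M \<rho>) A"
  interpret ME: module E \<E>\<^sub>E by (rule module_E)
  have subm: "submodule A E \<E>\<^sub>E" by (rule normal_subalgebra_submodule[OF modules(1) A])
  have sub: "subring A \<E>\<^sub>E" using A by (simp add: normal_subalgebra_def)
  from vs normal_subalgebra_reduction[OF \<rho> A]
  consider "reduction A = scalars k \<E>\<^sub>k" | "reduction A = carrier \<E>\<^sub>k"
    by (auto simp: very_simple_rep_def)
  then show "A = scalars E \<E>\<^sub>E \<or> A = carrier \<E>\<^sub>E"
  proof cases
    case 1
    have "scalars E \<E>\<^sub>E \<subseteq> A"
      using subringE(3)[OF sub] ME.submoduleE(4)[OF subm] by (auto simp: scalars_def)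
    then have "scalars E \<E>\<^sub>E = A"
      using 1 scalars_subset_reduction
      by (intro subspace_eq_if_reduction_subset scalars_submodule subm) auto
    then show ?thesis by simp
  next
    case 2
    \<comment> \<open>The reduction of the whole generic algebra is bounded only by
      \<open>carrier \<E>\<^sub>k\<close>, which is already the reduction of
      \<open>A\<close>.\<close>
    have "A = carrier \<E>\<^sub>E"
      using 2 reduction_subset ME.submoduleE(1)[OF subm]
      by (intro subspace_eq_if_reduction_subset ME.carrier_is_submodule subm) auto
    then show ?thesis by simp
  qed
qed

text \<open>The matrix entries are finitely many jointly injective functionals. The subalgebra is
  treated as a module in its own right because \<open>finite_dimensional\<close> takes its spanning
  vectors and sums there.\<close>

lemma finite_dimensional_subalgebra:
  assumes A: "submodule A E \<E>\<^sub>E"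
  shows "finite_dimensional E (\<E>\<^sub>E\<lparr>carrier := A\<rparr>)"
proof -
  interpret ME: module E \<E>\<^sub>E by (rule module_E)
  let ?B = "\<E>\<^sub>E\<lparr>carrier := A\<rparr>"
  interpret MB: module E ?B by (rule submodule.submodule_is_module[OF A module_E])
  have AE: "x \<in> carrier \<E>\<^sub>E" if "x \<in> A" for x using that ME.submoduleE(1)[OF A] by blast
  have "\<exists>B. finite B \<and> B \<subseteq> carrier ?B \<and>
    (\<forall>v\<in>carrier ?B. \<exists>c. c \<in> B \<rightarrow>\<^sub>E carrier E \<and> v = (\<Oplus>\<^bsub>?B\<^esub>b\<in>B. c b \<odot>\<^bsub>?B\<^esub> b))"
  proof (rule MB.submodule_finitely_spanned[OF field_E _ _ MB.carrier_is_submodule])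
    show "finite (J \<times> J)" using dual by (auto simp: dual_basis_def)
    show "linear_functional E ?B (XE.matrix_coeff t \<phi> p)" if "p \<in> J \<times> J" for p
      using linear_functionalD[OF XE.matrix_coeff_functional[OF dual that]] AE
      by (intro linear_functionalI) auto
    fix x assume x: "x \<in> carrier ?B" and x0: "\<And>p. p \<in> J \<times> J \<Longrightarrow> XE.matrix_coeff t \<phi> p x = \<zero>\<^bsub>E\<^esub>"
    have "x = \<zero>\<^bsub>\<E>\<^sub>E\<^esub>"
    proof (rule XE.matrix_coeff_inject[OF dual])
      show "x \<in> linear_maps E V\<^sub>E V\<^sub>E" "\<zero>\<^bsub>\<E>\<^sub>E\<^esub> \<in> linear_maps E V\<^sub>E V\<^sub>E"
        using x AE ME.M.zero_closed by (auto simp: End_module_simps(1))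
      show "XE.matrix_coeff t \<phi> p x = XE.matrix_coeff t \<phi> p \<zero>\<^bsub>\<E>\<^sub>E\<^esub>" if "p \<in> J \<times> J" for p
        using x0[OF that] ME.linear_functional_zero[OF XE.matrix_coeff_functional[OF dual that]] by simp
    qed
    then show "x = \<zero>\<^bsub>?B\<^esub>" by simp
  qed
  then show ?thesis by (simp add: finite_dimensional_def)
qed

text \<open>Simplicity of the reduction of \<open>A\<close> leaves two values for the reduction of
  an ideal \<open>I\<close>, and strict monotonicity makes \<open>I\<close> zero or
  \<open>A\<close>. The centre contains the scalars, while its reduction is central in the reduction
  of \<open>A\<close>, hence scalar; so the two coincide.\<close>

lemma central_simple_lifts:
  assumes \<rho>: "\<rho> \<in> hom G (Aut_module R M)" and nz: "carrier V\<^sub>E \<noteq> {\<zero>\<^bsub>V\<^sub>E\<^esub>}"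
    and cs: "central_simple_rep k V\<^sub>k G (base_change_rep R k res M \<rho>)"
  shows "central_simple_rep E V\<^sub>E G (base_change_rep R E \<iota> M \<rho>)"
  unfolding central_simple_rep_def
proof (intro allI impI)
  fix A assume A: "normal_subalgebra E V\<^sub>E G (base_change_rep R E \<iota> M \<rho>) A"
  let ?A = "\<E>\<^sub>E\<lparr>carrier := A\<rparr>" and ?B = "\<E>\<^sub>k\<lparr>carrier := reduction A\<rparr>"
  interpret ME: module E \<E>\<^sub>E by (rule module_E)
  interpret RE: ring \<E>\<^sub>E by (rule ring_E)
  interpret VE: module E V\<^sub>E by (rule modules)
  have subm: "submodule A E \<E>\<^sub>E" by (rule normal_subalgebra_submodule[OF modules(1) A])
  have sub: "subring A \<E>\<^sub>E" using A by (simp add: normal_subalgebra_def)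
  note A' = subringE[OF sub] and Am = ME.submoduleE[OF subm]
  have B: "normal_subalgebra k V\<^sub>k G (base_change_rep R k res M \<rho>) (reduction A)"
    by (rule normal_subalgebra_reduction[OF \<rho> A])
  have csB: "central_simple_algebra k ?B" using cs B by (simp add: central_simple_rep_def)
  have assoc: "(a \<odot>\<^bsub>\<E>\<^sub>E\<^esub> x) \<otimes>\<^bsub>\<E>\<^sub>E\<^esub> y = a \<odot>\<^bsub>\<E>\<^sub>E\<^esub> (x \<otimes>\<^bsub>\<E>\<^sub>E\<^esub> y)"
    "x \<otimes>\<^bsub>\<E>\<^sub>E\<^esub> (a \<odot>\<^bsub>\<E>\<^sub>E\<^esub> y) = a \<odot>\<^bsub>\<E>\<^sub>E\<^esub> (x \<otimes>\<^bsub>\<E>\<^sub>E\<^esub> y)"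
    if "a \<in> carrier E" "x \<in> carrier \<E>\<^sub>E" "y \<in> carrier \<E>\<^sub>E" for a x y
    using that algebras(1) by (auto simp: assoc_algebra_def)
  \<comment> \<open>A nonzero generic fibre keeps the identity apart from zero, so no subalgebra is
    the zero ring.\<close>
  have one_nz: "\<one>\<^bsub>\<E>\<^sub>E\<^esub> \<noteq> \<zero>\<^bsub>\<E>\<^sub>E\<^esub>"
  proof
    assume "\<one>\<^bsub>\<E>\<^sub>E\<^esub> = \<zero>\<^bsub>\<E>\<^sub>E\<^esub>"
    then have "(\<lambda>x\<in>carrier V\<^sub>E. x) v = (\<lambda>x\<in>carrier V\<^sub>E. \<zero>\<^bsub>V\<^sub>E\<^esub>) v" for v
      unfolding End_module_simps by simp
    then have "v = \<zero>\<^bsub>V\<^sub>E\<^esub>" if "v \<in> carrier V\<^sub>E" for v using that by (metis restrict_apply')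
    then show False using nz VE.M.zero_closed by blast
  qed
  have ideals: "I = {\<zero>\<^bsub>\<E>\<^sub>E\<^esub>} \<or> I = A" if I: "ideal I ?A" for I
  proof -
    interpret I: ideal I ?A by (rule I)
    have IA: "I \<subseteq> A" using I.a_subset by simp
    have l: "x \<otimes>\<^bsub>\<E>\<^sub>E\<^esub> y \<in> I" if "y \<in> I" "x \<in> A" for x y using I.I_l_closed[of y x] that by simp
    have r: "y \<otimes>\<^bsub>\<E>\<^sub>E\<^esub> x \<in> I" if "y \<in> I" "x \<in> A" for x y using I.I_r_closed[of y x] that by simp
    have add: "x \<oplus>\<^bsub>\<E>\<^sub>E\<^esub> y \<in> I" if "x \<in> I" "y \<in> I" for x y using additive_subgroup.a_closed[OF I.is_additive_subgroup that] by simp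
    have zero: "\<zero>\<^bsub>\<E>\<^sub>E\<^esub> \<in> I" using additive_subgroup.zero_closed[OF I.is_additive_subgroup] by simp
    \<comment> \<open>Ring ideals carry no scalar action by definition; stability under
      \<open>E\<close> comes from the scalar multiples of the identity, which lie in
      \<open>A\<close>.\<close>
    have sm: "a \<odot>\<^bsub>\<E>\<^sub>E\<^esub> x \<in> I" if a: "a \<in> carrier E" and x: "x \<in> I" for a x
    proof -
      have "a \<odot>\<^bsub>\<E>\<^sub>E\<^esub> x = (a \<odot>\<^bsub>\<E>\<^sub>E\<^esub> \<one>\<^bsub>\<E>\<^sub>E\<^esub>) \<otimes>\<^bsub>\<E>\<^sub>E\<^esub> x"
        using a x IA A'(1) by (subst assoc(1)) auto
      then show ?thesis using l[OF x Am(4)[OF a A'(3)]] by simp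
    qed
    have Isub: "submodule I E \<E>\<^sub>E"
      by (rule ME.submoduleI') (use IA A'(1) zero add sm in auto)
    have "module k ?B" and "ring ?B" using csB by (auto simp: central_simple_algebra_def assoc_algebra_def)
    interpret MB: module k ?B by fact
    have rsub: "reduction I \<subseteq> reduction A" using IA by (auto simp: reduction_def)
    \<comment> \<open>Negatives, which the ideal property requires, come from multiplication by
      minus one in \<open>k\<close>.\<close>
    have "submodule (reduction I) k ?B"
      by (rule MB.submoduleI')
        (use rsub reduction_zero[OF zero] reduction_add[OF add] reduction_smult[OF sm] in auto)
    then have "subgroup (reduction I) (add_monoid ?B)" by (rule submodule.axioms(1))
    then have "ideal (reduction I) ?B"
      using \<open>ring ?B\<close> reduction_mult[of A I I] reduction_mult[of I A I] l r
      by (intro idealI) auto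
    then consider "reduction I = {\<zero>\<^bsub>\<E>\<^sub>k\<^esub>}" | "reduction I = reduction A"
      using csB by (auto simp: central_simple_algebra_def)
    then show ?thesis
    proof cases
      case 1
      \<comment> \<open>The zero subspace is the smaller member of the comparison; its reduction
        contains zero, which is all of the reduction of \<open>I\<close>.\<close>
      have "submodule {\<zero>\<^bsub>\<E>\<^sub>E\<^esub>} E \<E>\<^sub>E" by (rule ME.submoduleI') auto
      then have "{\<zero>\<^bsub>\<E>\<^sub>E\<^esub>} = I"
        using 1 zero reduction_zero[of "{\<zero>\<^bsub>\<E>\<^sub>E\<^esub>}"]
        by (intro subspace_eq_if_reduction_subset Isub) auto
      then show ?thesis by simp
    next
      case 2
      then have "I = A" using IA by (intro subspace_eq_if_reduction_subset Isub subm) auto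
      then show ?thesis by simp
    qed
  qed
  let ?C = "algebra_center ?A"
  have C: "?C = {x \<in> A. \<forall>y\<in>A. x \<otimes>\<^bsub>\<E>\<^sub>E\<^esub> y = y \<otimes>\<^bsub>\<E>\<^sub>E\<^esub> x}" by (simp add: algebra_center_def)
  have cA: "x \<in> carrier \<E>\<^sub>E" if "x \<in> A" for x using that A'(1) by blast
  have Csub: "submodule ?C E \<E>\<^sub>E"
    unfolding C
    by (rule ME.submoduleI')
      (use A' Am cA in \<open>auto simp: assoc RE.l_distr RE.r_distr\<close>)
  have "scalars E \<E>\<^sub>E \<subseteq> ?C"
    unfolding C using A'(3) Am(4) cA by (auto simp: scalars_def assoc)
  moreover have "reduction ?C \<subseteq> reduction (scalars E \<E>\<^sub>E)"
  proof -
    have "reduction ?C \<subseteq> algebra_center ?B"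
    proof
      fix u assume "u \<in> reduction ?C"
      then obtain g where g: "g \<in> linear_maps R M M" "gen g \<in> ?C" "u = spec g" by (rule reductionE)
      have "u \<otimes>\<^bsub>\<E>\<^sub>k\<^esub> v = v \<otimes>\<^bsub>\<E>\<^sub>k\<^esub> u" if v: "v \<in> reduction A" for v
      proof -
        obtain h where h: "h \<in> linear_maps R M M" "gen h \<in> A" "v = spec h" using v by (rule reductionE)
        \<comment> \<open>Lifts of \<open>u\<close> and \<open>v\<close> need to commute only over
          \<open>E\<close>: the two products over \<open>R\<close> then have the same generic fibre,
          hence the same special fibre.\<close>
        have "compose (carrier V\<^sub>E) (gen g) (gen h) = compose (carrier V\<^sub>E) (gen h) (gen g)"
          using g(2) h(2) unfolding C End_module_simps by blast
        then have "gen (compose (carrier M) g h) = gen (compose (carrier M) h g)"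
          using g h by (simp add: XE.base_change_map_compose)
        then have "spec (compose (carrier M) g h) = spec (compose (carrier M) h g)"
          using g h by (intro gen_eq_imp_spec_eq module.End_module_closed(1)[OF module])
        then show ?thesis using g h by (simp add: Xk.base_change_map_compose End_module_simps)
      qed
      moreover have "u \<in> reduction A" using g by (auto simp: C intro: reductionI)
      ultimately show "u \<in> algebra_center ?B" by (simp add: algebra_center_def)
    qed
    also have "algebra_center ?B = scalars k \<E>\<^sub>k"
      using csB by (simp add: central_simple_algebra_def scalars_def)
    finally show ?thesis using scalars_subset_reduction by blast
  qed
  ultimately have "scalars E \<E>\<^sub>E = ?C"
    by (intro subspace_eq_if_reduction_subset scalars_submodule Csub)
  then have "algebra_center ?A = scalars E ?A" by (simp add: scalars_def)
  moreover have "assoc_algebra E ?A" by (rule assoc_algebra_subalgebra[OF algebras(1) sub subm])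
  ultimately show "central_simple_algebra E ?A"
    using field_E finite_dimensional_subalgebra[OF subm] A'(3) one_nz ideals
    by (auto simp: central_simple_algebra_def)
qed

end

section \<open>Bases of the generic fibre and the conclusion\<close>

lemma finite_basis_imp_finite_dimensional:
  assumes "finite_basis K V B" shows "finite_dimensional K V"
  unfolding finite_dimensional_def
proof (intro exI[of _ B] conjI ballI)
  note b = assms[unfolded finite_basis_def]
  show "finite B" using b by (rule conjunct1)
  show "B \<subseteq> carrier V" using b[THEN conjunct2] by (rule conjunct1)
  show "\<exists>c. c \<in> B \<rightarrow>\<^sub>E carrier K \<and> v = (\<Oplus>\<^bsub>V\<^esub>b\<in>B. c b \<odot>\<^bsub>V\<^esub> b)" if "v \<in> carrier V" for v
    by (rule ex1_implies_ex[OF bspec[OF b[THEN conjunct2, THEN conjunct2] that]])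
qed

text \<open>In the zero module every coefficient family represents zero, so uniqueness would
  identify the constant families zero and one on a nonempty \<open>B\<close>.\<close>

lemma finite_basis_nonempty_imp_nonzero:
  assumes "field E" "module E V" "finite_basis E V B" "B \<noteq> {}"
  shows "carrier V \<noteq> {\<zero>\<^bsub>V\<^esub>}"
proof
  assume V0: "carrier V = {\<zero>\<^bsub>V\<^esub>}"
  interpret E: field E by fact
  interpret V: module E V by fact
  have B: "B \<subseteq> carrier V"
    and uniq: "\<exists>!c. c \<in> B \<rightarrow>\<^sub>E carrier E \<and> \<zero>\<^bsub>V\<^esub> = (\<Oplus>\<^bsub>V\<^esub>b\<in>B. c b \<odot>\<^bsub>V\<^esub> b)"
    using assms(3) V0 by (auto simp: finite_basis_def)
  obtain e where e: "\<And>c. c \<in> B \<rightarrow>\<^sub>E carrier E \<Longrightarrow> \<zero>\<^bsub>V\<^esub> = (\<Oplus>\<^bsub>V\<^esub>b\<in>B. c b \<odot>\<^bsub>V\<^esub> b) \<Longrightarrow> c = e"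
    using uniq by (elim ex1E) blast
  have ce: "c = e" if c: "c \<in> B \<rightarrow>\<^sub>E carrier E" for c
  proof -
    have "(\<Oplus>\<^bsub>V\<^esub>b\<in>B. c b \<odot>\<^bsub>V\<^esub> b) \<in> carrier V" using B c by (intro V.M.finsum_closed) auto
    then show ?thesis using V0 e[OF c] by simp
  qed
  have eq: "(\<lambda>b\<in>B. \<zero>\<^bsub>E\<^esub>) = (\<lambda>b\<in>B. \<one>\<^bsub>E\<^esub>)"
    using ce[of "\<lambda>b\<in>B. \<zero>\<^bsub>E\<^esub>"] ce[of "\<lambda>b\<in>B. \<one>\<^bsub>E\<^esub>"] by simp
  obtain b where "b \<in> B" using assms(4) by blast
  then have "\<zero>\<^bsub>E\<^esub> = \<one>\<^bsub>E\<^esub>" using fun_cong[OF eq, of b] by simp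
  then show False using E.zero_not_one by simp
qed

theorem theorem4p11:
  fixes D :: "('a, 'x) ring_scheme"
    and E :: "('e, 'y) ring_scheme"
    and \<iota> :: "'a \<Rightarrow> 'e"
    and T :: "('a, 't, 'z) module_scheme"
    and G :: "('g, 'w) monoid_scheme"
    and \<rho> :: "'g \<Rightarrow> 't \<Rightarrow> 't"
    and \<mm> :: "'a set"
    and n :: nat
  assumes "dedekind_ring D E \<iota>"
    and "module D T"
    and "projective_module D T"
    and "has_rank D E \<iota> T n" and "n > 0"
    and "maximalideal \<mm> D"
    and "group G"
    and "\<rho> \<in> hom G (Aut_module D T)"
  shows "(central_simple_rep (D Quot \<mm>)
            (base_change D (D Quot \<mm>) (\<lambda>a. \<mm> +>\<^bsub>D\<^esub> a) T) G
            (base_change_rep D (D Quot \<mm>) (\<lambda>a. \<mm> +>\<^bsub>D\<^esub> a) T \<rho>)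
          \<longrightarrow> central_simple_rep E (base_change D E \<iota> T) G (base_change_rep D E \<iota> T \<rho>))
       \<and> (very_simple_rep (D Quot \<mm>)
            (base_change D (D Quot \<mm>) (\<lambda>a. \<mm> +>\<^bsub>D\<^esub> a) T) G
            (base_change_rep D (D Quot \<mm>) (\<lambda>a. \<mm> +>\<^bsub>D\<^esub> a) T \<rho>)
          \<longrightarrow> very_simple_rep E (base_change D E \<iota> T) G (base_change_rep D E \<iota> T \<rho>))"
proof -
  have E: "field E" and inj: "inj_on \<iota> (carrier D)" and hom: "\<iota> \<in> ring_hom D E"
    using assms(1) by (auto simp: dedekind_ring_def field_of_fractions_def)
  interpret S: scalar_extension D E \<iota> T
    using assms(2) hom fieldE(1)[OF E] by (simp add: scalar_extension_def scalar_extension_axioms_def)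
  obtain B where B: "finite_basis E (base_change D E \<iota> T) B" "card B = n"
    using assms(4) by (auto simp: has_rank_def)
  then have "finite_dimensional E (base_change D E \<iota> T)"
    by (intro finite_basis_imp_finite_dimensional)
  then obtain J t \<phi> where "dual_basis D T (J :: 't set) t \<phi>"
    using S.finite_dual_basis_exists[OF assms(3) inj] by blast
  then interpret dedekind_lattice D E \<iota> T \<mm> J t \<phi>
    using assms by (simp add: dedekind_lattice_def)
  \<comment> \<open>Positive rank enters here: it makes the generic fibre nonzero, as
    \<open>central_simple_lifts\<close> requires.\<close>
  have "B \<noteq> {}" using B(2) assms(5) by auto
  then have "carrier (base_change D E \<iota> T) \<noteq> {\<zero>\<^bsub>base_change D E \<iota> T\<^esub>}"
    using finite_basis_nonempty_imp_nonzero[OF E modules(1) B(1)] by blast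
  then show ?thesis
    using central_simple_lifts[OF assms(8)] very_simple_lifts[OF assms(8)] by blast
qed

end
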